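(* Let $\mathit{JL}$ be the Johnson–Lindenstrauss space associated with a family $\{N_\gamma:\gamma\in\Gamma\}$ as described in the context, let $V=c_0\subset \mathit{JL}$, let $J_V\colon V\to \mathit{JL}$ be the inclusion and $Q_V\colon \mathit{JL}\to \mathit{JL}/V$ the quotient map. Then: (i) $J_V$ is a subprojective operator. (ii) $Q_V$ is a superprojective operator. (iii) $\mathit{JL}$ is both subprojective and superprojective. (iv) The dual $\mathit{JL}^*$ is subprojective but not superprojective. (v) The bidual $\mathit{JL}^{**}$ is neither subprojective nor superprojective.
   Context: Construction of $\mathit{JL}$: let $\Gamma$ be a set with the cardinality of the continuum and let $\{N_\gamma:\gamma\in\Gamma\}$ be any family of infinite subsets of $\mathbb{N}$ such that $N_\gamma\cap N_{\gamma'}$ is finite whenever $\gamma\neq\gamma'$. For $\gamma\in\Gamma$ let $\phi_\gamma\in\ell_\infty$ be the characteristic function of $N_\gamma$. Let $V=c_0\subset\ell_\infty$ and let $\mathit{JL}_0$ be the linear span of $V\cup\{\phi_\gamma:\gamma\in\Gamma\}$ in $\ell_\infty$ with the norm $$\Bigl\|y+\sum_{i=1}^k a_i\phi_{\gamma_i}\Bigr\|_{\mathit{JL}}=\max\Bigl\{\Bigl\|y+\sum_{i=1}^k a_i\phi_{\gamma_i}\Bigr\|_\infty,\ \bigl\|(a_i)_{i=1}^k\bigr\|_2\Bigr\}$$ for $y\in V$, scalars $a_i$ and pairwise distinct $\gamma_1,\dots,\gamma_k\in\Gamma$. $\mathit{JL}$ is the completion of $(\mathit{JL}_0,\|\cdot\|_{\mathit{JL}})$;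 $V$ is a closed subspace of $\mathit{JL}$, isometric to $c_0$. (The space may depend on the family $\{N_\gamma\}$; the result holds for every such family.) Operators are bounded and linear. For a closed subspace $M$ of a Banach space $E$, $J_M\colon M\to E$ is the inclusion and $Q_M\colon E\to E/M$ is the quotient map. A complemented subspace is one that is the range of a bounded projection (in particular closed). "$TJ_M$ is an isomorphism" means that the restriction of $T$ to $M$ is an isomorphism onto its range (bounded below). A Banach space $X$ is subprojective if every closed infinite-dimensional subspace of $X$ contains an infinite-dimensional subspace complemented in $X$. It is superprojective if every closed infinite-codimensional subspace of $X$ is contained in an infinite-codimensional subspace complemented in $X$. An operator $T\colon X\to Y$ between Banach spaces is subprojective if every closed infinite-dimensional subspace $M$ of $X$ such that $TJ_M$ is an isomorphism contains a closed infinite-dimensional subspace $N$ such that $T(N)$ is complemented in $Y$. It is superprojective if every closed infinite-codimensional subspace $M$ of $Y$ such that $Q_MT$ is surjective is contained in a closed infinite-codimensional subspace $N$ of $Y$ such that $T^{-1}(N)$ is complemented in $X$. *)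

theory Defs
  imports "HOL-Analysis.Analysis" "HOL-Library.Equipollence"
begin

section \<open>Subspaces, quotients and complements\<close>

definition infinite_dimensional :: "'a::real_vector set \<Rightarrow> bool" where
  "infinite_dimensional M \<longleftrightarrow> \<not> (\<exists>B. finite B \<and> M \<subseteq> span B)"

text \<open>A finite set \<open>B\<close> satisfies \<open>span (M \<union> B) = UNIV\<close> iff the cosets of its
  elements span the quotient by \<open>M\<close>.\<close>

definition infinite_codimensional :: "'a::real_vector set \<Rightarrow> bool" where
  "infinite_codimensional M \<longleftrightarrow> \<not> (\<exists>B. finite B \<and> span (M \<union> B) = UNIV)"

definition complemented :: "'a::banach set \<Rightarrow> bool" where
  "complemented N \<longleftrightarrow> (\<exists>P :: 'a \<Rightarrow>\<^sub>L 'a. (\<forall>x. P (P x) = P x) \<and> range P = N)"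

text \<open>The quotient of a Banach space by \<open>M\<close>, as a set of cosets, is \<open>range (coset M)\<close>.\<close>

definition coset :: "'a::real_vector set \<Rightarrow> 'a \<Rightarrow> 'a set" where
  "coset M x = (\<lambda>m. x + m) ` M"

text \<open>\<open>Q\<close> exhibits the Banach space \<open>'b\<close> as the quotient of \<open>'a\<close> by the closed subspace \<open>M\<close>:
  the elements of \<open>'b\<close> correspond to the cosets of \<open>M\<close>, and they carry the quotient norm
  \<open>inf {\<parallel>x - m\<parallel> | m \<in> M}\<close>.\<close>

definition is_quotient_by :: "'a::banach set \<Rightarrow> ('a \<Rightarrow>\<^sub>L 'b::banach) \<Rightarrow> bool" where
  "is_quotient_by M Q \<longleftrightarrow> subspace M \<and> closed M \<and> surj Q \<and>
     (\<forall>x x'. Q x = Q x' \<longleftrightarrow> coset M x = coset M x') \<and>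
     (\<forall>x. norm (Q x) = infdist x M)"


section \<open>Subprojective and superprojective spaces and operators\<close>

definition subprojective_space :: "'a::banach itself \<Rightarrow> bool" where
  "subprojective_space _ \<longleftrightarrow>
     (\<forall>M :: 'a set. subspace M \<and> closed M \<and> infinite_dimensional M \<longrightarrow>
        (\<exists>N \<subseteq> M. subspace N \<and> infinite_dimensional N \<and> complemented N))"

definition superprojective_space :: "'a::banach itself \<Rightarrow> bool" where
  "superprojective_space _ \<longleftrightarrow>
     (\<forall>M :: 'a set. subspace M \<and> closed M \<and> infinite_codimensional M \<longrightarrow>
        (\<exists>N. M \<subseteq> N \<and> subspace N \<and> infinite_codimensional N \<and> complemented N))"

text \<open>The domain of an inclusion such as \<open>J_V\<close> is a closed subspace \<open>X\<close> of a Banach space.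
  Operators on such a domain are given by functions of which only the values on \<open>X\<close> matter.\<close>

definition operator_on :: "'a::banach set \<Rightarrow> ('a \<Rightarrow> 'b::banach) \<Rightarrow> bool" where
  "operator_on X T \<longleftrightarrow> subspace X \<and> closed X \<and>
     (\<forall>x\<in>X. \<forall>y\<in>X. T (x + y) = T x + T y) \<and>
     (\<forall>c. \<forall>x\<in>X. T (c *\<^sub>R x) = c *\<^sub>R T x) \<and>
     (\<exists>K. \<forall>x\<in>X. norm (T x) \<le> K * norm x)"

definition bounded_below_on :: "'a::real_normed_vector set \<Rightarrow> ('a \<Rightarrow> 'b::real_normed_vector) \<Rightarrow> bool" where
  "bounded_below_on M T \<longleftrightarrow> (\<exists>c>0. \<forall>x\<in>M. c * norm x \<le> norm (T x))"

definition subprojective_operator :: "'a::banach set \<Rightarrow> ('a \<Rightarrow> 'b::banach) \<Rightarrow> bool" where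
  "subprojective_operator X T \<longleftrightarrow> operator_on X T \<and>
     (\<forall>M \<subseteq> X. subspace M \<and> closed M \<and> infinite_dimensional M \<and> bounded_below_on M T \<longrightarrow>
        (\<exists>N \<subseteq> M. subspace N \<and> closed N \<and> infinite_dimensional N \<and> complemented (T ` N)))"

text \<open>The condition \<open>range (\<lambda>x. coset M (T x)) = range (coset M)\<close> is surjectivity of \<open>Q_M T\<close>.\<close>

definition superprojective_operator :: "('a::banach \<Rightarrow>\<^sub>L 'b::banach) \<Rightarrow> bool" where
  "superprojective_operator T \<longleftrightarrow>
     (\<forall>M. subspace M \<and> closed M \<and> infinite_codimensional M \<and>
          range (\<lambda>x. coset M (T x)) = range (coset M) \<longrightarrow>
        (\<exists>N. M \<subseteq> N \<and> subspace N \<and> closed N \<and> infinite_codimensional N \<and> complemented (T -` N)))"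


section \<open>The Johnson--Lindenstrauss space\<close>

text \<open>The type \<open>nat \<Rightarrow>\<^sub>C real\<close> of bounded (continuous) functions on the discrete space \<open>nat\<close>
  with the supremum norm is the real space \<open>\<ell>\<^sub>\<infinity>\<close>.\<close>

definition c0 :: "(nat \<Rightarrow>\<^sub>C real) set" where
  "c0 = {y. (\<lambda>n. apply_bcontfun y n) \<longlonglongrightarrow> 0}"

definition phi :: "('g \<Rightarrow> nat set) \<Rightarrow> 'g \<Rightarrow> (nat \<Rightarrow>\<^sub>C real)" where
  "phi N \<gamma> = Bcontfun (indicator (N \<gamma>))"

definition JL0 :: "'g set \<Rightarrow> ('g \<Rightarrow> nat set) \<Rightarrow> (nat \<Rightarrow>\<^sub>C real) set" where
  "JL0 \<Gamma> N = span (c0 \<union> phi N ` \<Gamma>)"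

text \<open>The value is unique, see \<open>JL_norm_eq\<close> below; \<open>norm x\<close> is the supremum norm
  and \<open>L2_set a F\<close> is the Euclidean norm of \<open>(a \<gamma>)\<close>, \<open>\<gamma> \<in> F\<close>.\<close>

definition JL_norm :: "'g set \<Rightarrow> ('g \<Rightarrow> nat set) \<Rightarrow> (nat \<Rightarrow>\<^sub>C real) \<Rightarrow> real" where
  "JL_norm \<Gamma> N x = (THE r. \<exists>y\<in>c0. \<exists>F a. finite F \<and> F \<subseteq> \<Gamma> \<and>
     x = y + (\<Sum>\<gamma>\<in>F. a \<gamma> *\<^sub>R phi N \<gamma>) \<and> r = max (norm x) (L2_set a F))"

text \<open>\<open>\<iota>\<close> exhibits the Banach space \<open>'b\<close> as the completion of the space \<open>S\<close> normed by \<open>\<nu>\<close>.\<close>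

definition is_completion :: "'a::real_vector set \<Rightarrow> ('a \<Rightarrow> real) \<Rightarrow> ('a \<Rightarrow> 'b::banach) \<Rightarrow> bool" where
  "is_completion S \<nu> \<iota> \<longleftrightarrow>
     (\<forall>x\<in>S. \<forall>y\<in>S. \<iota> (x + y) = \<iota> x + \<iota> y) \<and>
     (\<forall>c. \<forall>x\<in>S. \<iota> (c *\<^sub>R x) = c *\<^sub>R \<iota> x) \<and>
     (\<forall>x\<in>S. norm (\<iota> x) = \<nu> x) \<and>
     closure (\<iota> ` S) = UNIV"

lemma phi_apply: "apply_bcontfun (phi N \<gamma>) = indicator (N \<gamma>)"
  unfolding phi_def
proof (rule Bcontfun_inverse)
  have "bounded (range (indicator (N \<gamma>) :: nat \<Rightarrow> real))"
    by (rule boundedI[where B = 1]) (auto simp: indicator_def)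
  then show "(indicator (N \<gamma>) :: nat \<Rightarrow> real) \<in> bcontfun"
    by (simp add: bcontfun_def)
qed

lemma apply_bcontfun_sum:
  "apply_bcontfun (\<Sum>i\<in>F. f i) n = (\<Sum>i\<in>F. apply_bcontfun (f i) n)"
  by (induction F rule: infinite_finite_induct) (auto simp: plus_bcontfun.rep_eq)

lemma JL_coeff_limit:
  fixes a :: "'g \<Rightarrow> real"
  assumes inf: "infinite (N \<gamma>0)"
    and ad: "\<And>\<gamma>. \<gamma> \<in> F \<Longrightarrow> \<gamma> \<noteq> \<gamma>0 \<Longrightarrow> finite (N \<gamma> \<inter> N \<gamma>0)"
    and F: "finite F" and y: "y \<in> c0"
  shows "(\<lambda>k. apply_bcontfun (y + (\<Sum>\<gamma>\<in>F. a \<gamma> *\<^sub>R phi N \<gamma>)) (enumerate (N \<gamma>0) k))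
           \<longlonglongrightarrow> (if \<gamma>0 \<in> F then a \<gamma>0 else 0)"
proof -
  let ?e = "enumerate (N \<gamma>0)"
  have sm: "strict_mono ?e"
    using inf by (simp add: strict_mono_enumerate)
  have e_in: "?e k \<in> N \<gamma>0" for k
    using inf by (simp add: enumerate_in_set)
  have lim_y: "(\<lambda>k. apply_bcontfun y (?e k)) \<longlonglongrightarrow> 0"
    using LIMSEQ_subseq_LIMSEQ[OF _ sm, of "apply_bcontfun y" 0] y by (simp add: c0_def o_def)
  have lim_i: "(\<lambda>k. a \<gamma> * indicator (N \<gamma>) (?e k)) \<longlonglongrightarrow> (if \<gamma> = \<gamma>0 then a \<gamma> else 0)"
    if "\<gamma> \<in> F" for \<gamma>
  proof (cases "\<gamma> = \<gamma>0")
    case True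
    then show ?thesis by (simp add: e_in)
  next
    case False
    have "finite {k. ?e k \<in> N \<gamma> \<inter> N \<gamma>0}"
      using finite_vimageI[OF ad[OF that False], of ?e] strict_mono_imp_inj_on[OF sm]
      by (simp add: vimage_def)
    then have "\<forall>\<^sub>F k in sequentially. ?e k \<notin> N \<gamma> \<inter> N \<gamma>0"
      by (simp add: eventually_cofinite flip: cofinite_eq_sequentially)
    then have "\<forall>\<^sub>F k in sequentially. a \<gamma> * indicator (N \<gamma>) (?e k) = 0"
      by eventually_elim (simp add: e_in)
    then show ?thesis
      using False by (simp add: tendsto_eventually)
  qed
  have "(\<lambda>k. apply_bcontfun y (?e k) + (\<Sum>\<gamma>\<in>F. a \<gamma> * indicator (N \<gamma>) (?e k)))
      \<longlonglongrightarrow> 0 + (\<Sum>\<gamma>\<in>F. if \<gamma> = \<gamma>0 then a \<gamma> else 0)"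
    by (intro tendsto_add lim_y tendsto_sum lim_i)
  then show ?thesis
    using F by (simp add: plus_bcontfun.rep_eq apply_bcontfun_sum scaleR_bcontfun.rep_eq phi_apply)
qed

text \<open>The norm of \<open>JL0\<close> does not depend on the chosen representation.\<close>

lemma JL_norm_eq:
  assumes inf: "\<And>\<gamma>. \<gamma> \<in> \<Gamma> \<Longrightarrow> infinite (N \<gamma>)"
    and ad: "\<And>\<gamma> \<gamma>'. \<gamma> \<in> \<Gamma> \<Longrightarrow> \<gamma>' \<in> \<Gamma> \<Longrightarrow> \<gamma> \<noteq> \<gamma>' \<Longrightarrow> finite (N \<gamma> \<inter> N \<gamma>')"
    and y: "y \<in> c0" and F: "finite F" "F \<subseteq> \<Gamma>"
  shows "JL_norm \<Gamma> N (y + (\<Sum>\<gamma>\<in>F. a \<gamma> *\<^sub>R phi N \<gamma>)) =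
     max (norm (y + (\<Sum>\<gamma>\<in>F. a \<gamma> *\<^sub>R phi N \<gamma>))) (L2_set a F)"
  unfolding JL_norm_def
proof (rule the_equality)
  let ?x = "y + (\<Sum>\<gamma>\<in>F. a \<gamma> *\<^sub>R phi N \<gamma>)"
  show "\<exists>y'\<in>c0. \<exists>F' a'. finite F' \<and> F' \<subseteq> \<Gamma> \<and> ?x = y' + (\<Sum>\<gamma>\<in>F'. a' \<gamma> *\<^sub>R phi N \<gamma>) \<and>
      max (norm ?x) (L2_set a F) = max (norm ?x) (L2_set a' F')"
    using y F by blast
  fix r
  assume "\<exists>y'\<in>c0. \<exists>F' a'. finite F' \<and> F' \<subseteq> \<Gamma> \<and> ?x = y' + (\<Sum>\<gamma>\<in>F'. a' \<gamma> *\<^sub>R phi N \<gamma>) \<and>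
      r = max (norm ?x) (L2_set a' F')"
  then obtain y' F' a' where y': "y' \<in> c0" and F': "finite F'" "F' \<subseteq> \<Gamma>"
    and eq: "?x = y' + (\<Sum>\<gamma>\<in>F'. a' \<gamma> *\<^sub>R phi N \<gamma>)"
    and r: "r = max (norm ?x) (L2_set a' F')"
    by blast
  have coeff: "(if \<gamma> \<in> F then a \<gamma> else 0) = (if \<gamma> \<in> F' then a' \<gamma> else 0)" if "\<gamma> \<in> \<Gamma>" for \<gamma>
  proof (rule LIMSEQ_unique)
    let ?s = "\<lambda>k. apply_bcontfun ?x (enumerate (N \<gamma>) k)"
    show "?s \<longlonglongrightarrow> (if \<gamma> \<in> F then a \<gamma> else 0)"
      using F that by (intro JL_coeff_limit inf ad y) auto
    show "?s \<longlonglongrightarrow> (if \<gamma> \<in> F' then a' \<gamma> else 0)"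
      unfolding eq using F' that by (intro JL_coeff_limit inf ad y') auto
  qed
  have ext: "L2_set b G = L2_set (\<lambda>\<gamma>. if \<gamma> \<in> G then b \<gamma> else 0) (F \<union> F')"
    if "G \<subseteq> F \<union> F'" for b and G
    unfolding L2_set_def
    by (rule arg_cong[where f = sqrt], rule sum.mono_neutral_cong_left)
      (use that F F' in auto)
  have "L2_set a F = L2_set a' F'"
    unfolding ext[of F a, simplified] ext[of F' a', simplified]
    by (rule L2_set_cong) (use coeff F F' in blast)+
  then show "r = max (norm ?x) (L2_set a F)"
    using r by simp
qed

end

theory Submission
  imports Defs "HOL-Library.Diagonal_Subsequence"
begin

text \<open>JL embeds isometrically into the direct sum of \<open>\<ell>\<^sub>\<infinity>\<close> and \<open>\<ell>\<^sub>2(\<Gamma>)\<close>, with \<open>c0\<close> as the kernel of the map to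
  \<open>\<ell>\<^sub>2(\<Gamma>)\<close>. An infinite-dimensional closed subspace on which that map is bounded below up to finite codimension
  contains a complemented Hilbert space. Otherwise it contains a perturbation of normalized blocks in \<open>c0\<close>. A
  subsequence of the evaluations at peaks of the blocks converges pointwise, and subtracting the limit, which
  vanishes on \<open>c0\<close>, gives pointwise null biorthogonal functionals on all of JL and so a projection. The dual is
  treated in the same way with \<open>\<ell>\<^sub>1\<close> for \<open>c0\<close>, and superprojectivity of JL by running the argument in the
  annihilator of the given subspace.

  For the negative results, \<open>c0\<close> is a quotient of the \<open>\<ell>\<^sub>1\<close> part of the dual, and a complement of a subspace
  containing the kernel would carry blocks that are \<open>\<ell>\<^sub>1\<close>-like in the dual and \<open>c0\<close>-like in the quotient. The bidual
  contains a complemented copy of \<open>\<ell>\<^sub>\<infinity>\<close>. The Rademacher functions span \<open>\<ell>\<^sub>1\<close> there, no infinite-dimensional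
  subspace of which is complemented by the little Grothendieck inequality, and generalized limits of Rademacher
  averages give a quotient map onto \<open>\<ell>\<^sub>2\<close>, which is 2-summing.\<close>

section \<open>Infinite dimension and codimension\<close>

text \<open>The obstacle is that JL is not separable and that c0 is not the range of a projection of
  JL: the countably many evaluations separate the points of JL, while no countable family of
  functionals does so on l2 of an uncountable index set. Projections onto blocks therefore cannot be
  found by first projecting onto c0, and pointwise convergent subsequences of functionals cannot be
  found by diagonalizing over a countable dense set. The way out is that functionals tending to 0 on
  c0 are governed in the limit by square summable values at the \<phi> \<gamma>: at each precision
  only finitely many \<gamma> matter, so a diagonal sequence exists although the index set is
  uncountable. In the dual the difficulty disappears, as the l1 part is the range of an explicit
  projection. Statement (i) is the subprojectivity of JL applied to subspaces of c0, and (ii) is the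
  superprojectivity of JL pulled back along the quotient map.\<close>

lemma subspace_inter_kernels:
  fixes f :: "'i \<Rightarrow> 'a::real_vector \<Rightarrow> real"
  assumes "subspace M" "\<And>i. i \<in> I \<Longrightarrow> linear (f i)"
  shows "subspace {x \<in> M. \<forall>i\<in>I. f i x = 0}"
  using assms unfolding subspace_def
  by (auto simp: linear_0 linear_add linear_scale)

lemma infinite_dimensional_inter_kernel:
  fixes f :: "'a::real_vector \<Rightarrow> real"
  assumes M: "subspace M" "infinite_dimensional M" and f: "linear f"
  shows "infinite_dimensional {x \<in> M. f x = 0}"
  unfolding infinite_dimensional_def
proof
  assume "\<exists>B. finite B \<and> {x \<in> M. f x = 0} \<subseteq> span B"
  then obtain B where B: "finite B" "{x \<in> M. f x = 0} \<subseteq> span B" by blast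
  show False
  proof (cases "\<forall>x\<in>M. f x = 0")
    case True
    then show ?thesis using B M(2) unfolding infinite_dimensional_def by blast
  next
    case False
    then obtain z where z: "z \<in> M" "f z \<noteq> 0" by blast
    have "x \<in> span (insert z B)" if x: "x \<in> M" for x
    proof -
      have "f (x - (f x / f z) *\<^sub>R z) = 0"
        using f z by (simp add: linear_diff linear_scale)
      moreover have "x - (f x / f z) *\<^sub>R z \<in> M"
        using M(1) x z(1) by (simp add: subspace_diff subspace_scale)
      ultimately have "x - (f x / f z) *\<^sub>R z \<in> span B"
        using B(2) by blast
      then show ?thesis
        using span_breakdown_eq by blast
    qed
    then show ?thesis
      using B(1) M(2) unfolding infinite_dimensional_def by (meson finite_insert subsetI)
  qed
qed

lemma infinite_dimensional_inter_kernels: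
  fixes f :: "'i \<Rightarrow> 'a::real_vector \<Rightarrow> real"
  assumes "finite I" "subspace M" "infinite_dimensional M" "\<And>i. i \<in> I \<Longrightarrow> linear (f i)"
  shows "infinite_dimensional {x \<in> M. \<forall>i\<in>I. f i x = 0}"
  using assms(1,4)
proof (induction I)
  case empty
  then show ?case using assms(3) by simp
next
  case (insert j I)
  have "infinite_dimensional {x \<in> {x \<in> M. \<forall>i\<in>I. f i x = 0}. f j x = 0}"
    using insert by (intro infinite_dimensional_inter_kernel subspace_inter_kernels assms(2)) auto
  moreover have "{x \<in> {x \<in> M. \<forall>i\<in>I. f i x = 0}. f j x = 0} = {x \<in> M. \<forall>i\<in>insert j I. f i x = 0}"
    by auto
  ultimately show ?case by simp
qed

lemma infinite_dimensional_nonzero: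
  assumes "infinite_dimensional M"
  obtains x where "x \<in> M" "x \<noteq> 0"
proof -
  have "\<not> M \<subseteq> span {}"
    using assms unfolding infinite_dimensional_def by blast
  then show ?thesis using that by auto
qed

text \<open>The source of new vectors in the inductive constructions: a normalized element of
  \<open>M\<close> on which the finitely many functionals singled out so far vanish.\<close>

lemma infinite_dimensional_unit_vector:
  fixes f :: "'i \<Rightarrow> 'a::real_normed_vector \<Rightarrow> real"
  assumes "finite I" "subspace M" "infinite_dimensional M" "\<And>i. i \<in> I \<Longrightarrow> linear (f i)"
  obtains x where "x \<in> M" "norm x = 1" "\<And>i. i \<in> I \<Longrightarrow> f i x = 0"
proof -
  obtain y where y: "y \<in> {x \<in> M. \<forall>i\<in>I. f i x = 0}" "y \<noteq> 0"
    using infinite_dimensional_nonzero[OF infinite_dimensional_inter_kernels[OF assms]] .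
  show ?thesis
  proof (rule that[of "(1 / norm y) *\<^sub>R y"])
    show "(1 / norm y) *\<^sub>R y \<in> M" using y assms(2) by (simp add: subspace_scale)
    show "norm ((1 / norm y) *\<^sub>R y) = 1" using y by simp
    show "f i ((1 / norm y) *\<^sub>R y) = 0" if "i \<in> I" for i
      using y assms(4)[OF that] that by (simp add: linear_scale)
  qed
qed

text \<open>Applying \<open>g m\<close> to a linear relation among the \<open>x k\<close> isolates
  the \<open>m\<close>-th coefficient, so the \<open>x k\<close> are independent, and an independent
  set inside the span of a finite set is finite.\<close>

lemma infinite_dimensional_biorthogonal:
  fixes x :: "nat \<Rightarrow> 'a::real_vector" and g :: "nat \<Rightarrow> 'a \<Rightarrow> real"
  assumes M: "\<And>n. x n \<in> M" and g: "\<And>n. linear (g n)"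
    and bi: "\<And>n m. g n (x m) = (if n = m then 1 else 0)"
  shows "infinite_dimensional M"
  unfolding infinite_dimensional_def
proof
  assume "\<exists>B. finite B \<and> M \<subseteq> span B"
  then obtain B where B: "finite B" "M \<subseteq> span B" by blast
  have "inj x"
    by (rule injI) (metis bi zero_neq_one)
  have "independent (range x)"
  proof
    assume "dependent (range x)"
    then obtain t a v where t: "finite t" "t \<subseteq> range x" "(\<Sum>v\<in>t. a v *\<^sub>R v) = 0" "v \<in> t" "a v \<noteq> 0"
      unfolding dependent_explicit by blast
    obtain m where m: "v = x m" using t by blast
    have "g m (\<Sum>v\<in>t. a v *\<^sub>R v) = (\<Sum>w\<in>t. a w * g m w)"
      using g by (simp add: linear_sum linear_scale)
    also have "\<dots> = (\<Sum>w\<in>t. if w = v then a v else 0)"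
    proof (rule sum.cong)
      fix w assume "w \<in> t"
      then obtain k where "w = x k" using t by blast
      then show "a w * g m w = (if w = v then a v else 0)"
        using m bi[of m k] \<open>inj x\<close> by (auto simp: inj_eq)
    qed simp
    also have "\<dots> = a v" using t by simp
    finally show False using t g by (simp add: linear_0)
  qed
  then have "finite (range x)"
    using independent_span_bound[OF B(1)] M B(2) by (metis image_subsetI subset_trans)
  then show False using \<open>inj x\<close> finite_imageD by blast
qed

text \<open>The functionals vanish on \<open>span M\<close>, so they see only the components of the
  \<open>x m\<close> in the finite-dimensional \<open>span B\<close>, which would again be
  biorthogonal to them.\<close>

lemma infinite_codimensional_biorthogonal:
  fixes x :: "nat \<Rightarrow> 'a::real_vector" and g :: "nat \<Rightarrow> 'a \<Rightarrow> real"
  assumes M: "\<And>n y. y \<in> M \<Longrightarrow> g n y = 0" and g: "\<And>n. linear (g n)"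
    and bi: "\<And>n m. g n (x m) = (if n = m then 1 else 0)"
  shows "infinite_codimensional M"
  unfolding infinite_codimensional_def
proof
  assume "\<exists>B. finite B \<and> span (M \<union> B) = UNIV"
  then obtain B where B: "finite B" "span (M \<union> B) = UNIV" by blast
  have "\<exists>b\<in>span B. x m - b \<in> span M" for m
  proof -
    have "x m \<in> span (M \<union> B)" using B by simp
    then obtain y b where "y \<in> span M" "b \<in> span B" "x m = y + b"
      unfolding span_Un by blast
    then show ?thesis by (intro bexI[of _ b]) auto
  qed
  then obtain b where b: "\<And>m. b m \<in> span B" "\<And>m. x m - b m \<in> span M"
    by metis
  have "g n y = 0" if "y \<in> span M" for n y
    using that by (induction rule: span_induct_alt) (auto simp: linear_0 linear_add linear_scale g M)
  then have "g n (x m - b m) = 0" for n m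
    using b by blast
  then have "g n (b m) = (if n = m then 1 else 0)" for n m
    using bi[of n m] linear_diff[OF g[of n], of "x m" "b m"] by simp
  then have "infinite_dimensional (span B)"
    by (intro infinite_dimensional_biorthogonal[where x = b, OF b(1) g])
  then show False
    using B(1) unfolding infinite_dimensional_def by blast
qed

section \<open>Projections and their perturbations\<close>

text \<open>For each \<open>y\<close> the map sending \<open>x\<close> to \<open>y - D x\<close> is
  a contraction, and its fixed point solves \<open>x + D x = y\<close>; uniqueness of the fixed
  point makes the solution linear in \<open>y\<close>.\<close>

lemma blinfun_id_plus_invertible:
  fixes D :: "'a::banach \<Rightarrow>\<^sub>L 'a"
  assumes D: "norm D < 1"
  obtains W :: "'a \<Rightarrow>\<^sub>L 'a" where "\<And>x. W (x + D x) = x" "\<And>x. W x + D (W x) = x"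
proof -
  have ex1: "\<exists>!x. y - D x = x" for y
  proof -
    have "dist (y - D x) (y - D z) \<le> norm D * dist x z" for x z
      using norm_blinfun[of D "z - x"]
      by (simp add: dist_norm blinfun.diff_right norm_minus_commute)
    then show ?thesis
      using banach_fix_type[of "norm D" "\<lambda>x. y - D x"] D by simp
  qed
  define w where "w y = (THE x. y - D x = x)" for y
  have w: "y - D (w y) = w y" for y
    unfolding w_def by (rule theI'[OF ex1])
  have w_uniq: "w y = x" if "y - D x = x" for x y
    using ex1[of y] w[of y] that by blast
  have "bounded_linear w"
  proof (rule bounded_linear_intro[where K = "1 / (1 - norm D)"])
    show "w (x + y) = w x + w y" for x y
      by (rule w_uniq) (use w[of x] w[of y] in \<open>simp add: blinfun.add_right algebra_simps\<close>)
    show "w (r *\<^sub>R x) = r *\<^sub>R w x" for r x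
      by (rule w_uniq) (simp add: w blinfun.scaleR_right flip: scaleR_right_diff_distrib)
    show "norm (w x) \<le> norm x * (1 / (1 - norm D))" for x
    proof -
      have "norm (w x) \<le> norm x + norm (D (w x))"
        using norm_triangle_ineq4[of x "D (w x)"] by (simp add: w)
      also have "\<dots> \<le> norm x + norm D * norm (w x)"
        using norm_blinfun[of D "w x"] by simp
      finally show ?thesis using D by (simp add: field_simps)
    qed
  qed
  then have "blinfun_apply (Blinfun w) = w"
    by (rule bounded_linear_Blinfun_apply)
  then show ?thesis
    by (intro that[of "Blinfun w"]) (simp_all add: w_uniq algebra_simps flip: w[unfolded diff_eq_eq])
qed

text \<open>A series of rank one operators that converges absolutely in operator norm; its sum is
  the error operator of the two perturbation lemmas below.\<close>

lemma summable_rank_one_operators: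
  fixes g :: "nat \<Rightarrow> 'a::real_normed_vector \<Rightarrow>\<^sub>L real" and z :: "nat \<Rightarrow> 'b::banach"
  assumes sm: "summable (\<lambda>n. norm (g n) * norm (z n))"
  obtains D :: "'a \<Rightarrow>\<^sub>L 'b" where "\<And>x. (\<lambda>n. g n x *\<^sub>R z n) sums D x"
    "norm D \<le> (\<Sum>n. norm (g n) * norm (z n))"
proof -
  let ?r = "\<lambda>n. blinfun_scaleR_left (z n) o\<^sub>L g n"
  have le: "norm (?r n) \<le> norm (g n) * norm (z n)" for n
  proof (rule norm_blinfun_bound)
    show "norm ((?r n) x) \<le> norm (g n) * norm (z n) * norm x" for x
      using mult_right_mono[OF norm_blinfun[of "g n" x], of "norm (z n)"] by (simp add: ac_simps)
  qed simp
  have s: "summable (\<lambda>n. norm (?r n))"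
    by (rule summable_comparison_test[OF _ sm]) (use le in auto)
  then have "?r sums suminf ?r"
    by (rule summable_sums[OF summable_norm_cancel])
  then have "(\<lambda>n. g n x *\<^sub>R z n) sums (suminf ?r) x" for x
    using bounded_linear.sums[OF blinfun.bounded_linear_left] by fastforce
  moreover have "norm (suminf ?r) \<le> (\<Sum>n. norm (g n) * norm (z n))"
    using summable_norm[OF s] suminf_le[OF le s sm] by linarith
  ultimately show ?thesis using that by blast
qed

text \<open>The series of the \<open>g n x *\<^sub>R u n\<close> then defines a projection onto the
  closed span of the \<open>u n\<close>. The uniform bound on the partial sums passes directly to
  this projection.\<close>

definition projection_system :: "(nat \<Rightarrow> 'a::banach) \<Rightarrow> (nat \<Rightarrow> 'a \<Rightarrow>\<^sub>L real) \<Rightarrow> bool" where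
  "projection_system u g \<longleftrightarrow>
     (\<forall>n m. g n (u m) = (if n = m then 1 else 0)) \<and>
     (\<forall>x. summable (\<lambda>n. g n x *\<^sub>R u n)) \<and>
     (\<exists>C. \<forall>x n. norm (\<Sum>i<n. g i x *\<^sub>R u i) \<le> norm x * C)"

lemma projection_systemE:
  assumes "projection_system u g"
  obtains P :: "'a::banach \<Rightarrow>\<^sub>L 'a" where "\<And>x. (\<lambda>n. g n x *\<^sub>R u n) sums P x"
    "\<And>x. P (P x) = P x" "\<And>n x. g n (P x) = g n x" "\<And>n. P (u n) = u n"
proof -
  from assms obtain C where bi: "\<And>n m. g n (u m) = (if n = m then 1 else 0)"
    and sm: "\<And>x. summable (\<lambda>n. g n x *\<^sub>R u n)"
    and C: "\<And>x n. norm (\<Sum>i<n. g i x *\<^sub>R u i) \<le> norm x * C"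
    unfolding projection_system_def by blast
  define p where "p x = (\<Sum>n. g n x *\<^sub>R u n)" for x
  have p: "(\<lambda>n. g n x *\<^sub>R u n) sums p x" for x
    unfolding p_def using sm by (rule summable_sums)
  have "bounded_linear p"
  proof (rule bounded_linear_intro[where K = C])
    show "p (x + y) = p x + p y" for x y
    proof (rule sums_unique2[OF p])
      show "(\<lambda>n. g n (x + y) *\<^sub>R u n) sums (p x + p y)"
        using sums_add[OF p[of x] p[of y]] by (simp add: blinfun.add_right scaleR_left_distrib)
    qed
    show "p (r *\<^sub>R x) = r *\<^sub>R p x" for r x
      using sums_scaleR_right[OF p[of x], of r] p[of "r *\<^sub>R x"]
      by (simp add: blinfun.scaleR_right sums_unique2)
    show "norm (p x) \<le> norm x * C" for x
    proof (rule LIMSEQ_le_const2)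
      show "(\<lambda>n. norm (\<Sum>i<n. g i x *\<^sub>R u i)) \<longlonglongrightarrow> norm (p x)"
        using p[of x] unfolding sums_def by (rule tendsto_norm)
    qed (use C in auto)
  qed
  then have P: "blinfun_apply (Blinfun p) = p"
    by (rule bounded_linear_Blinfun_apply)
  have g: "g m (p x) = g m x" for m x
  proof (rule sums_unique2)
    have "(\<lambda>n. g m (g n x *\<^sub>R u n)) sums g m (p x)"
      using bounded_linear.sums[OF blinfun.bounded_linear_right p] .
    then show "(\<lambda>n. if n = m then g n x else 0) sums g m (p x)"
      by (rule back_subst[where P = "\<lambda>h. h sums _"]) (auto simp: blinfun.scaleR_right bi)
    show "(\<lambda>n. if n = m then g n x else 0) sums g m x"
      using sums_single[of m "\<lambda>n. g n x"] by simp
  qed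
  have pu: "p (u n) = u n" for n
  proof (rule sums_unique2[OF p])
    have "(\<lambda>m. g m (u n) *\<^sub>R u m) = (\<lambda>m. if m = n then u m else 0)"
      by (auto simp: bi)
    then show "(\<lambda>m. g m (u n) *\<^sub>R u m) sums u n"
      using sums_single[of n u] by simp
  qed
  have pp: "p (p x) = p x" for x
    by (rule sums_unique2[OF p]) (use p[of x] in \<open>simp add: g\<close>)
  show ?thesis
    by (rule that[of "Blinfun p"]) (simp_all add: P p g pp pu)
qed

text \<open>Principle of small perturbations: \<open>U = 1 + D\<close>, with \<open>D y\<close> the
  sum of the vectors \<open>x n - u n\<close> with coefficients \<open>g n y\<close>, is invertible
  and sends \<open>u n\<close> to \<open>x n\<close>. Conjugating the projection by \<open>U\<close>
  gives a projection onto the closed span of the \<open>x n\<close>, which lies in the closed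
  subspace \<open>M\<close>.\<close>

lemma complemented_subspace_perturbation:
  fixes u x :: "nat \<Rightarrow> 'a::banach"
  assumes sys: "projection_system u g"
    and sm: "summable (\<lambda>n. norm (g n) * norm (x n - u n))" "(\<Sum>n. norm (g n) * norm (x n - u n)) < 1"
    and M: "subspace M" "closed M" "\<And>n. x n \<in> M"
  shows "\<exists>N \<subseteq> M. subspace N \<and> infinite_dimensional N \<and> complemented N"
proof -
  obtain D :: "'a \<Rightarrow>\<^sub>L 'a" where D: "\<And>y. (\<lambda>n. g n y *\<^sub>R (x n - u n)) sums D y"
    "norm D \<le> (\<Sum>n. norm (g n) * norm (x n - u n))"
    by (rule summable_rank_one_operators[OF sm(1)]) blast
  obtain W :: "'a \<Rightarrow>\<^sub>L 'a" where W: "\<And>y. W (y + D y) = y" "\<And>y. W y + D (W y) = y"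
    by (rule blinfun_id_plus_invertible[OF le_less_trans[OF D(2) sm(2)]]) blast
  obtain P0 :: "'a \<Rightarrow>\<^sub>L 'a" where P0: "\<And>y. (\<lambda>n. g n y *\<^sub>R u n) sums P0 y" "\<And>y. P0 (P0 y) = P0 y"
    "\<And>n y. g n (P0 y) = g n y" "\<And>n. P0 (u n) = u n"
    by (rule projection_systemE[OF sys]) blast
  have bi: "g n (u m) = (if n = m then 1 else 0)" for n m
    using sys by (simp add: projection_system_def)
  define U where "U = id_blinfun + D"
  have U: "U y = y + D y" for y by (simp add: U_def blinfun.add_left)
  have Uu: "U (u m) = x m" for m
  proof -
    have "(\<lambda>n. g n (u m) *\<^sub>R (x n - u n)) = (\<lambda>n. if n = m then x n - u n else 0)"
      by (auto simp: bi)
    then have "D (u m) = x m - u m"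
      using D(1)[of "u m"] sums_single[of m "\<lambda>n. x n - u n"] by (simp add: sums_unique2)
    then show ?thesis by (simp add: U)
  qed
  define P where "P = U o\<^sub>L P0 o\<^sub>L W"
  have P: "P y = U (P0 (W y))" for y by (simp add: P_def)
  have Wx: "W (x n) = u n" for n
    using W(1)[of "u n"] Uu[of n] by (simp add: U)
  have Px: "P (x n) = x n" for n
    by (simp add: P Wx P0(4) Uu)
  show ?thesis
  proof (intro exI[of _ "range P"] conjI)
    show "range P \<subseteq> M"
    proof safe
      fix y
      have "(\<lambda>n. U (g n (W y) *\<^sub>R u n)) sums U (P0 (W y))"
        using bounded_linear.sums[OF blinfun.bounded_linear_right P0(1)] .
      then have "(\<lambda>n. \<Sum>i<n. g i (W y) *\<^sub>R x i) \<longlonglongrightarrow> P y"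
        by (simp add: blinfun.scaleR_right Uu P sums_def)
      then show "P y \<in> M"
        by (rule closed_sequentially[OF M(2), rotated]) (simp add: M subspace_sum subspace_scale)
    qed
    show "subspace (range P)"
      by (simp add: blinfun.bounded_linear_right bounded_linear.linear linear_subspace_image)
    show "infinite_dimensional (range P)"
    proof (rule infinite_dimensional_biorthogonal[where x = x and g = "\<lambda>n y. g n (W y)"])
      show "x n \<in> range P" for n using Px by (metis rangeI)
      show "linear (\<lambda>y. g n (W y))" for n
        by (intro bounded_linear.linear bounded_linear_intros)
      show "g n (W (x m)) = (if n = m then 1 else 0)" for n m
        by (simp add: Wx bi)
    qed
    show "complemented (range P)"
      unfolding complemented_def
      by (intro exI[of _ P]) (simp add: P W(1)[folded U] P0)
  qed
qed

text \<open>Dual to the preceding lemma: the functionals are moved and the vectors stay. With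
  \<open>D y\<close> the sum of the \<open>u n\<close> with coefficients
  \<open>(f n - g n) y\<close>, the operator \<open>W = 1 + D\<close> turns \<open>g m\<close> into
  \<open>f m\<close>, that is, \<open>g m (W y) = f m y\<close>. The conjugated projection therefore
  vanishes on the common kernel of the \<open>f m\<close>, which contains \<open>M\<close>, and its
  kernel is the required subspace.\<close>

lemma infinite_codimensional_complemented_perturbation:
  fixes u :: "nat \<Rightarrow> 'a::banach" and f g :: "nat \<Rightarrow> 'a \<Rightarrow>\<^sub>L real"
  assumes sys: "projection_system u g"
    and sm: "summable (\<lambda>n. norm (f n - g n) * norm (u n))" "(\<Sum>n. norm (f n - g n) * norm (u n)) < 1"
    and M: "\<And>n y. y \<in> M \<Longrightarrow> f n y = 0"
  shows "\<exists>N. M \<subseteq> N \<and> subspace N \<and> infinite_codimensional N \<and> complemented N"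
proof -
  obtain D :: "'a \<Rightarrow>\<^sub>L 'a" where D: "\<And>y. (\<lambda>n. (f n - g n) y *\<^sub>R u n) sums D y"
    "norm D \<le> (\<Sum>n. norm (f n - g n) * norm (u n))"
    by (rule summable_rank_one_operators[OF sm(1)]) blast
  obtain V :: "'a \<Rightarrow>\<^sub>L 'a" where V: "\<And>y. V (y + D y) = y" "\<And>y. V y + D (V y) = y"
    by (rule blinfun_id_plus_invertible[OF le_less_trans[OF D(2) sm(2)]]) blast
  obtain P0 :: "'a \<Rightarrow>\<^sub>L 'a" where P0: "\<And>y. (\<lambda>n. g n y *\<^sub>R u n) sums P0 y" "\<And>y. P0 (P0 y) = P0 y"
    "\<And>n y. g n (P0 y) = g n y" "\<And>n. P0 (u n) = u n"
    by (rule projection_systemE[OF sys]) blast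
  have bi: "g n (u m) = (if n = m then 1 else 0)" for n m
    using sys by (simp add: projection_system_def)
  define W where "W = id_blinfun + D"
  have W: "W y = y + D y" for y by (simp add: W_def blinfun.add_left)
  have VW: "V (W y) = y" "W (V y) = y" for y using V by (simp_all add: W)
  have gW: "g m (W y) = f m y" for m y
  proof -
    have "(\<lambda>n. g m ((f n - g n) y *\<^sub>R u n)) sums g m (D y)"
      using bounded_linear.sums[OF blinfun.bounded_linear_right D(1)] .
    then have "(\<lambda>n. if n = m then (f n - g n) y else 0) sums g m (D y)"
      by (rule back_subst[where P = "\<lambda>h. h sums _"]) (auto simp: blinfun.scaleR_right bi)
    then have "g m (D y) = (f m - g m) y"
      using sums_single[of m "\<lambda>n. (f n - g n) y"] by (simp add: sums_unique2)
    then show ?thesis by (simp add: W blinfun.add_right blinfun.diff_left)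
  qed
  define P where "P = V o\<^sub>L P0 o\<^sub>L W"
  have P: "P y = V (P0 (W y))" for y by (simp add: P_def)
  have PP: "P (P y) = P y" for y by (simp add: P VW P0)
  define R where "R = id_blinfun - P"
  have R: "R y = y - P y" for y by (simp add: R_def blinfun.diff_left)
  show ?thesis
  proof (intro exI[of _ "range R"] conjI)
    have "P y = 0" if "y \<in> M" for y
    proof -
      have "(\<lambda>n. 0) sums P0 (W y)"
        using P0(1)[of "W y"] M[OF that] by (simp add: gW)
      then have "P0 (W y) = 0"
        by (rule sums_unique2[OF _ sums_zero])
      then show ?thesis by (simp add: P blinfun.zero_right)
    qed
    then show "M \<subseteq> range R"
      by (metis R diff_zero rangeI subsetI)
    show "subspace (range R)"
      by (simp add: blinfun.bounded_linear_right bounded_linear.linear linear_subspace_image)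
    show "complemented (range R)"
      unfolding complemented_def by (intro exI[of _ R]) (simp add: R blinfun.diff_right PP)
    show "infinite_codimensional (range R)"
    proof (rule infinite_codimensional_biorthogonal[where x = "\<lambda>m. V (u m)" and g = "\<lambda>n y. g n (W y)"])
      show "linear (\<lambda>y. g n (W y))" for n
        by (intro bounded_linear.linear bounded_linear_intros)
      show "g n (W (V (u m))) = (if n = m then 1 else 0)" for n m
        by (simp add: VW bi)
      fix n y assume "y \<in> range R"
      then obtain y' where "y = R y'" by blast
      then have "P y = 0" by (simp add: R blinfun.diff_right PP)
      then have "P0 (W y) = 0" using VW(2)[of "P0 (W y)"] by (simp add: P)
      then show "g n (W y) = 0" using P0(3)[of n "W y"] by simp
    qed
  qed
qed

text \<open>The hypothesis on \<open>u\<close> is the upper estimate of c0. Boundedness of the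
  \<open>g n\<close> bounds the partial sums; it is the pointwise convergence to 0 that makes the
  tails small and the series convergent.\<close>

lemma projection_system_c0:
  fixes u :: "nat \<Rightarrow> 'a::banach" and g :: "nat \<Rightarrow> 'a \<Rightarrow>\<^sub>L real"
  assumes bi: "\<And>n m. g n (u m) = (if n = m then 1 else 0)"
    and u: "\<And>F a B. finite F \<Longrightarrow> 0 \<le> B \<Longrightarrow> (\<And>n. n \<in> F \<Longrightarrow> \<bar>a n\<bar> \<le> B) \<Longrightarrow>
      norm (\<Sum>n\<in>F. a n *\<^sub>R u n) \<le> C * B"
    and g: "\<And>n. norm (g n) \<le> K" "\<And>x. (\<lambda>n. g n x) \<longlonglongrightarrow> 0"
  shows "projection_system u g"
  unfolding projection_system_def
proof (intro conjI allI exI[of _ "C * K"])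
  have K: "0 \<le> K" using g(1)[of 0] norm_ge_zero order_trans by blast
  have "0 \<le> C" using u[of "{}" 1] by simp
  show "g n (u m) = (if n = m then 1 else 0)" for n m by (rule bi)
  show "norm (\<Sum>i<n. g i x *\<^sub>R u i) \<le> norm x * (C * K)" for x n
  proof -
    have "\<bar>g i x\<bar> \<le> K * norm x" for i
      using norm_blinfun[of "g i" x] mult_right_mono[OF g(1)[of i] norm_ge_zero[of x]] by simp
    then have "norm (\<Sum>i<n. g i x *\<^sub>R u i) \<le> C * (K * norm x)"
      by (intro u) (simp_all add: K)
    then show ?thesis by (simp add: ac_simps)
  qed
  show "summable (\<lambda>n. g n x *\<^sub>R u n)" for x
    unfolding summable_Cauchy
  proof (intro allI impI)
    fix e :: real assume "0 < e"
    \<comment> \<open>\<open>C + 1\<close> instead of \<open>C\<close> because \<open>C\<close> may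
      be 0.\<close>
    then have "0 < e / (C + 1)" using \<open>0 \<le> C\<close> by simp
    then obtain n0 where n0: "\<And>n. n \<ge> n0 \<Longrightarrow> \<bar>g n x\<bar> < e / (C + 1)"
      using LIMSEQ_D[OF g(2)[of x]] by (metis diff_zero real_norm_def)
    have "norm (\<Sum>i=m..<n. g i x *\<^sub>R u i) < e" if "m \<ge> n0" for m n
    proof -
      have "norm (\<Sum>i=m..<n. g i x *\<^sub>R u i) \<le> C * (e / (C + 1))"
        using n0 that \<open>0 < e / (C + 1)\<close> by (intro u) (auto intro: less_imp_le)
      also have "\<dots> < e" using \<open>0 \<le> C\<close> \<open>0 < e\<close> by (simp add: field_simps)
      finally show ?thesis .
    qed
    then show "\<exists>n0. \<forall>m\<ge>n0. \<forall>n. norm (\<Sum>i=m..<n. g i x *\<^sub>R u i) < e" by blast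
  qed
qed

text \<open>The roles are reversed compared with c0: the \<open>u n\<close> are merely bounded, and
  the coefficients are absolutely summable.\<close>

lemma projection_system_l1:
  fixes u :: "nat \<Rightarrow> 'a::banach" and g :: "nat \<Rightarrow> 'a \<Rightarrow>\<^sub>L real"
  assumes bi: "\<And>n m. g n (u m) = (if n = m then 1 else 0)"
    and u: "\<And>n. norm (u n) \<le> C"
    and g: "\<And>F x. finite F \<Longrightarrow> (\<Sum>n\<in>F. \<bar>g n x\<bar>) \<le> K * norm x"
  shows "projection_system u g"
  unfolding projection_system_def
proof (intro conjI allI exI[of _ "C * K"])
  have C: "0 \<le> C" using u[of 0] norm_ge_zero order_trans by blast
  show "g n (u m) = (if n = m then 1 else 0)" for n m by (rule bi)
  show "norm (\<Sum>i<n. g i x *\<^sub>R u i) \<le> norm x * (C * K)" for x n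
  proof -
    have "norm (\<Sum>i<n. g i x *\<^sub>R u i) \<le> (\<Sum>i<n. \<bar>g i x\<bar> * C)"
      using u by (intro sum_norm_le) (simp add: mult_left_mono)
    also have "\<dots> \<le> (K * norm x) * C"
      unfolding sum_distrib_right[symmetric] using g[of "{..<n}" x] C by (simp add: mult_right_mono)
    finally show ?thesis by (simp add: ac_simps)
  qed
  show "summable (\<lambda>n. g n x *\<^sub>R u n)" for x
  proof (rule summable_norm_cancel, rule summable_comparison_test)
    have "summable (\<lambda>n. \<bar>g n x\<bar>)"
      by (rule summableI_nonneg_bounded[where x = "K * norm x"]) (simp_all add: g)
    then show "summable (\<lambda>n. \<bar>g n x\<bar> * C)" by (rule summable_mult2)
    show "\<exists>N. \<forall>n\<ge>N. norm (norm (g n x *\<^sub>R u n)) \<le> \<bar>g n x\<bar> * C"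
      using u by (simp add: mult_left_mono)
  qed
qed

text \<open>An upper l2 estimate for the \<open>u n\<close> is matched by a Bessel inequality for
  the \<open>g n\<close>, so a tail of the series is bounded by the l2 norm of a tail of the
  coefficients.\<close>

lemma projection_system_l2:
  fixes u :: "nat \<Rightarrow> 'a::banach" and g :: "nat \<Rightarrow> 'a \<Rightarrow>\<^sub>L real"
  assumes bi: "\<And>n m. g n (u m) = (if n = m then 1 else 0)"
    and u: "\<And>F a. finite F \<Longrightarrow> norm (\<Sum>n\<in>F. a n *\<^sub>R u n) \<le> C * L2_set a F"
    and C: "0 \<le> C"
    and g: "\<And>F x. finite F \<Longrightarrow> (\<Sum>n\<in>F. (g n x)\<^sup>2) \<le> (K * norm x)\<^sup>2" and K: "0 \<le> K"
  shows "projection_system u g"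
  unfolding projection_system_def
proof (intro conjI allI exI[of _ "C * K"])
  show "g n (u m) = (if n = m then 1 else 0)" for n m by (rule bi)
  show "norm (\<Sum>i<n. g i x *\<^sub>R u i) \<le> norm x * (C * K)" for x n
  proof -
    have "L2_set (\<lambda>i. g i x) {..<n} \<le> K * norm x"
      unfolding L2_set_def using g[of "{..<n}" x] K by (simp add: real_le_lsqrt sum_nonneg)
    then have "norm (\<Sum>i<n. g i x *\<^sub>R u i) \<le> C * (K * norm x)"
      using u[of "{..<n}" "\<lambda>i. g i x"] mult_left_mono[OF _ C] by (smt (verit) finite_lessThan)
    then show ?thesis by (simp add: ac_simps)
  qed
  show "summable (\<lambda>n. g n x *\<^sub>R u n)" for x
    unfolding summable_Cauchy
  proof (intro allI impI)
    fix e :: real assume "0 < e"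
    have "summable (\<lambda>n. (g n x)\<^sup>2)"
      by (rule summableI_nonneg_bounded[where x = "(K * norm x)\<^sup>2"]) (simp_all add: g)
    moreover have "0 < (e / (C + 1))\<^sup>2" using \<open>0 < e\<close> C by simp
    ultimately obtain n0 where n0: "\<And>m n. m \<ge> n0 \<Longrightarrow> norm (\<Sum>i=m..<n. (g i x)\<^sup>2) < (e / (C + 1))\<^sup>2"
      unfolding summable_Cauchy by meson
    have "norm (\<Sum>i=m..<n. g i x *\<^sub>R u i) < e" if "m \<ge> n0" for m n
    proof -
      have "L2_set (\<lambda>i. g i x) {m..<n} \<le> e / (C + 1)"
        unfolding L2_set_def
        using n0[OF that, of n] \<open>0 < e\<close> C by (intro real_le_lsqrt) (simp_all add: sum_nonneg)
      then have "norm (\<Sum>i=m..<n. g i x *\<^sub>R u i) \<le> C * (e / (C + 1))"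
        using u[of "{m..<n}" "\<lambda>i. g i x"] mult_left_mono[OF _ C] by (smt (verit) finite_atLeastLessThan)
      also have "\<dots> < e" using C \<open>0 < e\<close> by (simp add: field_simps)
      finally show ?thesis .
    qed
    then show "\<exists>n0. \<forall>m\<ge>n0. \<forall>n. norm (\<Sum>i=m..<n. g i x *\<^sub>R u i) < e" by blast
  qed
qed

text \<open>Dependent choice with a state: \<open>s n\<close> records which coordinates or indices
  have been used up before stage \<open>n\<close>, and \<open>y n\<close> is the object chosen at
  that stage. The invariant \<open>I\<close>, such as finiteness of the set of used indices, is
  carried along.\<close>

lemma dependent_choice_states:
  assumes "I s0" and step: "\<And>n s. I s \<Longrightarrow> \<exists>y s'. Q n s y s' \<and> I s'"
  obtains y :: "nat \<Rightarrow> 'y" and s :: "nat \<Rightarrow> 's"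
  where "s 0 = s0" "\<And>n. I (s n)" "\<And>n. Q n (s n) (y n) (s (Suc n))"
proof -
  obtain s where s: "s 0 = s0" "\<And>n. I (s n)" "\<And>n. \<exists>y. Q n (s n) y (s (Suc n))"
  \<comment> \<open>A clause that speaks only of stage 0 pins the starting state.\<close>
  proof (rule dependent_nat_choice[where P = "\<lambda>n s. I s \<and> (n = 0 \<longrightarrow> s = s0)"
        and Q = "\<lambda>n s s'. \<exists>y. Q n s y s'", THEN exE])
    show "\<exists>x. I x \<and> (0 = 0 \<longrightarrow> x = s0)" using assms(1) by blast
    show "\<exists>y. (I y \<and> (Suc n = 0 \<longrightarrow> y = s0)) \<and> (\<exists>ya. Q n x ya y)"
      if "I x \<and> (n = 0 \<longrightarrow> x = s0)" for x n
      using step[of x n] that by blast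
  qed blast
  then obtain y where "\<And>n. Q n (s n) (y n) (s (Suc n))" by metis
  then show ?thesis using that s by blast
qed

lemma dependent_choice_sequence:
  assumes "\<And>n s. \<exists>y s'. Q n s y s'"
  obtains y :: "nat \<Rightarrow> 'y" and s :: "nat \<Rightarrow> 's"
  where "s 0 = s0" "\<And>n. Q n (s n) (y n) (s (Suc n))"
proof (rule dependent_choice_states[of "\<lambda>_. True" s0 Q])
  show "\<exists>y s'. Q n s y s' \<and> True" for n s using assms by simp
qed (use that in auto)

section \<open>Orthonormal sequences and Hilbertian subspaces\<close>

lemma Bessel_inequality:
  fixes h :: "nat \<Rightarrow> 'h::real_inner"
  assumes orth: "\<And>n m. inner (h n) (h m) = (if n = m then 1 else 0)" and F: "finite F"
  shows "(\<Sum>n\<in>F. (inner y (h n))\<^sup>2) \<le> (norm y)\<^sup>2"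
proof -
  let ?p = "\<Sum>n\<in>F. inner y (h n) *\<^sub>R h n"
  have 1: "inner y ?p = (\<Sum>n\<in>F. (inner y (h n))\<^sup>2)"
    by (simp add: inner_sum_right power2_eq_square)
  have 2: "inner ?p ?p = (\<Sum>n\<in>F. (inner y (h n))\<^sup>2)"
    using F by (simp add: inner_sum_right inner_sum_left orth if_distrib sum.delta power2_eq_square cong: if_cong)
  have "0 \<le> inner (y - ?p) (y - ?p)" by simp
  also have "\<dots> = inner y y - 2 * inner y ?p + inner ?p ?p"
    by (simp only: inner_diff_left inner_diff_right inner_commute[of ?p y])
  finally show ?thesis using 1 2 by (simp add: power2_norm_eq_inner)
qed

lemma norm_orthonormal_sum:
  fixes h :: "nat \<Rightarrow> 'h::real_inner"
  assumes orth: "\<And>n m. inner (h n) (h m) = (if n = m then 1 else 0)" and F: "finite F"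
  shows "norm (\<Sum>n\<in>F. a n *\<^sub>R h n) = L2_set a F"
  using F by (simp add: norm_eq_sqrt_inner L2_set_def inner_sum_right inner_sum_left orth if_distrib
      sum.delta power2_eq_square cong: if_cong)

text \<open>Gram-Schmidt without subtraction: each new vector is taken from the part of
  \<open>M\<close> on which the inner products with all earlier images vanish. It can be rescaled to
  an image of norm 1 because \<open>R\<close> is bounded below on \<open>M\<close>.\<close>

lemma orthonormal_sequence:
  fixes R :: "'a::real_normed_vector \<Rightarrow>\<^sub>L 'h::real_inner"
  assumes M: "subspace M" "infinite_dimensional M" and c: "0 < c" "\<And>x. x \<in> M \<Longrightarrow> c * norm x \<le> norm (R x)"
  obtains x :: "nat \<Rightarrow> 'a" where "\<And>n. x n \<in> M"
    "\<And>n m. inner (R (x n)) (R (x m)) = (if n = m then 1 else 0)"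
proof -
  have "\<exists>y S'. (y \<in> M \<and> norm (R y) = 1 \<and> (\<forall>s\<in>S. inner (R s) (R y) = 0) \<and> S' = insert y S) \<and> finite S'"
    if S: "finite S" for S
  proof -
    obtain y where y: "y \<in> M" "norm y = 1" "\<And>s. s \<in> S \<Longrightarrow> inner (R s) (R y) = 0"
      by (rule infinite_dimensional_unit_vector[OF S M, of "\<lambda>s y. inner (R s) (R y)"])
        (auto intro!: bounded_linear.linear bounded_linear_intros)
    have "R y \<noteq> 0" using c(2)[OF y(1)] c(1) y(2) by auto
    then show ?thesis
      using y M(1) S by (intro exI[of _ "(1 / norm (R y)) *\<^sub>R y"])
        (auto simp: subspace_scale blinfun.scaleR_right)
  qed
  then obtain x S where xS: "S 0 = {}" "\<And>n. finite (S n)"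
    "\<And>n::nat. x n \<in> M \<and> norm (R (x n)) = 1 \<and> (\<forall>s\<in>S n. inner (R s) (R (x n)) = 0) \<and> S (Suc n) = insert (x n) (S n)"
    using dependent_choice_states[of finite "{}" "\<lambda>n S y S'. y \<in> M \<and> norm (R y) = 1 \<and>
      (\<forall>s\<in>S. inner (R s) (R y) = 0) \<and> S' = insert y S"] finite.emptyI by metis
  have in_S: "x i \<in> S n" if "i < n" for i n
    using that by (induction n) (use xS(3) in \<open>auto simp: less_Suc_eq\<close>)
  have "inner (R (x n)) (R (x m)) = 0" if "n < m" for n m
    using xS(3)[of m] in_S[OF that] by blast
  moreover have "inner (R (x n)) (R (x n)) = 1" for n
    using xS(3)[of n] by (simp add: norm_eq_1)
  ultimately have "inner (R (x n)) (R (x m)) = (if n = m then 1 else 0)" for n m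
    by (metis inner_commute linorder_neqE_nat)
  then show ?thesis using that xS(3) by blast
qed

text \<open>A subspace on which an operator into a Hilbert space is bounded below carries an orthonormal
  sequence, and the Fourier coefficients with respect to it extend to the whole space.\<close>

lemma complemented_subspace_of_hilbertian:
  fixes R :: "'a::banach \<Rightarrow>\<^sub>L 'h::real_inner"
  assumes M: "subspace M" "closed M" "infinite_dimensional M"
    and c: "0 < c" "\<And>x. x \<in> M \<Longrightarrow> c * norm x \<le> norm (R x)"
  shows "\<exists>N \<subseteq> M. subspace N \<and> infinite_dimensional N \<and> complemented N"
proof -
  obtain x where x: "\<And>n::nat. x n \<in> M"
    "\<And>n m. inner (R (x n)) (R (x m)) = (if n = m then 1 else 0)"
    using orthonormal_sequence[OF M(1,3) c] by blast
  define g where "g n = blinfun_inner_left (R (x n)) o\<^sub>L R" for n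
  have g: "g n y = inner (R y) (R (x n))" for n y
    by (simp add: g_def inner_commute)
  have "projection_system x g"
  proof (rule projection_system_l2)
    show "g n (x m) = (if n = m then 1 else 0)" for n m
      using x(2)[of m n] by (auto simp: g)
    show "norm (\<Sum>n\<in>F. a n *\<^sub>R x n) \<le> 1 / c * L2_set a F" if F: "finite F" for F a
    proof -
      have "c * norm (\<Sum>n\<in>F. a n *\<^sub>R x n) \<le> norm (R (\<Sum>n\<in>F. a n *\<^sub>R x n))"
        using M(1) x(1) by (intro c) (simp add: subspace_sum subspace_scale)
      also have "\<dots> = L2_set a F"
        using norm_orthonormal_sum[of "\<lambda>n. R (x n)" F a, OF x(2) F]
        by (simp add: blinfun.sum_right blinfun.scaleR_right)
      finally show ?thesis using c(1) by (simp add: field_simps)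
    qed
    show "(\<Sum>n\<in>F. (g n y)\<^sup>2) \<le> (norm R * norm y)\<^sup>2" if F: "finite F" for F y
    proof -
      have "(\<Sum>n\<in>F. (g n y)\<^sup>2) \<le> (norm (R y))\<^sup>2"
        unfolding g using Bessel_inequality[of "\<lambda>n. R (x n)" F "R y", OF x(2) F] .
      also have "\<dots> \<le> (norm R * norm y)\<^sup>2"
        by (intro power_mono norm_blinfun norm_ge_zero)
      finally show ?thesis .
    qed
  qed (use c in auto)
  \<comment> \<open>The perturbation is zero, with \<open>x\<close> in both roles; the lemma only
    converts the projection system into a complemented subspace of \<open>M\<close>.\<close>
  then show ?thesis
    using complemented_subspace_perturbation[of x g x M] M x(1) by simp
qed

text \<open>The iteration behind the open mapping theorem: an approximate lift that halves the error
  is applied again to the remainder, and the corrections form a geometric series, whence the factor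
  2. It will show that an operator \<open>P\<close> vanishing on the kernel of \<open>q\<close>
  satisfies \<open>norm (P x) \<le> 2 * C * norm P * norm (q x)\<close>.\<close>

lemma approximate_preimage:
  fixes q :: "'a::banach \<Rightarrow>\<^sub>L 'b::real_normed_vector"
  assumes approx: "\<And>x. \<exists>y. norm y \<le> C * norm (q x) \<and> norm (q (x - y)) \<le> norm (q x) / 2"
  obtains y where "norm y \<le> 2 * C * norm (q x)" "q y = q x"
proof -
  obtain a where a: "\<And>x. norm (a x) \<le> C * norm (q x)" "\<And>x. norm (q (x - a x)) \<le> norm (q x) / 2"
    using approx by metis
  define r where "r n = ((\<lambda>z. z - a z) ^^ n) x" for n
  have r: "r 0 = x" "r (Suc n) = r n - a (r n)" for n
    by (simp_all add: r_def)
  have qr: "norm (q (r n)) \<le> norm (q x) * (1 / 2) ^ n" for n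
  proof (induction n)
    case (Suc n)
    then show ?case using a(2)[of "r n"] by (simp add: r)
  qed (simp add: r)
  show ?thesis
  proof (cases "q x = 0")
    case True
    then show ?thesis using that[of 0] by (simp add: blinfun.zero_right)
  next
    case False
    have "0 \<le> C * norm (q x)" using a(1)[of x] norm_ge_zero order_trans by blast
    then have C: "0 \<le> C" using False by (simp add: zero_le_mult_iff)
    have ar: "norm (a (r n)) \<le> C * norm (q x) * (1 / 2) ^ n" for n
      using a(1)[of "r n"] mult_left_mono[OF qr[of n] C] by (simp add: mult.assoc)
    have geo: "(\<lambda>n. C * norm (q x) * (1 / 2) ^ n) sums (C * norm (q x) * 2)"
      using sums_mult[OF geometric_sums[of "1 / 2 :: real"], of "C * norm (q x)"] by simp
    have sm: "summable (\<lambda>n. norm (a (r n)))"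
      by (rule summable_comparison_test[OF _ sums_summable[OF geo]]) (use ar in auto)
    define y where "y = (\<Sum>n. a (r n))"
    have y: "(\<lambda>n. a (r n)) sums y"
      unfolding y_def using sm by (intro summable_sums summable_norm_cancel[where f = "\<lambda>n. a (r n)"])
    have "norm y \<le> (\<Sum>n. norm (a (r n)))"
      unfolding y_def by (rule summable_norm[OF sm])
    also have "\<dots> \<le> C * norm (q x) * 2"
      using suminf_le[OF ar sm sums_summable[OF geo]] sums_unique[OF geo] by simp
    finally have "norm y \<le> 2 * C * norm (q x)" by simp
    moreover have "q y = q x"
    proof -
      have partial: "(\<Sum>i<n. a (r i)) = x - r n" for n
        by (induction n) (simp_all add: r)
      have "(\<lambda>n. q (x - r n)) \<longlonglongrightarrow> q y"
        using bounded_linear.tendsto[OF blinfun.bounded_linear_right y[unfolded sums_def]]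
        by (simp add: partial)
      moreover have "(\<lambda>n. q (r n)) \<longlonglongrightarrow> 0"
      proof (rule Lim_null_comparison)
        show "\<forall>\<^sub>F n in sequentially. norm (q (r n)) \<le> norm (q x) * (1 / 2) ^ n"
          using qr by simp
        show "(\<lambda>n. norm (q x) * (1 / 2) ^ n) \<longlonglongrightarrow> 0"
          using tendsto_mult_right_zero[OF LIMSEQ_power_zero[of "1 / 2 :: real"]] by simp
      qed
      then have "(\<lambda>n. q (x - r n)) \<longlonglongrightarrow> q x"
        using tendsto_diff[OF tendsto_const[of "q x"]] by (fastforce simp: blinfun.diff_right)
      ultimately show ?thesis by (rule LIMSEQ_unique)
    qed
    ultimately show ?thesis by (rule that)
  qed
qed

section \<open>The Hahn--Banach theorem and annihilators\<close>

text \<open>For positive scalars one inequality is enough, since applying it to \<open>1 / r\<close>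
  gives the reverse one; this halves the work when infima are shown to be sublinear.\<close>

definition sublinear :: "('a::real_vector \<Rightarrow> real) \<Rightarrow> bool" where
  "sublinear p \<longleftrightarrow> (\<forall>x y. p (x + y) \<le> p x + p y) \<and> (\<forall>r>0. \<forall>x. p (r *\<^sub>R x) \<le> r * p x)"

lemma sublinearD:
  assumes "sublinear p"
  shows "p (x + y) \<le> p x + p y" "p 0 = 0" "0 \<le> r \<Longrightarrow> p (r *\<^sub>R x) = r * p x" "- p (- x) \<le> p x"
proof -
  show add: "p (x + y) \<le> p x + p y" for x y using assms by (simp add: sublinear_def)
  have sc: "p (r *\<^sub>R x) \<le> r * p x" if "0 < r" for r x using assms that by (simp add: sublinear_def)
  show 0: "p 0 = 0" using sc[of 2 0] sc[of "1/2" 0] by simp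
  show "p (r *\<^sub>R x) = r * p x" if "0 \<le> r" for r
  proof (cases "r = 0")
    case False
    then have "0 < r" using that by simp
    then show ?thesis
      using sc[of r x] sc[of "1 / r" "r *\<^sub>R x"] by (simp add: field_simps)
  qed (simp add: 0)
  show "- p (- x) \<le> p x" using add[of x "- x"] by (simp add: 0)
qed

text \<open>The classical device for lowering a sublinear functional: \<open>q z\<close> stays below
  \<open>p\<close>, and its value at \<open>- z\<close> drops to \<open>- p z\<close> or less. The
  infimum is finite because subadditivity bounds it below by \<open>- p (- y)\<close>. A
  \<open>p\<close> that cannot be lowered must satisfy \<open>p (- z) = - p z\<close>.\<close>

lemma sublinear_directional_infimum:
  fixes p :: "'a::real_vector \<Rightarrow> real"
  assumes p: "sublinear p"
  defines "q \<equiv> \<lambda>z y. INF t\<in>{0..}. p (y + t *\<^sub>R z) - t * p z"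
  shows "sublinear (q z)" "q z y \<le> p y" "q z (- z) \<le> - p z"
proof -
  note pD = sublinearD[OF p]
  have ge: "- p (- y) \<le> p (y + t *\<^sub>R z) - t * p z" if "0 \<le> t" for t y
    using pD(1)[of "y + t *\<^sub>R z" "- y"] pD(3)[OF that, of z] by simp
  have bdd: "bdd_below ((\<lambda>t. p (y + t *\<^sub>R z) - t * p z) ` {0..})" for y
    by (rule bdd_belowI2[of _ "- p (- y)"]) (use ge in simp)
  have q_le: "q z y \<le> p (y + t *\<^sub>R z) - t * p z" if "0 \<le> t" for t y
    unfolding q_def using that by (intro cINF_lower bdd) simp
  have q_ge: "c \<le> q z y" if "\<And>t. 0 \<le> t \<Longrightarrow> c \<le> p (y + t *\<^sub>R z) - t * p z" for c y
    unfolding q_def using that by (intro cINF_greatest) auto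
  show "q z y \<le> p y" for y using q_le[of 0 y] by simp
  show "q z (- z) \<le> - p z" using q_le[of 1 "- z"] by (simp add: pD(2))
  show "sublinear (q z)"
    unfolding sublinear_def
  proof (intro conjI allI impI)
    fix x y
    have "q z (x + y) - (p (x + s *\<^sub>R z) - s * p z) \<le> p (y + t *\<^sub>R z) - t * p z"
      if "0 \<le> s" "0 \<le> t" for s t
      using q_le[of "s + t" "x + y"] pD(1)[of "x + s *\<^sub>R z" "y + t *\<^sub>R z"] that
      by (simp add: algebra_simps)
    then have "q z (x + y) - (p (x + s *\<^sub>R z) - s * p z) \<le> q z y" if "0 \<le> s" for s
      using that q_ge by simp
    then have "q z (x + y) - q z y \<le> p (x + s *\<^sub>R z) - s * p z" if "0 \<le> s" for s
      using that by (simp add: algebra_simps)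
    then show "q z (x + y) \<le> q z x + q z y" using q_ge[of "q z (x + y) - q z y" x] by simp
  next
    fix r :: real and x assume r: "0 < r"
    have "q z (r *\<^sub>R x) / r \<le> p (x + t *\<^sub>R z) - t * p z" if t: "0 \<le> t" for t
    proof -
      have "q z (r *\<^sub>R x) \<le> p (r *\<^sub>R (x + t *\<^sub>R z)) - r * t * p z"
        using q_le[of "r * t" "r *\<^sub>R x"] r t by (simp add: scaleR_right_distrib)
      then show ?thesis using pD(3)[of r "x + t *\<^sub>R z"] r by (simp add: field_simps)
    qed
    then have "q z (r *\<^sub>R x) / r \<le> q z x" by (rule q_ge)
    then show "q z (r *\<^sub>R x) \<le> r * q z x" using r by (simp add: field_simps)
  qed
qed

text \<open>Subadditivity of a pointwise infimum is where the chain condition enters: of two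
  members, one that is nearly minimal at \<open>x\<close> and one at \<open>y\<close>, the smaller
  serves at both points.\<close>

lemma sublinear_chain_infimum:
  fixes C :: "('a::real_vector \<Rightarrow> real) set"
  assumes C: "C \<noteq> {}" "\<And>q. q \<in> C \<Longrightarrow> sublinear q" "\<And>q. q \<in> C \<Longrightarrow> q \<le> p"
    and chain: "\<And>q r. q \<in> C \<Longrightarrow> r \<in> C \<Longrightarrow> q \<le> r \<or> r \<le> q"
  shows "sublinear (\<lambda>x. INF q\<in>C. q x)" and "q \<in> C \<Longrightarrow> (\<lambda>x. INF q\<in>C. q x) \<le> q"
proof -
  have bdd: "bdd_below ((\<lambda>q. q x) ` C)" for x
  proof (rule bdd_belowI2[of _ "- p (- x)"])
    fix q assume "q \<in> C"
    then show "- p (- x) \<le> q x"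
      using sublinearD(4)[OF C(2), of q x] le_funD[OF C(3), of q "- x"] by simp
  qed
  have le: "(INF q\<in>C. q x) \<le> r x" if "r \<in> C" for r x
    using that by (intro cINF_lower bdd)
  show "sublinear (\<lambda>x. INF q\<in>C. q x)"
    unfolding sublinear_def
  proof (intro conjI allI impI)
    fix x y
    have "(INF q\<in>C. q (x + y)) \<le> q x + r y" if "q \<in> C" "r \<in> C" for q r
    proof (cases "q \<le> r")
      case True
      then show ?thesis
        using le[OF that(1), of "x + y"] sublinearD(1)[OF C(2)[OF that(1)], of x y]
        by (smt (verit) le_funE)
    next
      case False
      then have "r \<le> q" using chain that by blast
      then show ?thesis
        using le[OF that(2), of "x + y"] sublinearD(1)[OF C(2)[OF that(2)], of x y]
        by (smt (verit) le_funE)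
    qed
    then have "(INF q\<in>C. q (x + y)) - q x \<le> r y" if "q \<in> C" "r \<in> C" for q r
      using that by (simp add: diff_le_eq add.commute)
    then have "(INF q\<in>C. q (x + y)) - q x \<le> (INF r\<in>C. r y)" if "q \<in> C" for q
      using that C(1) by (intro cINF_greatest)
    then have "(INF q\<in>C. q (x + y)) - (INF r\<in>C. r y) \<le> q x" if "q \<in> C" for q
      using that by (simp add: diff_le_eq add.commute)
    then have "(INF q\<in>C. q (x + y)) - (INF r\<in>C. r y) \<le> (INF q\<in>C. q x)"
      using C(1) by (intro cINF_greatest)
    then show "(INF q\<in>C. q (x + y)) \<le> (INF q\<in>C. q x) + (INF q\<in>C. q y)" by simp
  next
    fix r :: real and x assume r: "0 < r"
    have "(INF q\<in>C. q (r *\<^sub>R x)) / r \<le> q x" if "q \<in> C" for q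
      using le[OF that, of "r *\<^sub>R x"] sublinearD(3)[OF C(2)[OF that], of r x] r by (simp add: field_simps)
    then have "(INF q\<in>C. q (r *\<^sub>R x)) / r \<le> (INF q\<in>C. q x)"
      using C(1) by (intro cINF_greatest)
    then show "(INF q\<in>C. q (r *\<^sub>R x)) \<le> r * (INF q\<in>C. q x)" using r by (simp add: field_simps)
  qed
  show "(\<lambda>x. INF q\<in>C. q x) \<le> q" if "q \<in> C"
    using le[OF that] by (simp add: le_fun_def)
qed

text \<open>A minimal sublinear functional is linear.\<close>

lemma Hahn_Banach_sublinear:
  fixes p :: "'a::real_vector \<Rightarrow> real"
  assumes p: "sublinear p"
  obtains f where "linear f" "f \<le> p"
proof -
  define A where "A = {q :: 'a \<Rightarrow> real. sublinear q \<and> q \<le> p}"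
  have "\<exists>m\<in>A. \<forall>a\<in>A. a \<le> m \<longrightarrow> a = m"
  proof (rule predicate_Zorn[where P = "\<lambda>q r. r \<le> q"])
    show "partial_order_on A (relation_of (\<lambda>q r. r \<le> q) A)"
      by (rule partial_order_on_relation_ofI) auto
    fix C assume "C \<in> Chains (relation_of (\<lambda>q r. r \<le> q) A)"
    then have C: "C \<subseteq> A" and chain: "\<And>q r. q \<in> C \<Longrightarrow> r \<in> C \<Longrightarrow> q \<le> r \<or> r \<le> q"
      unfolding Chains_def relation_of_def by auto
    show "\<exists>u\<in>A. \<forall>a\<in>C. u \<le> a"
    proof (cases "C = {}")
      case True
      then show ?thesis using p by (auto simp: A_def)
    next
      case False
      have sub: "\<And>q. q \<in> C \<Longrightarrow> sublinear q" and le: "\<And>q. q \<in> C \<Longrightarrow> q \<le> p"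
        using C by (auto simp: A_def)
      note inf = sublinear_chain_infimum[OF False sub le chain]
      obtain q where "q \<in> C" using False by blast
      then have "(\<lambda>x. INF q\<in>C. q x) \<in> A"
        using inf le unfolding A_def by (blast intro: order_trans)
      then show ?thesis using inf(2) by blast
    qed
  qed
  then obtain m where m: "sublinear m" "m \<le> p"
    and min: "\<And>q. sublinear q \<Longrightarrow> q \<le> m \<Longrightarrow> q = m"
    unfolding A_def by (auto intro: order_trans)
  have neg: "m (- z) = - m z" for z
  proof -
    have "(\<lambda>y. INF t\<in>{0..}. m (y + t *\<^sub>R z) - t * m z) = m"
      using sublinear_directional_infimum[OF m(1)] by (intro min) (auto simp: le_fun_def)
    from fun_cong[OF this, of "- z"] have "m (- z) \<le> - m z"
      using sublinear_directional_infimum(3)[OF m(1), of z] by (simp only:)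
    then show ?thesis using sublinearD(4)[OF m(1), of z] by simp
  qed
  have "linear m"
  proof (rule linearI)
    show "m (x + y) = m x + m y" for x y
      using sublinearD(1)[OF m(1), of x y] sublinearD(1)[OF m(1), of "x + y" "- y"] by (simp add: neg)
    show "m (r *\<^sub>R x) = r *\<^sub>R m x" for r x
      using sublinearD(3)[OF m(1), of r x] sublinearD(3)[OF m(1), of "- r" x] neg[of "r *\<^sub>R x"]
      by (cases "0 \<le> r") auto
  qed
  then show ?thesis using m(2) by (rule that)
qed

lemma infdist_less_witness:
  assumes "A \<noteq> {}" "infdist x A < c"
  obtains a where "a \<in> A" "dist x a < c"
  using assms cINF_less_iff[OF assms(1), of "dist x" c]
  by (auto simp: infdist_notempty bdd_below_def intro: zero_le_dist)

text \<open>The distance to \<open>M\<close> is the seminorm of the quotient: near-best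
  approximations of \<open>x\<close> and \<open>y\<close> from \<open>M\<close> add up to an
  admissible approximation of \<open>x + y\<close>.\<close>

lemma sublinear_infdist:
  fixes M :: "'a::real_normed_vector set"
  assumes M: "subspace M"
  shows "sublinear (\<lambda>x. infdist x M)"
  unfolding sublinear_def
proof (intro conjI allI impI)
  have ne: "M \<noteq> {}" using subspace_0[OF M] by blast
  show "infdist (x + y) M \<le> infdist x M + infdist y M" for x y
  proof (rule field_le_epsilon)
    fix e :: real assume "0 < e"
    obtain a where a: "a \<in> M" "dist x a < infdist x M + e / 2"
      using infdist_less_witness[OF ne, of x "infdist x M + e / 2"] \<open>0 < e\<close> by auto
    obtain b where b: "b \<in> M" "dist y b < infdist y M + e / 2"
      using infdist_less_witness[OF ne, of y "infdist y M + e / 2"] \<open>0 < e\<close> by auto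
    have "infdist (x + y) M \<le> dist (x + y) (a + b)"
      using M a b by (intro infdist_le) (simp add: subspace_add)
    also have "\<dots> \<le> dist x a + dist y b" by (rule dist_triangle_add)
    finally show "infdist (x + y) M \<le> infdist x M + infdist y M + e" using a b by simp
  qed
  show "infdist (r *\<^sub>R x) M \<le> r * infdist x M" if r: "0 < r" for r x
  proof (rule field_le_epsilon)
    fix e :: real assume "0 < e"
    obtain a where a: "a \<in> M" "dist x a < infdist x M + e / r"
      using infdist_less_witness[OF ne, of x "infdist x M + e / r"] \<open>0 < e\<close> r by auto
    have "infdist (r *\<^sub>R x) M \<le> dist (r *\<^sub>R x) (r *\<^sub>R a)"
      using M a by (intro infdist_le) (simp add: subspace_scale)
    also have "\<dots> = r * dist x a" using r by (simp add: dist_norm flip: scaleR_right_diff_distrib)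
    also have "\<dots> \<le> r * (infdist x M + e / r)" using a r by (intro mult_left_mono) auto
    also have "\<dots> = r * infdist x M + e" using r by (simp add: distrib_left)
    finally show "infdist (r *\<^sub>R x) M \<le> r * infdist x M + e" .
  qed
qed

text \<open>The functional is taken below the directional infimum at \<open>x\<close> rather than
  below the distance itself; this forces \<open>f (- x)\<close> down to minus the distance of
  \<open>x\<close>, so the bound is attained at \<open>x\<close>. Being at most 0 on the subspace
  \<open>M\<close>, the functional vanishes there.\<close>

lemma Hahn_Banach_infdist:
  fixes M :: "'a::real_normed_vector set"
  assumes M: "subspace M"
  obtains f :: "'a \<Rightarrow>\<^sub>L real" where "\<And>y. f y \<le> infdist y M" "f x = infdist x M"
proof -
  note p = sublinear_infdist[OF M]
  obtain f where f: "linear f" "f \<le> (\<lambda>y. INF t\<in>{0..}. infdist (y + t *\<^sub>R x) M - t * infdist x M)"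
    using Hahn_Banach_sublinear[OF sublinear_directional_infimum(1)[OF p, of x]] .
  have le: "f y \<le> infdist y M" for y
    using f(2) sublinear_directional_infimum(2)[OF p, where z = x and y = y] by (auto simp: le_fun_def intro: order_trans)
  have "f (- x) \<le> - infdist x M"
    using f(2) sublinear_directional_infimum(3)[OF p, of x] by (auto simp: le_fun_def intro: order_trans)
  then have eq: "f x = infdist x M"
    using le[of x] linear_neg[OF f(1), of x] by simp
  have le_norm: "infdist y M \<le> norm y" for y
    using infdist_le[OF subspace_0[OF M], of y] by simp
  have "bounded_linear f"
  proof (rule bounded_linear_intro[where K = 1])
    show "norm (f y) \<le> norm y * 1" for y
      using le[of y] le[of "- y"] le_norm[of y] le_norm[of "- y"] linear_neg[OF f(1), of y] by simp
  qed (use f(1) in \<open>auto simp: linear_add linear_scale\<close>)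
  then have "blinfun_apply (Blinfun f) = f" by (rule bounded_linear_Blinfun_apply)
  then show ?thesis using that[of "Blinfun f"] le eq by simp
qed

definition annihilator :: "'a::real_normed_vector set \<Rightarrow> ('a \<Rightarrow>\<^sub>L real) set" where
  "annihilator M = {f :: 'a \<Rightarrow>\<^sub>L real. \<forall>y\<in>M. f y = 0}"

lemma subspace_annihilator: "subspace (annihilator M)"
  by (auto simp: subspace_def annihilator_def blinfun.add_left blinfun.scaleR_left)

lemma finite_codimension_inter_kernels:
  fixes B :: "('a::real_normed_vector \<Rightarrow>\<^sub>L real) set"
  assumes "finite B"
  shows "\<exists>C. finite C \<and> span ({y. \<forall>f\<in>B. f y = 0} \<union> C) = UNIV"
  using assms
proof (induction B)
  case empty
  then show ?case by (intro exI[of _ "{}"]) auto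
next
  case (insert g B)
  let ?K = "{y. \<forall>f\<in>B. f y = 0}" and ?L = "{y. \<forall>f\<in>insert g B. f y = 0}"
  obtain C where C: "finite C" "span (?K \<union> C) = UNIV" using insert.IH by blast
  show ?case
  proof (cases "\<forall>y\<in>?K. g y = 0")
    case True
    then have "?L = ?K" by auto
    then show ?thesis using C by (intro exI[of _ C]) simp
  next
    case False
    then obtain z where z: "z \<in> ?K" "g z \<noteq> 0" by blast
    have "y \<in> span (?L \<union> insert z C)" if "y \<in> ?K \<union> C" for y
    proof (cases "y \<in> C")
      case True
      then show ?thesis by (simp add: span_base)
    next
      case False
      have "y - (g y / g z) *\<^sub>R z \<in> ?L"
        using False that z by (auto simp: blinfun.diff_right blinfun.scaleR_right)
      then have "(y - (g y / g z) *\<^sub>R z) + (g y / g z) *\<^sub>R z \<in> span (?L \<union> insert z C)"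
        by (intro span_add span_scale span_base) auto
      then show ?thesis by simp
    qed
    then have "span (?K \<union> C) \<subseteq> span (?L \<union> insert z C)"
      by (intro span_minimal) auto
    then show ?thesis using C by (intro exI[of _ "insert z C"]) auto
  qed
qed

text \<open>If finitely many functionals spanned the annihilator, their common kernel would lie in
  \<open>M\<close>, because Hahn-Banach separates any point outside the closed \<open>M\<close> from
  \<open>M\<close>. Such a common kernel has finite codimension.\<close>

lemma infinite_dimensional_annihilator:
  fixes M :: "'a::real_normed_vector set"
  assumes M: "subspace M" "closed M" "infinite_codimensional M"
  shows "infinite_dimensional (annihilator M)"
  unfolding infinite_dimensional_def
proof
  assume "\<exists>B. finite B \<and> annihilator M \<subseteq> span B"
  then obtain B where B: "finite B" "annihilator M \<subseteq> span B" by blast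
  have "y \<in> M" if y: "\<forall>f\<in>B. f y = 0" for y
  proof (rule ccontr)
    assume "y \<notin> M"
    moreover have "M \<noteq> {}" using subspace_0[OF M(1)] by blast
    ultimately have pos: "0 < infdist y M" using M(2) by (intro infdist_pos_not_in_closed)
    obtain f :: "'a \<Rightarrow>\<^sub>L real" where f: "\<And>y. f y \<le> infdist y M" "f y = infdist y M"
      using Hahn_Banach_infdist[OF M(1)] by blast
    have "f m = 0" if "m \<in> M" for m
      using f(1)[of m] f(1)[of "- m"] that subspace_neg[OF M(1) that]
      by (simp add: blinfun.minus_right)
    then have "f \<in> span B" using B(2) by (auto simp: annihilator_def)
    then have "f y = 0"
      by (induction rule: span_induct_alt) (auto simp: blinfun.add_left blinfun.scaleR_left y)
    then show False using f(2) pos by simp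
  qed
  then have sub: "{y. \<forall>f\<in>B. f y = 0} \<subseteq> M" by blast
  obtain C where C: "finite C" "span ({y. \<forall>f\<in>B. f y = 0} \<union> C) = UNIV"
    using finite_codimension_inter_kernels[OF B(1)] by blast
  have "span ({y. \<forall>f\<in>B. f y = 0} \<union> C) \<subseteq> span (M \<union> C)"
    using sub by (intro span_mono) auto
  then show False using C M(3) unfolding infinite_codimensional_def by auto
qed

section \<open>The Hilbert space of square summable families\<close>

lemma square_summable_mult:
  fixes f g :: "'a \<Rightarrow> real"
  assumes "(\<lambda>i. (f i)\<^sup>2) summable_on UNIV" "(\<lambda>i. (g i)\<^sup>2) summable_on UNIV"
  shows "(\<lambda>i. f i * g i) summable_on UNIV"
proof -
  have "(\<lambda>i. \<bar>f i * g i\<bar>) summable_on UNIV"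
  proof (rule summable_on_comparison_test)
    show "(\<lambda>i. (f i)\<^sup>2 + (g i)\<^sup>2) summable_on UNIV" by (intro summable_on_add assms)
    show "\<bar>f i * g i\<bar> \<le> (f i)\<^sup>2 + (g i)\<^sup>2" for i
    proof -
      have "2 * (\<bar>f i\<bar> * \<bar>g i\<bar>) \<le> (f i)\<^sup>2 + (g i)\<^sup>2"
        using sum_squares_bound[of "\<bar>f i\<bar>" "\<bar>g i\<bar>"] by (simp add: mult.assoc)
      moreover have "0 \<le> \<bar>f i\<bar> * \<bar>g i\<bar>" by simp
      ultimately show ?thesis unfolding abs_mult by linarith
    qed
  qed simp
  then show ?thesis using summable_on_iff_abs_summable_on_real by auto
qed

text \<open>Summability is unordered and the index type arbitrary, so the same type serves for the
  uncountable family of the \<phi> \<gamma> and, over \<open>nat\<close>, as the target of the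
  Rademacher quotient.\<close>

typedef 'a l2 = "{f :: 'a \<Rightarrow> real. (\<lambda>i. (f i)\<^sup>2) summable_on UNIV}"
  morphisms l2_nth Abs_l2
  by (rule exI[of _ "\<lambda>_. 0"]) simp

setup_lifting type_definition_l2

lemma l2_eqI: "(\<And>i. l2_nth x i = l2_nth y i) \<Longrightarrow> x = y"
  by transfer auto

lemma l2_summable: "(\<lambda>i. (l2_nth x i)\<^sup>2) summable_on UNIV"
  by transfer

lemma l2_mult_summable: "(\<lambda>i. l2_nth x i * l2_nth y i) summable_on UNIV"
  by (intro square_summable_mult l2_summable)

instantiation l2 :: (type) real_inner
begin

lift_definition zero_l2 :: "'a l2" is "\<lambda>_. 0" by simp

lift_definition plus_l2 :: "'a l2 \<Rightarrow> 'a l2 \<Rightarrow> 'a l2" is "\<lambda>f g i. f i + g i"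
proof -
  fix f g :: "'a \<Rightarrow> real"
  assume fg: "(\<lambda>i. (f i)\<^sup>2) summable_on UNIV" "(\<lambda>i. (g i)\<^sup>2) summable_on UNIV"
  have "(\<lambda>i. (f i)\<^sup>2 + (g i)\<^sup>2 + 2 * (f i * g i)) summable_on UNIV"
    by (intro summable_on_add summable_on_cmult_right square_summable_mult fg)
  then show "(\<lambda>i. (f i + g i)\<^sup>2) summable_on UNIV"
    by (simp add: power2_sum mult.assoc)
qed

lift_definition scaleR_l2 :: "real \<Rightarrow> 'a l2 \<Rightarrow> 'a l2" is "\<lambda>r f i. r * f i"
  by (simp add: power_mult_distrib summable_on_cmult_right)

lift_definition uminus_l2 :: "'a l2 \<Rightarrow> 'a l2" is "\<lambda>f i. - f i" by simp

definition minus_l2 :: "'a l2 \<Rightarrow> 'a l2 \<Rightarrow> 'a l2" where "minus_l2 x y = x + - y"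

definition inner_l2 :: "'a l2 \<Rightarrow> 'a l2 \<Rightarrow> real" where
  "inner_l2 x y = (\<Sum>\<^sub>\<infinity>i. l2_nth x i * l2_nth y i)"

definition norm_l2 :: "'a l2 \<Rightarrow> real" where "norm_l2 x = sqrt (inner x x)"
definition dist_l2 :: "'a l2 \<Rightarrow> 'a l2 \<Rightarrow> real" where "dist_l2 x y = norm (x - y)"
definition sgn_l2 :: "'a l2 \<Rightarrow> 'a l2" where "sgn_l2 x = inverse (norm x) *\<^sub>R x"
definition uniformity_l2 :: "('a l2 \<times> 'a l2) filter" where
  "uniformity_l2 = (INF e\<in>{0<..}. principal {(x, y). dist x y < e})"
definition open_l2 :: "'a l2 set \<Rightarrow> bool" where
  "open_l2 U \<longleftrightarrow> (\<forall>x\<in>U. \<forall>\<^sub>F (x', y) in uniformity. x' = x \<longrightarrow> y \<in> U)"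

instance
proof
  fix x y z :: "'a l2" and r s :: real
  show "x + y + z = x + (y + z)" "x + y = y + x" "0 + x = x" "- x + x = 0"
    "r *\<^sub>R (x + y) = r *\<^sub>R x + r *\<^sub>R y" "(r + s) *\<^sub>R x = r *\<^sub>R x + s *\<^sub>R x"
    "r *\<^sub>R s *\<^sub>R x = (r * s) *\<^sub>R x" "1 *\<^sub>R x = x"
    by (transfer; auto simp: algebra_simps)+
  show "x - y = x + - y" by (rule minus_l2_def)
  show "dist x y = norm (x - y)" by (rule dist_l2_def)
  show "sgn x = inverse (norm x) *\<^sub>R x" by (rule sgn_l2_def)
  show "uniformity = (INF e\<in>{0<..}. principal {(x :: 'a l2, y). dist x y < e})"
    by (rule uniformity_l2_def)
  show "open U \<longleftrightarrow> (\<forall>x\<in>U. \<forall>\<^sub>F (x', y) in uniformity. x' = x \<longrightarrow> y \<in> U)" for U :: "'a l2 set"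
    by (rule open_l2_def)
  show "norm x = sqrt (inner x x)" by (rule norm_l2_def)
  show "inner x y = inner y x" by (simp add: inner_l2_def mult.commute)
  show "inner (x + y) z = inner x z + inner y z"
    unfolding inner_l2_def
    by (simp add: plus_l2.rep_eq distrib_right infsum_add l2_mult_summable)
  show "inner (r *\<^sub>R x) y = r * inner x y"
    unfolding inner_l2_def by (simp add: scaleR_l2.rep_eq mult.assoc infsum_cmult_right')
  show "0 \<le> inner x x" unfolding inner_l2_def by (simp add: infsum_nonneg)
  show "inner x x = 0 \<longleftrightarrow> x = 0"
  proof
    assume *: "inner x x = 0"
    show "x = 0"
    proof (rule l2_eqI)
      fix i
      have "l2_nth x i * l2_nth x i = 0"
        by (rule nonneg_infsum_le_0D[of "\<lambda>i. l2_nth x i * l2_nth x i" UNIV])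
          (use * in \<open>auto simp: inner_l2_def l2_mult_summable\<close>)
      then show "l2_nth x i = l2_nth 0 i" by (simp add: zero_l2.rep_eq)
    qed
  qed (simp add: inner_l2_def zero_l2.rep_eq)
qed

end

lemma l2_nth_minus: "l2_nth (x - y) i = l2_nth x i - l2_nth y i"
  by (simp only: minus_l2_def plus_l2.rep_eq uminus_l2.rep_eq)

lemma norm_l2_square: "(norm x)\<^sup>2 = (\<Sum>\<^sub>\<infinity>i. (l2_nth x i)\<^sup>2)"
  unfolding power2_norm_eq_inner inner_l2_def by (simp add: power2_eq_square)

lemma sum_squares_le_norm_l2: "finite F \<Longrightarrow> (\<Sum>i\<in>F. (l2_nth x i)\<^sup>2) \<le> (norm x)\<^sup>2"
  unfolding norm_l2_square by (intro finite_sum_le_infsum l2_summable) auto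

lemma norm_l2_leI:
  assumes "\<And>F. finite F \<Longrightarrow> (\<Sum>i\<in>F. (l2_nth x i)\<^sup>2) \<le> C\<^sup>2" "0 \<le> C"
  shows "norm x \<le> C"
proof (rule power2_le_imp_le)
  show "(norm x)\<^sup>2 \<le> C\<^sup>2"
    unfolding norm_l2_square using assms(1) by (intro infsum_le_finite_sums l2_summable) auto
qed fact

lemma norm_l2_tail:
  assumes "0 < e"
  obtains F where "finite F" "\<And>G. finite G \<Longrightarrow> G \<inter> F = {} \<Longrightarrow> (\<Sum>i\<in>G. (l2_nth x i)\<^sup>2) \<le> e"
    "(norm x)\<^sup>2 - e \<le> (\<Sum>i\<in>F. (l2_nth x i)\<^sup>2)"
proof -
  obtain F where F: "finite F" "dist (\<Sum>i\<in>F. (l2_nth x i)\<^sup>2) (\<Sum>\<^sub>\<infinity>i. (l2_nth x i)\<^sup>2) \<le> e"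
    using infsum_finite_approximation[OF l2_summable[of x] assms] by auto
  then have *: "(norm x)\<^sup>2 - e \<le> (\<Sum>i\<in>F. (l2_nth x i)\<^sup>2)"
    by (simp add: norm_l2_square dist_real_def)
  have "(\<Sum>i\<in>G. (l2_nth x i)\<^sup>2) \<le> e" if "finite G" "G \<inter> F = {}" for G
    using sum_squares_le_norm_l2[of "G \<union> F" x] * F(1) that by (simp add: sum.union_disjoint)
  then show ?thesis using F(1) * that by blast
qed

lemma l2_operator:
  fixes g :: "'i \<Rightarrow> 'a::real_normed_vector \<Rightarrow> real"
  assumes g: "\<And>i. linear (g i)" and C: "0 \<le> C"
    and le: "\<And>F x. finite F \<Longrightarrow> (\<Sum>i\<in>F. (g i x)\<^sup>2) \<le> (C * norm x)\<^sup>2"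
  obtains R :: "'a \<Rightarrow>\<^sub>L 'i l2" where "\<And>x i. l2_nth (R x) i = g i x" "\<And>x. norm (R x) \<le> C * norm x"
proof -
  have "(\<lambda>i. (g i x)\<^sup>2) summable_on UNIV" for x
    by (rule nonneg_bdd_above_summable_on) (use le[of _ x] in \<open>auto intro!: bdd_aboveI2\<close>)
  then have nth: "l2_nth (Abs_l2 (\<lambda>i. g i x)) i = g i x" for x i
    by (simp add: Abs_l2_inverse)
  have bound: "norm (Abs_l2 (\<lambda>i. g i x)) \<le> C * norm x" for x
    by (rule norm_l2_leI) (simp_all add: nth le C)
  have "bounded_linear (\<lambda>x. Abs_l2 (\<lambda>i. g i x))"
  proof (rule bounded_linear_intro[where K = C])
    show "Abs_l2 (\<lambda>i. g i (x + y)) = Abs_l2 (\<lambda>i. g i x) + Abs_l2 (\<lambda>i. g i y)" for x y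
      by (rule l2_eqI, unfold plus_l2.rep_eq nth, rule linear_add[OF g])
    show "Abs_l2 (\<lambda>i. g i (r *\<^sub>R x)) = r *\<^sub>R Abs_l2 (\<lambda>i. g i x)" for r x
      by (rule l2_eqI, unfold scaleR_l2.rep_eq nth) (simp add: linear_scale[OF g])
  qed (use bound in \<open>simp add: mult.commute\<close>)
  then have "blinfun_apply (Blinfun (\<lambda>x. Abs_l2 (\<lambda>i. g i x))) = (\<lambda>x. Abs_l2 (\<lambda>i. g i x))"
    by (rule bounded_linear_Blinfun_apply)
  then show ?thesis using that[of "Blinfun (\<lambda>x. Abs_l2 (\<lambda>i. g i x))"] nth bound by simp
qed

section \<open>Pointwise limits of functionals\<close>

text \<open>Convergence extends to the span by linearity, and the uniform bound \<open>K\<close>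
  carries the Cauchy property to the closure by a three epsilon argument.\<close>

lemma pointwise_limit_functional:
  fixes f :: "nat \<Rightarrow> 'a::real_normed_vector \<Rightarrow>\<^sub>L real"
  assumes S: "closure (span S) = UNIV" and K: "\<And>n. norm (f n) \<le> K"
    and conv: "\<And>s. s \<in> S \<Longrightarrow> convergent (\<lambda>n. f n s)"
  obtains L :: "'a \<Rightarrow>\<^sub>L real" where "\<And>x. (\<lambda>n. f n x) \<longlonglongrightarrow> L x" "norm L \<le> K"
proof -
  have K0: "0 \<le> K" using K[of 0] norm_ge_zero order_trans by blast
  have bound: "\<bar>f n x\<bar> \<le> K * norm x" for n x
    using norm_blinfun[of "f n" x] mult_right_mono[OF K[of n] norm_ge_zero[of x]] by simp
  have span: "convergent (\<lambda>n. f n y)" if "y \<in> span S" for y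
    using that
  proof (induction rule: span_induct_alt)
    case base
    then show ?case by (simp add: blinfun.zero_right convergent_const)
  next
    case (step c x y)
    have "convergent (\<lambda>n. c * f n x + f n y)"
      by (intro convergent_add convergent_mult convergent_const conv step)
    then show ?case by (simp add: blinfun.add_right blinfun.scaleR_right)
  qed
  have "Cauchy (\<lambda>n. f n x)" for x
    unfolding Cauchy_def
  proof (intro allI impI)
    fix e :: real assume e: "0 < e"
    have "0 < e / (3 * (K + 1))" using e K0 by simp
    then obtain y where y: "y \<in> span S" "dist y x < e / (3 * (K + 1))"
      using S closure_approachable[of x "span S"] by auto
    have small: "\<bar>f n x - f n y\<bar> < e / 3" for n
    proof -
      have "\<bar>f n x - f n y\<bar> \<le> K * norm (x - y)"
        using bound[of n "x - y"] by (simp add: blinfun.diff_right)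
      also have "\<dots> \<le> (K + 1) * norm (x - y)" by (simp add: mult_right_mono)
      also have "\<dots> < e / 3"
        using y(2) K0 by (simp add: dist_norm norm_minus_commute field_simps)
      finally show ?thesis .
    qed
    have "Cauchy (\<lambda>n. f n y)" using span[OF y(1)] by (rule convergent_Cauchy)
    then obtain m where m: "\<And>i j. i \<ge> m \<Longrightarrow> j \<ge> m \<Longrightarrow> dist (f i y) (f j y) < e / 3"
      unfolding Cauchy_def using e by (metis divide_pos_pos zero_less_numeral)
    have "dist (f i x) (f j x) < e" if "i \<ge> m" "j \<ge> m" for i j
      using m[OF that] small[of i] small[of j] unfolding dist_real_def abs_less_iff by linarith
    then show "\<exists>m. \<forall>i\<ge>m. \<forall>j\<ge>m. dist (f i x) (f j x) < e" by blast
  qed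
  then have lim: "(\<lambda>n. f n x) \<longlonglongrightarrow> lim (\<lambda>n. f n x)" for x
    by (simp add: Cauchy_convergent_iff convergent_LIMSEQ_iff)
  let ?L = "\<lambda>x. lim (\<lambda>n. f n x)"
  have L_bound: "norm (?L x) \<le> K * norm x" for x
    by (rule LIMSEQ_le_const2[OF tendsto_norm[OF lim]]) (use bound in auto)
  have "bounded_linear ?L"
  proof (rule bounded_linear_intro[where K = K])
    show "?L (x + y) = ?L x + ?L y" for x y
      using LIMSEQ_unique[OF lim[of "x + y"]] tendsto_add[OF lim[of x] lim[of y]]
      by (simp add: blinfun.add_right)
    show "?L (r *\<^sub>R x) = r *\<^sub>R ?L x" for r x
      using LIMSEQ_unique[OF lim[of "r *\<^sub>R x"]] tendsto_mult_left[OF lim[of x], of r]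
      by (simp add: blinfun.scaleR_right)
  qed (use L_bound in \<open>simp add: mult.commute\<close>)
  then have ap: "blinfun_apply (Blinfun ?L) = ?L" by (rule bounded_linear_Blinfun_apply)
  show ?thesis
  proof (rule that[of "Blinfun ?L"])
    show "(\<lambda>n. f n x) \<longlonglongrightarrow> Blinfun ?L x" for x using lim by (simp add: ap)
    show "norm (Blinfun ?L) \<le> K" using L_bound K0 by (intro norm_blinfun_bound) (simp_all add: ap)
  qed
qed

lemma convergent_subsequence_finite:
  fixes a :: "nat \<Rightarrow> 'i \<Rightarrow> real"
  assumes "finite F" "\<And>i. i \<in> F \<Longrightarrow> bounded (range (\<lambda>n. a n i))"
  shows "\<exists>r. strict_mono r \<and> (\<forall>i\<in>F. convergent (\<lambda>n. a (r n) i))"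
  using assms
proof (induction F)
  case empty
  then show ?case by (intro exI[of _ id]) (auto simp: strict_mono_def)
next
  case (insert j F)
  then obtain r where r: "strict_mono r" "\<forall>i\<in>F. convergent (\<lambda>n. a (r n) i)" by auto
  have "bounded (range (\<lambda>n. a (r n) j))"
    by (rule bounded_subset[OF insert.prems[of j]]) auto
  then obtain l r' where r': "strict_mono r'" "((\<lambda>n. a (r n) j) \<circ> r') \<longlonglongrightarrow> l"
    using bounded_imp_convergent_subsequence by blast
  have "convergent (\<lambda>n. a ((r \<circ> r') n) i)" if "i \<in> insert j F" for i
  proof (cases "i = j")
    case True
    then show ?thesis using r'(2) by (auto simp: convergent_def o_def)
  next
    case False
    then have "convergent (\<lambda>n. a (r n) i)" using that r(2) by blast
    then show ?thesis
      using convergent_subseq_convergent[OF _ r'(1)] by (fastforce simp: o_def)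
  qed
  then show ?case using strict_mono_o[OF r(1) r'(1)] by blast
qed

text \<open>A finite set of coordinates with values at least \<open>\<epsilon>\<close> along a subsequence has bounded cardinality, and
  one of maximal cardinality leaves nothing large outside.\<close>

lemma small_outside_finite_set:
  fixes a :: "nat \<Rightarrow> 'i \<Rightarrow> real"
  assumes ev: "\<And>F. finite F \<Longrightarrow> \<forall>\<^sub>F n in sequentially. (\<Sum>i\<in>F. (a n i)\<^sup>2) \<le> C" and eps: "0 < \<epsilon>"
  obtains r F where "strict_mono (r :: nat \<Rightarrow> nat)" "finite F" "\<And>i. i \<notin> F \<Longrightarrow> \<forall>\<^sub>F n in sequentially. \<bar>a (r n) i\<bar> \<le> \<epsilon>"
proof -
  let ?P = "\<lambda>k. \<exists>r F. strict_mono (r :: nat \<Rightarrow> nat) \<and> finite F \<and> card F = k \<and> (\<forall>i\<in>F. \<forall>n. \<epsilon> \<le> \<bar>a (r n) i\<bar>)"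
  have "?P 0" by (intro exI[of _ id] exI[of _ "{}"]) (auto simp: strict_mono_def)
  moreover have bound: "k \<le> nat \<lceil>C / \<epsilon>\<^sup>2\<rceil>" if Pk: "?P k" for k
  proof -
    obtain r F where rF: "strict_mono (r :: nat \<Rightarrow> nat)" "finite F" "card F = k" "\<forall>i\<in>F. \<forall>n. \<epsilon> \<le> \<bar>a (r n) i\<bar>"
      using Pk by blast
    have "\<forall>\<^sub>F n in sequentially. (\<Sum>i\<in>F. (a (r n) i)\<^sup>2) \<le> C"
      using eventually_subseq[OF rF(1) ev[OF rF(2)]] .
    then obtain n where n: "(\<Sum>i\<in>F. (a (r n) i)\<^sup>2) \<le> C"
      by (auto simp: eventually_sequentially)
    have "real k * \<epsilon>\<^sup>2 = (\<Sum>i\<in>F. \<epsilon>\<^sup>2)" by (simp add: rF)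
    also have "\<dots> \<le> (\<Sum>i\<in>F. (a (r n) i)\<^sup>2)"
      using rF(4) eps by (intro sum_mono) (metis abs_le_square_iff abs_of_pos)
    finally have "real k \<le> C / \<epsilon>\<^sup>2" using n eps by (simp add: pos_le_divide_eq)
    then show ?thesis by linarith
  qed
  ultimately have k: "?P (Greatest ?P)" "\<And>k'. ?P k' \<Longrightarrow> k' \<le> Greatest ?P"
    using GreatestI_nat[where P = ?P, OF _ bound] Greatest_le_nat[where P = ?P, OF _ bound] by blast+
  from k(1) obtain r F where rF: "strict_mono (r :: nat \<Rightarrow> nat)" "finite F" "card F = Greatest ?P" "\<forall>i\<in>F. \<forall>n. \<epsilon> \<le> \<bar>a (r n) i\<bar>"
    by blast
  have "\<forall>\<^sub>F n in sequentially. \<bar>a (r n) i\<bar> \<le> \<epsilon>" if i: "i \<notin> F" for i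
  proof (rule ccontr)
    assume "\<not> (\<forall>\<^sub>F n in sequentially. \<bar>a (r n) i\<bar> \<le> \<epsilon>)"
    then have inf: "infinite {n. \<epsilon> < \<bar>a (r n) i\<bar>}"
      by (simp add: cofinite_eq_sequentially[symmetric] eventually_cofinite not_le)
    let ?q = "enumerate {n. \<epsilon> < \<bar>a (r n) i\<bar>}"
    have q: "strict_mono ?q" "\<And>n. \<epsilon> < \<bar>a (r (?q n)) i\<bar>"
      using inf enumerate_in_set[OF inf] by (auto simp: strict_mono_enumerate)
    have "?P (card (insert i F))"
      using rF q(2) by (intro exI[of _ "r \<circ> ?q"] exI[of _ "insert i F"])
        (auto intro: strict_mono_o q(1) less_imp_le)
    then show False using k(2)[of "card (insert i F)"] i rF by simp
  qed
  then show ?thesis using that rF(1,2) by blast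
qed

text \<open>The index type may be uncountable, so one cannot diagonalize over the coordinates. The
  diagonal runs over precisions instead: at stage \<open>k\<close> a subsequence is chosen along
  which all coordinates outside a finite set are eventually at most \<open>1 / (k + 1)\<close>, and
  those inside it converge. Along the diagonal a coordinate either belongs to one of these finite
  sets and converges, or is eventually below every precision and tends to 0.\<close>

lemma coordinatewise_convergent_subsequence:
  fixes a :: "nat \<Rightarrow> 'i \<Rightarrow> real"
  assumes ev: "\<And>F. finite F \<Longrightarrow> \<forall>\<^sub>F n in sequentially. (\<Sum>i\<in>F. (a n i)\<^sup>2) \<le> C"
  obtains s where "strict_mono (s :: nat \<Rightarrow> nat)" "\<And>i. convergent (\<lambda>n. a (s n) i)"
proof -
  have bdd: "bounded (range (\<lambda>n. a n i))" for i
  proof -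
    have "\<forall>\<^sub>F n in sequentially. (a n i)\<^sup>2 \<le> C"
      using ev[of "{i}"] by simp
    then have "\<forall>\<^sub>F n in sequentially. norm (a n i) \<le> C + 1"
    proof eventually_elim
      case (elim n)
      have "2 * \<bar>a n i\<bar> * 1 \<le> \<bar>a n i\<bar>\<^sup>2 + 1\<^sup>2" by (rule sum_squares_bound)
      moreover have "0 \<le> (a n i)\<^sup>2" by simp
      ultimately show ?case using elim by simp
    qed
    then have "Bseq (\<lambda>n. a n i)" by (rule BfunI)
    then show ?thesis by (simp add: Bseq_eq_bounded)
  qed
  define P where "P k s \<longleftrightarrow> (\<exists>F. finite F \<and> (\<forall>i\<in>F. convergent (\<lambda>n. a (s n) i)) \<and>
      (\<forall>i. i \<notin> F \<longrightarrow> (\<forall>\<^sub>F n in sequentially. \<bar>a (s n) i\<bar> \<le> 1 / (real k + 1))))" for k :: nat and s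
  interpret subseqs P
  proof
    fix k and s :: "nat \<Rightarrow> nat" assume s: "strict_mono s"
    obtain r F where rF: "strict_mono (r :: nat \<Rightarrow> nat)" "finite F"
      "\<And>i. i \<notin> F \<Longrightarrow> \<forall>\<^sub>F n in sequentially. \<bar>a (s (r n)) i\<bar> \<le> 1 / (real k + 1)"
      using small_outside_finite_set[of "\<lambda>n. a (s n)" C "1 / (real k + 1)"]
        eventually_subseq[OF s ev] by auto
    have "bounded (range (\<lambda>n. a (s (r n)) i))" for i
      by (rule bounded_subset[OF bdd[of i]]) auto
    then obtain r' where r': "strict_mono r'" "\<forall>i\<in>F. convergent (\<lambda>n. a (s (r (r' n))) i)"
      using convergent_subsequence_finite[of F "\<lambda>n. a (s (r n))", OF rF(2)] by blast
    show "\<exists>r. strict_mono r \<and> P k (s \<circ> r)"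
      unfolding P_def using rF r' eventually_subseq[OF r'(1) rF(3)] strict_mono_o[OF rF(1) r'(1)]
      by (intro exI[of _ "r \<circ> r'"] conjI exI[of _ F]) auto
  qed
  \<comment> \<open>The property \<open>P k\<close> is inherited by subsequences, and from index
    \<open>Suc k\<close> on the diagonal sequence is a subsequence of one that has it.\<close>
  have P: "P k (diagseq \<circ> ((+) (Suc k)))" for k
  proof (rule diagseq_holds)
    fix r s :: "nat \<Rightarrow> nat" and n assume r: "strict_mono r" and "P n s"
    then obtain F where F: "finite F" "\<And>i. i \<in> F \<Longrightarrow> convergent (\<lambda>n. a (s n) i)"
      "\<And>i. i \<notin> F \<Longrightarrow> \<forall>\<^sub>F m in sequentially. \<bar>a (s m) i\<bar> \<le> 1 / (real n + 1)"
      unfolding P_def by blast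
    have "convergent (\<lambda>n. a (s (r n)) i)" if "i \<in> F" for i
      using convergent_subseq_convergent[OF F(2)[OF that] r] by (simp add: o_def)
    then show "P n (s \<circ> r)"
      unfolding P_def using F(1) eventually_subseq[OF r F(3)] by (intro exI[of _ F]) auto
  qed
  have "convergent (\<lambda>n. a (diagseq n) i)" for i
  proof (cases "\<forall>k. \<forall>\<^sub>F n in sequentially. \<bar>a (diagseq n) i\<bar> \<le> 1 / (real k + 1)")
    case True
    have "(\<lambda>n. a (diagseq n) i) \<longlonglongrightarrow> 0"
    proof (rule tendstoI)
      fix e :: real assume "0 < e"
      then obtain k where k: "1 / (real k + 1) < e"
        using nat_approx_posE by (metis of_nat_Suc add.commute)
      from True[rule_format, of k] show "\<forall>\<^sub>F n in sequentially. dist (a (diagseq n) i) 0 < e"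
        by eventually_elim (use k in simp)
    qed
    then show ?thesis by (auto simp: convergent_def)
  next
    case False
    then obtain k where k: "\<not> (\<forall>\<^sub>F n in sequentially. \<bar>a (diagseq n) i\<bar> \<le> 1 / (real k + 1))" by blast
    obtain F where F: "\<And>i. i \<in> F \<Longrightarrow> convergent (\<lambda>n. a (diagseq (Suc k + n)) i)"
      "\<And>i. i \<notin> F \<Longrightarrow> \<forall>\<^sub>F n in sequentially. \<bar>a (diagseq (Suc k + n)) i\<bar> \<le> 1 / (real k + 1)"
      using P[of k] unfolding P_def by auto
    have "i \<in> F"
    proof (rule ccontr)
      assume "i \<notin> F"
      from F(2)[OF this] have "\<forall>\<^sub>F n in sequentially. \<bar>a (diagseq (n + Suc k)) i\<bar> \<le> 1 / (real k + 1)"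
        by (simp add: add.commute)
      then show False
        using k eventually_sequentially_seg[of "\<lambda>n. \<bar>a (diagseq n) i\<bar> \<le> 1 / (real k + 1)" "Suc k"] by blast
    qed
    from F(1)[OF this] have "convergent (\<lambda>n. a (diagseq (n + Suc k)) i)"
      by (simp add: add.commute)
    then show ?thesis
      unfolding convergent_def using LIMSEQ_offset[of "\<lambda>n. a (diagseq n) i" "Suc k"] by blast
  qed
  then show ?thesis using that subseq_diagseq by blast
qed

text \<open>Turns termwise bounds into the two smallness hypotheses of the perturbation lemmas. The
  bounding series sums to \<open>2 * c\<close>, and the constructions below arrange \<open>c\<close>
  to be 1/8 or 1/16.\<close>

lemma geometric_small_sum:
  fixes t :: "nat \<Rightarrow> real"
  assumes "\<And>n. 0 \<le> t n" "\<And>n. t n \<le> c * (1 / 2) ^ n" "2 * c < 1"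
  shows "summable t" "suminf t < 1"
proof -
  have geo: "(\<lambda>n. c * (1 / 2) ^ n) sums (c * 2)"
    using sums_mult[OF geometric_sums[of "1 / 2 :: real"], of c] by simp
  show sm: "summable t"
    by (rule summable_comparison_test[OF _ sums_summable[OF geo]]) (use assms in auto)
  have "suminf t \<le> c * 2"
    using suminf_le[OF assms(2) sm sums_summable[OF geo]] sums_unique[OF geo] by simp
  then show "suminf t < 1" using assms(3) by simp
qed

lemma span_rangeE:
  assumes "y \<in> span (range f)"
  obtains A a where "finite A" "y = (\<Sum>i\<in>A. a i *\<^sub>R f i)"
proof -
  have "\<exists>A a. finite A \<and> y = (\<Sum>i\<in>A. a i *\<^sub>R f i)"
    using assms
  proof (induction rule: span_induct_alt)
    case base
    then show ?case by (intro exI[of _ "{}"]) simp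
  next
    case (step c x y)
    then obtain A a i where A: "finite A" "y = (\<Sum>i\<in>A. a i *\<^sub>R f i)" "x = f i" by blast
    let ?a = "\<lambda>j. (if j = i then c else 0) + (if j \<in> A then a j else 0)"
    have "(\<Sum>j\<in>insert i A. ?a j *\<^sub>R f j) = (\<Sum>j\<in>insert i A. (if j = i then c *\<^sub>R f i else 0))
        + (\<Sum>j\<in>insert i A. if j \<in> A then a j *\<^sub>R f j else 0)"
      unfolding sum.distrib[symmetric] by (intro sum.cong) (auto simp: scaleR_left_distrib)
    also have "(\<Sum>j\<in>insert i A. if j \<in> A then a j *\<^sub>R f j else 0) = y"
      unfolding A(2) using A(1) by (intro sum.mono_neutral_cong_right) auto
    finally have "c *\<^sub>R x + y = (\<Sum>j\<in>insert i A. ?a j *\<^sub>R f j)"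
      using A by simp
    then show ?case using A(1) by (intro exI[of _ "insert i A"] exI[of _ ?a]) simp
  qed
  then show ?thesis using that by blast
qed

lemma disjoint_consecutive_intervals:
  fixes m :: "nat \<Rightarrow> nat"
  assumes "strict_mono m" "i \<noteq> n"
  shows "{m i..<m (Suc i)} \<inter> {m n..<m (Suc n)} = {}"
proof -
  have "m (Suc i) \<le> m n" if "i < n" for i n
    using assms(1) that by (simp add: strict_mono_less_eq Suc_le_eq)
  then show ?thesis using assms(2) by (cases i n rule: linorder_cases) fastforce+
qed

section \<open>The space JL through its coordinate functionals\<close>

text \<open>\<open>\<delta> k\<close> evaluates at the \<open>k\<close>-th coordinate and \<open>e \<gamma>\<close> extracts the coefficient of \<open>\<phi> \<gamma>\<close>, so \<open>norm x\<close>
  is the maximum of the sup norm of \<open>(\<delta> k x)\<close> and the Euclidean norm of \<open>(e \<gamma> x)\<close>.\<close>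

locale JL_model =
  fixes N :: "'g \<Rightarrow> nat set" and u :: "nat \<Rightarrow> 'x::banach" and \<phi> :: "'g \<Rightarrow> 'x"
    and \<delta> :: "nat \<Rightarrow> 'x \<Rightarrow>\<^sub>L real" and e :: "'g \<Rightarrow> 'x \<Rightarrow>\<^sub>L real"
  assumes almost_disjoint: "\<gamma> \<noteq> \<gamma>' \<Longrightarrow> finite (N \<gamma> \<inter> N \<gamma>')"
    and \<delta>_u: "\<delta> j (u k) = (if j = k then 1 else 0)"
    and e_u: "e \<gamma> (u k) = 0"
    and \<delta>_\<phi>: "\<delta> k (\<phi> \<gamma>) = (if k \<in> N \<gamma> then 1 else 0)"
    and e_\<phi>: "e \<gamma> (\<phi> \<gamma>') = (if \<gamma> = \<gamma>' then 1 else 0)"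
    and dense: "closure (span (range u \<union> range \<phi>)) = UNIV"
    and abs_\<delta>_le: "\<bar>\<delta> k x\<bar> \<le> norm x"
    and sum_e_le: "finite F \<Longrightarrow> (\<Sum>\<gamma>\<in>F. (e \<gamma> x)\<^sup>2) \<le> (norm x)\<^sup>2"
    and norm_leI: "0 \<le> C \<Longrightarrow> (\<And>k. \<bar>\<delta> k x\<bar> \<le> C) \<Longrightarrow>
      (\<And>F. finite F \<Longrightarrow> (\<Sum>\<gamma>\<in>F. (e \<gamma> x)\<^sup>2) \<le> C\<^sup>2) \<Longrightarrow> norm x \<le> C"
begin

lemma norm_\<delta>_le: "norm (\<delta> k) \<le> 1"
  by (rule norm_blinfun_bound) (simp_all add: abs_\<delta>_le)

lemma \<delta>_sum_u: "finite A \<Longrightarrow> \<delta> j (\<Sum>k\<in>A. a k *\<^sub>R u k) = (if j \<in> A then a j else 0)"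
  by (simp add: blinfun.sum_right blinfun.scaleR_right \<delta>_u if_distrib sum.delta cong: if_cong)

lemma e_sum_u: "e \<gamma> (\<Sum>k\<in>A. a k *\<^sub>R u k) = 0"
  by (simp add: blinfun.sum_right blinfun.scaleR_right e_u)

lemma norm_sum_u_le:
  assumes "finite A" "0 \<le> B" "\<And>k. k \<in> A \<Longrightarrow> \<bar>a k\<bar> \<le> B"
  shows "norm (\<Sum>k\<in>A. a k *\<^sub>R u k) \<le> B"
  by (rule norm_leI) (use assms in \<open>auto simp: \<delta>_sum_u e_sum_u\<close>)

text \<open>Testing \<open>f\<close> on the sign vector of the values \<open>f (u k)\<close>, which
  has norm at most 1, shows that the restriction of \<open>f\<close> to c0 is given by an l1
  sequence.\<close>

lemma sum_abs_u_le:
  fixes f :: "'x \<Rightarrow>\<^sub>L real"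
  assumes "finite A"
  shows "(\<Sum>k\<in>A. \<bar>f (u k)\<bar>) \<le> norm f"
proof -
  let ?x = "\<Sum>k\<in>A. sgn (f (u k)) *\<^sub>R u k"
  have "f ?x = (\<Sum>k\<in>A. \<bar>f (u k)\<bar>)"
    by (simp add: blinfun.sum_right blinfun.scaleR_right abs_sgn mult.commute)
  moreover have "norm ?x \<le> 1"
    using assms by (intro norm_sum_u_le) (auto simp: sgn_if)
  moreover have "f ?x \<le> norm f * norm ?x"
    using norm_blinfun[of f ?x] by simp
  ultimately show ?thesis
    using mult_left_mono[of "norm ?x" 1 "norm f"] by simp
qed

text \<open>At each coordinate at most one of the disjoint blocks is nonzero, and every
  \<open>e \<gamma>\<close> vanishes on the blocks, so only the sup norm counts.\<close>

lemma norm_blocks_le: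
  assumes F: "finite F" and A: "\<And>n. n \<in> F \<Longrightarrow> finite (A n)"
    "\<And>n m. n \<in> F \<Longrightarrow> m \<in> F \<Longrightarrow> n \<noteq> m \<Longrightarrow> A n \<inter> A m = {}"
    and a: "\<And>n k. n \<in> F \<Longrightarrow> k \<in> A n \<Longrightarrow> \<bar>a n k\<bar> \<le> 1" and B: "0 \<le> B" "\<And>n. n \<in> F \<Longrightarrow> \<bar>c n\<bar> \<le> B"
  shows "norm (\<Sum>n\<in>F. c n *\<^sub>R (\<Sum>k\<in>A n. a n k *\<^sub>R u k)) \<le> B"
proof (rule norm_leI)
  let ?x = "\<Sum>n\<in>F. c n *\<^sub>R (\<Sum>k\<in>A n. a n k *\<^sub>R u k)"
  show "\<bar>\<delta> j ?x\<bar> \<le> B" for j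
  proof -
    have eq: "\<delta> j ?x = (\<Sum>n\<in>F. if j \<in> A n then c n * a n j else 0)"
      using A(1) by (simp add: blinfun.sum_right[of "\<delta> j" _ F] blinfun.scaleR_right \<delta>_sum_u
          if_distrib cong: if_cong sum.cong)
    show ?thesis
    proof (cases "\<exists>n\<in>F. j \<in> A n")
      case True
      then obtain n where n: "n \<in> F" "j \<in> A n" by blast
      have "(\<Sum>m\<in>F. if j \<in> A m then c m * a m j else 0) = (\<Sum>m\<in>F. if m = n then c n * a n j else 0)"
      proof (rule sum.cong[OF refl])
        fix m assume "m \<in> F"
        then show "(if j \<in> A m then c m * a m j else 0) = (if m = n then c n * a n j else 0)"
          using A(2)[of m n] n by auto
      qed
      then have "\<delta> j ?x = c n * a n j" using eq F n by simp
      moreover have "\<bar>c n\<bar> * \<bar>a n j\<bar> \<le> B * 1" using B a n by (intro mult_mono) auto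
      ultimately show ?thesis by (simp add: abs_mult)
    next
      case False
      then have "(\<Sum>m\<in>F. if j \<in> A m then c m * a m j else 0) = 0"
        by (intro sum.neutral) auto
      then show ?thesis using eq B(1) by simp
    qed
  qed
  show "(\<Sum>\<gamma>\<in>G. (e \<gamma> ?x)\<^sup>2) \<le> B\<^sup>2" for G
    by (simp add: blinfun.sum_right[of _ _ F] blinfun.scaleR_right e_sum_u)
qed fact

text \<open>Discarding finitely many coordinates makes finitely many of the \<open>\<phi> \<gamma>\<close> disjointly supported.\<close>

definition cut :: "'g \<Rightarrow> nat \<Rightarrow> 'x" where
  "cut \<gamma> K = \<phi> \<gamma> - (\<Sum>k\<in>N \<gamma> \<inter> {..<K}. u k)"

lemma \<delta>_cut: "\<delta> k (cut \<gamma> K) = (if k \<in> N \<gamma> \<and> K \<le> k then 1 else 0)"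
proof -
  have "\<delta> k (\<Sum>k\<in>N \<gamma> \<inter> {..<K}. u k) = (if k \<in> N \<gamma> \<inter> {..<K} then 1 else 0)"
    using \<delta>_sum_u[of "N \<gamma> \<inter> {..<K}" k "\<lambda>_. 1"] by simp
  then show ?thesis by (auto simp: cut_def blinfun.diff_right \<delta>_\<phi>)
qed

lemma e_cut: "e \<gamma> (cut \<gamma>' K) = (if \<gamma> = \<gamma>' then 1 else 0)"
  using e_sum_u[of \<gamma> "\<lambda>_. 1"] by (simp add: cut_def blinfun.diff_right e_\<phi>)

text \<open>Each coordinate meets at most one of the cut supports, so the sup norm is at most the
  largest modulus of a \<open>b \<gamma>\<close>, and the Euclidean norm decides. The height
  \<open>\<kappa> \<gamma>\<close> may vary with \<gamma> because blocks built at different stages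
  are cut at different heights.\<close>

lemma norm_sum_cut_le:
  assumes F: "finite F"
    and disj: "\<And>\<gamma> \<gamma>' k. \<gamma> \<in> F \<Longrightarrow> \<gamma>' \<in> F \<Longrightarrow> k \<in> N \<gamma> \<Longrightarrow> k \<in> N \<gamma>' \<Longrightarrow> \<kappa> \<gamma> \<le> k \<Longrightarrow> \<kappa> \<gamma>' \<le> k \<Longrightarrow> \<gamma> = \<gamma>'"
  shows "norm (\<Sum>\<gamma>\<in>F. b \<gamma> *\<^sub>R cut \<gamma> (\<kappa> \<gamma>)) \<le> L2_set b F"
proof (rule norm_leI)
  let ?x = "\<Sum>\<gamma>\<in>F. b \<gamma> *\<^sub>R cut \<gamma> (\<kappa> \<gamma>)"
  show "\<bar>\<delta> k ?x\<bar> \<le> L2_set b F" for k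
  proof -
    have eq: "\<delta> k ?x = (\<Sum>\<gamma>\<in>F. if k \<in> N \<gamma> \<and> \<kappa> \<gamma> \<le> k then b \<gamma> else 0)"
      by (simp add: blinfun.sum_right blinfun.scaleR_right \<delta>_cut if_distrib cong: if_cong)
    show ?thesis
    proof (cases "\<exists>\<gamma>\<in>F. k \<in> N \<gamma> \<and> \<kappa> \<gamma> \<le> k")
      case True
      then obtain \<gamma> where \<gamma>: "\<gamma> \<in> F" "k \<in> N \<gamma>" "\<kappa> \<gamma> \<le> k" by blast
      have "(\<Sum>\<gamma>\<in>F. if k \<in> N \<gamma> \<and> \<kappa> \<gamma> \<le> k then b \<gamma> else 0) = (\<Sum>\<gamma>'\<in>F. if \<gamma>' = \<gamma> then b \<gamma> else 0)"
        using disj \<gamma> by (intro sum.cong) auto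
      then have "\<bar>\<delta> k ?x\<bar> = L2_set b {\<gamma>}" using eq F \<gamma> by simp
      also have "\<dots> \<le> L2_set b F"
        unfolding L2_set_def using F \<gamma> by (intro real_sqrt_le_mono sum_mono2) auto
      finally show ?thesis .
    next
      case False
      then have "(\<Sum>\<gamma>\<in>F. if k \<in> N \<gamma> \<and> \<kappa> \<gamma> \<le> k then b \<gamma> else 0) = 0"
        by (intro sum.neutral) auto
      then show ?thesis using eq by simp
    qed
  qed
  show "(\<Sum>\<gamma>\<in>G. (e \<gamma> ?x)\<^sup>2) \<le> (L2_set b F)\<^sup>2" if G: "finite G" for G
  proof -
    have "e \<gamma> ?x = (if \<gamma> \<in> F then b \<gamma> else 0)" for \<gamma>
      using F by (simp add: blinfun.sum_right blinfun.scaleR_right e_cut if_distrib sum.delta cong: if_cong)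
    then have "(\<Sum>\<gamma>\<in>G. (e \<gamma> ?x)\<^sup>2) = (\<Sum>\<gamma>\<in>G. if \<gamma> \<in> F then (b \<gamma>)\<^sup>2 else 0)"
      by (intro sum.cong) auto
    also have "\<dots> = (\<Sum>\<gamma>\<in>G \<inter> F. (b \<gamma>)\<^sup>2)" using G by (simp add: sum.inter_restrict)
    also have "\<dots> \<le> (\<Sum>\<gamma>\<in>F. (b \<gamma>)\<^sup>2)" using F by (intro sum_mono2) auto
    also have "\<dots> = (L2_set b F)\<^sup>2" by (simp add: L2_set_def sum_nonneg)
    finally show ?thesis .
  qed
qed simp

lemma disjoint_cuts:
  assumes "finite F"
  obtains K where "\<And>\<gamma> \<gamma>' k. \<gamma> \<in> F \<Longrightarrow> \<gamma>' \<in> F \<Longrightarrow> k \<in> N \<gamma> \<Longrightarrow> k \<in> N \<gamma>' \<Longrightarrow> K \<le> k \<Longrightarrow> \<gamma> = \<gamma>'"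
proof -
  let ?S = "\<Union>\<gamma>\<in>F. \<Union>\<gamma>'\<in>F - {\<gamma>}. N \<gamma> \<inter> N \<gamma>'"
  have "finite ?S" using assms by (intro finite_UN_I finite_Diff almost_disjoint) auto
  then obtain K where "\<forall>k\<in>?S. k < K" using finite_nat_set_iff_bounded by blast
  then show ?thesis by (intro that[of K]) (force simp: not_less[symmetric])
qed

text \<open>Duality: \<open>f\<close> takes the square of the left side as its value at the
  combination of the cuts with coefficients \<open>f (cut \<gamma> K)\<close>, and the norm of this
  combination is at most the left side.\<close>

lemma functional_cut_l2:
  fixes f :: "'x \<Rightarrow>\<^sub>L real"
  assumes F: "finite F"
    and disj: "\<And>\<gamma> \<gamma>' k. \<gamma> \<in> F \<Longrightarrow> \<gamma>' \<in> F \<Longrightarrow> k \<in> N \<gamma> \<Longrightarrow> k \<in> N \<gamma>' \<Longrightarrow> K \<le> k \<Longrightarrow> \<gamma> = \<gamma>'"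
  shows "L2_set (\<lambda>\<gamma>. f (cut \<gamma> K)) F \<le> norm f"
proof -
  let ?b = "\<lambda>\<gamma>. f (cut \<gamma> K)" let ?x = "\<Sum>\<gamma>\<in>F. ?b \<gamma> *\<^sub>R cut \<gamma> K"
  have "(L2_set ?b F)\<^sup>2 = f ?x"
    by (simp add: L2_set_def sum_nonneg blinfun.sum_right blinfun.scaleR_right power2_eq_square)
  also have "\<dots> \<le> norm f * norm ?x" using norm_blinfun[of f ?x] by simp
  also have "\<dots> \<le> norm f * L2_set ?b F"
    by (intro mult_left_mono norm_sum_cut_le F disj) auto
  finally show ?thesis
    by (cases "L2_set ?b F = 0") (auto simp: power2_eq_square less_le)
qed

text \<open>Replacing \<open>\<phi> \<gamma>\<close> by a cut changes
  \<open>f n (\<phi> \<gamma>)\<close> by finitely many values \<open>f n (u k)\<close>, which tend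
  to 0, and the values at disjoint cuts have l2 norm at most \<open>K\<close>. So over a finite set
  \<open>F\<close> the squares of the \<open>f n (\<phi> \<gamma>)\<close> sum to at most
  \<open>(K + 1)\<^sup>2\<close> from some stage on. This stage depends on \<open>F\<close>, but
  that is enough for coordinatewise convergence along a subsequence, and then for convergence on the
  dense span.\<close>

lemma weak_star_convergent_subsequence:
  fixes f :: "nat \<Rightarrow> 'x \<Rightarrow>\<^sub>L real"
  assumes K: "\<And>n. norm (f n) \<le> K" and null: "\<And>k. (\<lambda>n. f n (u k)) \<longlonglongrightarrow> 0"
  obtains s L where "strict_mono s" "\<And>x. (\<lambda>n. f (s n) x) \<longlonglongrightarrow> blinfun_apply L x" "norm L \<le> K"
    "\<And>k. L (u k) = 0"
proof -
  have K0: "0 \<le> K" using K[of 0] norm_ge_zero order_trans by blast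
  have ev: "\<forall>\<^sub>F n in sequentially. (\<Sum>\<gamma>\<in>F. (f n (\<phi> \<gamma>))\<^sup>2) \<le> (K + 1)\<^sup>2" if F: "finite F" for F
  proof -
    obtain m where m: "\<And>\<gamma> \<gamma>' k. \<gamma> \<in> F \<Longrightarrow> \<gamma>' \<in> F \<Longrightarrow> k \<in> N \<gamma> \<Longrightarrow> k \<in> N \<gamma>' \<Longrightarrow> m \<le> k \<Longrightarrow> \<gamma> = \<gamma>'"
      using disjoint_cuts[OF F] by blast
    define d where "d n \<gamma> = (\<Sum>k\<in>N \<gamma> \<inter> {..<m}. f n (u k))" for n \<gamma>
    have split: "f n (\<phi> \<gamma>) = f n (cut \<gamma> m) + d n \<gamma>" for n \<gamma>
      by (simp add: cut_def d_def blinfun.diff_right blinfun.sum_right)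
    have "(\<lambda>n. L2_set (d n) F) \<longlonglongrightarrow> sqrt (\<Sum>\<gamma>\<in>F. (\<Sum>k\<in>N \<gamma> \<inter> {..<m}. 0)\<^sup>2)"
      unfolding L2_set_def d_def by (intro tendsto_intros null)
    then have "\<forall>\<^sub>F n in sequentially. L2_set (d n) F < 1"
      by (rule order_tendstoD) simp
    then show ?thesis
    proof eventually_elim
      case (elim n)
      have "L2_set (\<lambda>\<gamma>. f n (\<phi> \<gamma>)) F \<le> L2_set (\<lambda>\<gamma>. f n (cut \<gamma> m)) F + L2_set (d n) F"
        unfolding split by (rule L2_set_triangle_ineq)
      also have "\<dots> \<le> K + 1"
      proof -
        have "L2_set (\<lambda>\<gamma>. f n (cut \<gamma> m)) F \<le> norm (f n)"
          by (rule functional_cut_l2[OF F]) (rule m)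
        then show ?thesis using K[of n] elim by simp
      qed
      finally have "(L2_set (\<lambda>\<gamma>. f n (\<phi> \<gamma>)) F)\<^sup>2 \<le> (K + 1)\<^sup>2" by (intro power_mono) auto
      then show ?case by (simp add: L2_set_def sum_nonneg)
    qed
  qed
  obtain s where s: "strict_mono (s :: nat \<Rightarrow> nat)" "\<And>\<gamma>. convergent (\<lambda>n. f (s n) (\<phi> \<gamma>))"
    using coordinatewise_convergent_subsequence[of "\<lambda>n \<gamma>. f n (\<phi> \<gamma>)", OF ev] by blast
  have null_s: "(\<lambda>n. f (s n) (u k)) \<longlonglongrightarrow> 0" for k
    using LIMSEQ_subseq_LIMSEQ[OF null s(1)] by (simp add: o_def)
  obtain L where L: "\<And>x. (\<lambda>n. f (s n) x) \<longlonglongrightarrow> blinfun_apply L x" "norm L \<le> K"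
  proof (rule pointwise_limit_functional[OF dense, of "\<lambda>n. f (s n)" K])
    show "norm (f (s n)) \<le> K" for n by (rule K)
    show "convergent (\<lambda>n. f (s n) y)" if "y \<in> range u \<union> range \<phi>" for y
      using that s(2) null_s by (auto simp: convergent_def)
  qed blast
  have "L (u k) = 0" for k
    using LIMSEQ_unique[OF L(1) null_s] .
  then show ?thesis using that[OF s(1) L] by blast
qed

lemma coefficient_operator:
  obtains R :: "'x \<Rightarrow>\<^sub>L 'g l2" where "\<And>x \<gamma>. l2_nth (R x) \<gamma> = e \<gamma> x" "\<And>x. norm (R x) \<le> norm x"
proof (rule l2_operator[of "\<lambda>\<gamma>. e \<gamma>" 1])
  show "linear (e \<gamma>)" for \<gamma> by (simp add: blinfun.bounded_linear_right bounded_linear.linear)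
qed (use sum_e_le that in auto)

lemma dense_approximation:
  assumes "0 < \<epsilon>"
  obtains A a F b where "finite A" "finite F"
    "norm (x - ((\<Sum>k\<in>A. a k *\<^sub>R u k) + (\<Sum>\<gamma>\<in>F. b \<gamma> *\<^sub>R \<phi> \<gamma>))) < \<epsilon>"
proof -
  obtain y where y: "y \<in> span (range u \<union> range \<phi>)" "dist y x < \<epsilon>"
    using dense closure_approachable[of x "span (range u \<union> range \<phi>)"] assms by auto
  then obtain v w where vw: "v \<in> span (range u)" "w \<in> span (range \<phi>)" "y = v + w"
    unfolding span_Un by blast
  obtain A a where A: "finite A" "v = (\<Sum>k\<in>A. a k *\<^sub>R u k)" using span_rangeE[OF vw(1)] .
  obtain F b where F: "finite F" "w = (\<Sum>\<gamma>\<in>F. b \<gamma> *\<^sub>R \<phi> \<gamma>)" using span_rangeE[OF vw(2)] .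
  show ?thesis
    by (rule that[OF A(1) F(1), of a b]) (use y(2) vw A F in \<open>simp add: dist_norm norm_minus_commute\<close>)
qed

text \<open>The distance of \<open>x\<close> to c0 is at most \<open>norm (R x)\<close>: in a finite
  approximation of \<open>x\<close> the \<phi> \<gamma> can be replaced, modulo finitely supported
  vectors, by disjoint cuts, whose combination is bounded by the Euclidean norm of its
  coefficients.\<close>

lemma approximation_by_c0:
  fixes R :: "'x \<Rightarrow>\<^sub>L 'g l2"
  assumes R: "\<And>x \<gamma>. l2_nth (R x) \<gamma> = e \<gamma> x" "\<And>x. norm (R x) \<le> norm x" and "0 < \<epsilon>"
  obtains A a where "finite A" "norm (x - (\<Sum>k\<in>A. a k *\<^sub>R u k)) < norm (R x) + \<epsilon>"
proof -
  obtain A a F b where x: "finite A" "finite F"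
    "norm (x - ((\<Sum>k\<in>A. a k *\<^sub>R u k) + (\<Sum>\<gamma>\<in>F. b \<gamma> *\<^sub>R \<phi> \<gamma>))) < \<epsilon> / 2"
    using dense_approximation[of "\<epsilon> / 2"] \<open>0 < \<epsilon>\<close> by (metis half_gt_zero)
  let ?x = "(\<Sum>k\<in>A. a k *\<^sub>R u k) + (\<Sum>\<gamma>\<in>F. b \<gamma> *\<^sub>R \<phi> \<gamma>)"
  obtain K where K: "\<And>\<gamma> \<gamma>' k. \<gamma> \<in> F \<Longrightarrow> \<gamma>' \<in> F \<Longrightarrow> k \<in> N \<gamma> \<Longrightarrow> k \<in> N \<gamma>' \<Longrightarrow> K \<le> k \<Longrightarrow> \<gamma> = \<gamma>'"
    using disjoint_cuts[OF x(2)] by blast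
  let ?w = "\<Sum>\<gamma>\<in>F. b \<gamma> *\<^sub>R cut \<gamma> K"
  have "u k \<in> span (range u)" for k by (simp add: span_base)
  then have "?x - ?w \<in> span (range u)"
    by (simp add: cut_def scaleR_right_diff_distrib sum_subtractf span_add span_sum span_scale)
  then obtain B c where B: "finite B" "?x - ?w = (\<Sum>k\<in>B. c k *\<^sub>R u k)"
    using span_rangeE by blast
  have "e \<gamma> ?x = (if \<gamma> \<in> F then b \<gamma> else 0)" for \<gamma>
    using x(2) by (simp add: blinfun.add_right e_sum_u blinfun.sum_right[of _ _ F] blinfun.scaleR_right e_\<phi>
        if_distrib sum.delta cong: if_cong)
  then have "(\<Sum>\<gamma>\<in>F. (b \<gamma>)\<^sup>2) = (\<Sum>\<gamma>\<in>F. (l2_nth (R ?x) \<gamma>)\<^sup>2)"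
    by (intro sum.cong) (simp_all add: R(1))
  also have "\<dots> \<le> (norm (R ?x))\<^sup>2"
    by (rule sum_squares_le_norm_l2[OF x(2)])
  finally have "L2_set b F \<le> norm (R ?x)"
    unfolding L2_set_def by (simp add: real_le_lsqrt sum_nonneg)
  then have "norm ?w \<le> norm (R ?x)"
    using norm_sum_cut_le[OF x(2), of "\<lambda>_. K" b] K by (meson order_trans)
  also have "\<dots> \<le> norm (R x) + norm (R (x - ?x))"
    using norm_triangle_ineq4[of "R x" "R (x - ?x)"] by (simp add: blinfun.diff_right)
  also have "\<dots> < norm (R x) + \<epsilon> / 2" using R(2)[of "x - ?x"] x(3) by simp
  finally have "norm ?w < norm (R x) + \<epsilon> / 2" .
  moreover have "norm (x - (\<Sum>k\<in>B. c k *\<^sub>R u k)) \<le> norm (x - ?x) + norm ?w"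
    using norm_triangle_ineq[of "x - ?x" ?w] unfolding B(2)[symmetric] by (simp add: algebra_simps)
  ultimately have "norm (x - (\<Sum>k\<in>B. c k *\<^sub>R u k)) < norm (R x) + \<epsilon>"
    using x(3) by linarith
  then show ?thesis using that B(1) by blast
qed

section \<open>JL is subprojective\<close>

lemma subprojective_JL:
  fixes M :: "'x set"
  assumes M: "subspace M" "closed M" "infinite_dimensional M"
  shows "\<exists>N' \<subseteq> M. subspace N' \<and> infinite_dimensional N' \<and> complemented N'"
proof -
  obtain R :: "'x \<Rightarrow>\<^sub>L 'g l2" where R: "\<And>x \<gamma>. l2_nth (R x) \<gamma> = e \<gamma> x" "\<And>x. norm (R x) \<le> norm x"
    using coefficient_operator by blast
  define M' where "M' m = {x \<in> M. \<forall>k\<in>{..<m}. \<delta> k x = 0}" for m :: nat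
  have lin: "linear (\<delta> k)" for k by (simp add: blinfun.bounded_linear_right bounded_linear.linear)
  have M'_sub: "subspace (M' m)" for m
    unfolding M'_def by (intro subspace_inter_kernels M lin)
  show ?thesis
  \<comment> \<open>\<open>M' m\<close> has finite codimension in \<open>M\<close>, so a Hilbertian
    \<open>M' m\<close> settles the claim. Otherwise every \<open>M' m\<close> contains unit vectors
    with arbitrarily small image under \<open>R\<close>, and these supply blocks located beyond
    \<open>m\<close>.\<close>
  proof (cases "\<exists>m c. 0 < c \<and> (\<forall>x\<in>M' m. c * norm x \<le> norm (R x))")
    case True
    then obtain m c where c: "0 < c" "\<And>x. x \<in> M' m \<Longrightarrow> c * norm x \<le> norm (R x)" by blast
    have "closed (M' m)"
    proof -
      have "M' m = M \<inter> (\<Inter>k\<in>{..<m}. {x. \<delta> k x = 0})" by (auto simp: M'_def)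
      moreover have "closed {x. \<delta> k x = 0}" for k
        by (intro closed_Collect_eq continuous_intros)
      ultimately show ?thesis using M(2) by (simp add: closed_INT closed_Int)
    qed
    moreover have "infinite_dimensional (M' m)"
      unfolding M'_def by (intro infinite_dimensional_inter_kernels M lin) simp
    ultimately obtain N' where "N' \<subseteq> M' m" "subspace N'" "infinite_dimensional N'" "complemented N'"
      using complemented_subspace_of_hilbertian[OF M'_sub _ _ c] by blast
    moreover have "M' m \<subseteq> M" by (auto simp: M'_def)
    ultimately show ?thesis by blast
  next
    case False
    \<comment> \<open>The block of stage \<open>n\<close> lives on \<open>{m..<m'}\<close> and is
      normalized at its peak \<open>j\<close>, so that evaluation at \<open>j\<close> takes the
      value 1 on it.\<close>
    let ?Q = "\<lambda>n m (x, a, j) m'. j \<in> {m..<m'} \<and> a j = 1 \<and> (\<forall>k\<in>{m..<m'}. \<bar>a k\<bar> \<le> 1) \<and> x \<in> M \<and>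
      norm (x - (\<Sum>k\<in>{m..<m'}. a k *\<^sub>R u k)) \<le> (1 / 2) ^ n / 16"
    have step: "\<exists>y m'. ?Q n m y m'" for n :: nat and m :: nat
    proof -
      \<comment> \<open>Deviation from c0 and approximation cost \<open>2 * \<epsilon>\<close>,
        discarding the coordinates below \<open>m\<close> another \<open>2 * \<epsilon>\<close>, and
        division by a peak of size at least 1/2 doubles the total to
        \<open>8 * \<epsilon> = (1 / 2) ^ n / 16\<close>.\<close>
      define \<epsilon> where "\<epsilon> = (1 / 2 :: real) ^ n / 128"
      have eps: "0 < \<epsilon>" "\<epsilon> \<le> 1 / 128" by (simp_all add: \<epsilon>_def power_le_one)
      obtain x0 where x0: "x0 \<in> M' m" "norm (R x0) < \<epsilon> * norm x0"
        using False eps(1) by (auto simp: not_le)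
      then have "x0 \<noteq> 0" by auto
      define x where "x = (1 / norm x0) *\<^sub>R x0"
      have x: "x \<in> M' m" "norm x = 1" "norm (R x) < \<epsilon>"
        using x0 \<open>x0 \<noteq> 0\<close> M'_sub[of m]
        by (simp_all add: x_def subspace_scale blinfun.scaleR_right pos_divide_less_eq)
      obtain A a where A: "finite A" "norm (x - (\<Sum>k\<in>A. a k *\<^sub>R u k)) < norm (R x) + \<epsilon>"
        using approximation_by_c0[OF R eps(1)] by blast
      let ?v = "\<Sum>k\<in>A. a k *\<^sub>R u k"
      have v: "norm (x - ?v) < 2 * \<epsilon>" using A(2) x(3) by simp
      define b where "b k = (if k \<in> A then a k else 0)" for k
      obtain m' where m': "m < m'" "A \<subseteq> {..<m'}"
        using A(1) finite_nat_set_iff_bounded[of "insert m A"] by auto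
      let ?w = "\<Sum>k\<in>{m..<m'}. b k *\<^sub>R u k"
      have v_eq: "?v = (\<Sum>k\<in>{..<m'}. b k *\<^sub>R u k)"
        unfolding b_def using m'(2) by (intro sum.mono_neutral_cong_left) auto
      also have "\<dots> = (\<Sum>k\<in>{..<m}. b k *\<^sub>R u k) + ?w"
        using m'(1) by (simp add: lessThan_atLeast0 sum.atLeastLessThan_concat)
      finally have vw: "?v - ?w = (\<Sum>k\<in>{..<m}. b k *\<^sub>R u k)" by simp
      have \<delta>v: "\<delta> k ?v = b k" for k using A(1) by (simp add: \<delta>_sum_u b_def)
      \<comment> \<open>Below \<open>m\<close> the coordinates of \<open>x\<close> vanish, so those
        of the approximant are no larger than the approximation error.\<close>
      have "norm (?v - ?w) \<le> 2 * \<epsilon>"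
        unfolding vw
      proof (rule norm_sum_u_le)
        fix k assume "k \<in> {..<m}"
        then have "\<delta> k x = 0" using x(1) by (auto simp: M'_def)
        then have "\<bar>b k\<bar> = \<bar>\<delta> k (x - ?v)\<bar>" by (simp add: blinfun.diff_right \<delta>v)
        also have "\<dots> \<le> 2 * \<epsilon>" using abs_\<delta>_le[of k "x - ?v"] v by simp
        finally show "\<bar>b k\<bar> \<le> 2 * \<epsilon>" .
      qed (use eps in auto)
      then have w: "norm (x - ?w) \<le> 4 * \<epsilon>"
        using norm_triangle_ineq[of "x - ?v" "?v - ?w"] v by simp
      then have w1: "1 / 2 \<le> norm ?w"
        using norm_triangle_ineq2[of x "x - ?w"] x(2) eps(2) by simp
      define t where "t = Max ((\<lambda>k. \<bar>b k\<bar>) ` {m..<m'})"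
      have fin: "finite ((\<lambda>k. \<bar>b k\<bar>) ` {m..<m'})" "(\<lambda>k. \<bar>b k\<bar>) ` {m..<m'} \<noteq> {}" using m'(1) by auto
      have bt: "\<bar>b k\<bar> \<le> t" if "k \<in> {m..<m'}" for k
        unfolding t_def using fin that by (intro Max_ge) auto
      obtain j where j: "j \<in> {m..<m'}" "\<bar>b j\<bar> = t"
        using Max_in[OF fin] unfolding t_def by (metis imageE)
      have "norm ?w \<le> t" using bt j by (intro norm_sum_u_le) auto
      then have t: "1 / 2 \<le> \<bar>b j\<bar>" using w1 j(2) by simp
      then have bj: "b j \<noteq> 0" by auto
      have "?Q n m ((1 / b j) *\<^sub>R x, \<lambda>k. b k / b j, j) m'"
      proof (simp only: prod.case, intro conjI ballI)
        show "j \<in> {m..<m'}" "b j / b j = 1" using j bj by simp_all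
        show "\<bar>b k / b j\<bar> \<le> 1" if "k \<in> {m..<m'}" for k
          using bt[OF that] t unfolding j(2)[symmetric] by (simp add: divide_le_eq_1)
        show "(1 / b j) *\<^sub>R x \<in> M" using x(1) M(1) by (simp add: M'_def subspace_scale)
        have "(1 / b j) *\<^sub>R x - (\<Sum>k\<in>{m..<m'}. (b k / b j) *\<^sub>R u k) = (1 / b j) *\<^sub>R (x - ?w)"
          by (simp add: scaleR_right_diff_distrib scaleR_sum_right)
        then have "norm ((1 / b j) *\<^sub>R x - (\<Sum>k\<in>{m..<m'}. (b k / b j) *\<^sub>R u k)) = norm (x - ?w) / \<bar>b j\<bar>"
          by (simp add: divide_inverse mult.commute)
        also have "\<dots> \<le> (4 * \<epsilon>) / (1 / 2)"
          using w t eps by (intro frac_le) auto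
        also have "\<dots> = (1 / 2) ^ n / 16" by (simp add: \<epsilon>_def)
        finally show "norm ((1 / b j) *\<^sub>R x - (\<Sum>k\<in>{m..<m'}. (b k / b j) *\<^sub>R u k)) \<le> (1 / 2) ^ n / 16" .
      qed
      then show ?thesis
        by (intro exI[of _ "((1 / b j) *\<^sub>R x, \<lambda>k. b k / b j, j)"] exI[of _ m'])
    qed
    obtain y m where "m 0 = 0" "\<And>n. ?Q n (m n) (y n) (m (Suc n))"
      by (rule dependent_choice_sequence[where Q = ?Q and ?s0.0 = 0, OF step]) (rule that)
    then obtain x a j where j: "\<And>n. j n \<in> {m n..<m (Suc n)}" "\<And>n. a n (j n) = 1"
      and a: "\<And>n k. k \<in> {m n..<m (Suc n)} \<Longrightarrow> \<bar>a n k\<bar> \<le> 1"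
      and x: "\<And>n. x n \<in> M" "\<And>n. norm (x n - (\<Sum>k\<in>{m n..<m (Suc n)}. a n k *\<^sub>R u k)) \<le> (1 / 2) ^ n / 16"
      using that[of "\<lambda>n. snd (snd (y n))" "\<lambda>n. fst (snd (y n))" "\<lambda>n. fst (y n)"]
      by (auto simp: case_prod_unfold)
    have m_mono: "strict_mono m"
      using j(1) by (intro strict_mono_Suc_iff[THEN iffD2]) (metis atLeastLessThan_iff le_less_trans)
    note disj = disjoint_consecutive_intervals[OF m_mono]
    let ?w = "\<lambda>n. \<Sum>k\<in>{m n..<m (Suc n)}. a n k *\<^sub>R u k"
    have "(\<lambda>n. \<delta> (j n) (u k)) \<longlonglongrightarrow> 0" for k
    proof (rule tendsto_eventually)
      have "j n > k" if "n \<ge> Suc k" for n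
        using j(1)[of n] seq_suble[OF m_mono, of n] that by auto
      then show "\<forall>\<^sub>F n in sequentially. \<delta> (j n) (u k) = 0"
        unfolding eventually_sequentially by (intro exI[of _ "Suc k"]) (auto simp: \<delta>_u)
    qed
    then obtain s L where s: "strict_mono s" "\<And>x. (\<lambda>n. \<delta> (j (s n)) x) \<longlonglongrightarrow> blinfun_apply L x"
      "norm L \<le> 1" "\<And>k. L (u k) = 0"
      using weak_star_convergent_subsequence[of "\<lambda>n. \<delta> (j n)" 1] norm_\<delta>_le by blast
    have s_inj: "s n = s i \<longleftrightarrow> n = i" for n i using s(1) by (simp add: strict_mono_eq)
    define g where "g n = \<delta> (j (s n)) - L" for n
    have g: "g n x = \<delta> (j (s n)) x - L x" for n x by (simp add: g_def blinfun.diff_left)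
    have g_norm: "norm (g n) \<le> 2" for n
      unfolding g_def using norm_triangle_ineq4[of "\<delta> (j (s n))" L] norm_\<delta>_le[of "j (s n)"] s(3) by simp
    have sys: "projection_system (\<lambda>n. ?w (s n)) g"
    proof (rule projection_system_c0)
      show "g n (?w (s i)) = (if n = i then 1 else 0)" for n i
      proof -
        have "j (s n) \<in> {m (s i)..<m (Suc (s i))} \<longleftrightarrow> n = i"
          using j(1)[of "s n"] disj[of "s n" "s i"] s_inj[of n i] by blast
        then show ?thesis
          unfolding g \<delta>_sum_u[OF finite_atLeastLessThan]
          by (auto simp: blinfun.sum_right blinfun.scaleR_right s(4) j(2))
      qed
      show "norm (\<Sum>n\<in>F. c n *\<^sub>R ?w (s n)) \<le> 1 * B" if "finite F" "0 \<le> B" "\<And>n. n \<in> F \<Longrightarrow> \<bar>c n\<bar> \<le> B" for F c B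
        unfolding mult_1
      proof (rule norm_blocks_le)
        show "{m (s n)..<m (Suc (s n))} \<inter> {m (s i)..<m (Suc (s i))} = {}" if "n \<noteq> i" for n i
          using that s_inj by (intro disj) simp
      qed (use that a in auto)
      show "norm (g n) \<le> 2" for n by (rule g_norm)
      show "(\<lambda>n. g n x) \<longlonglongrightarrow> 0" for x
        unfolding g using tendsto_diff[OF s(2)[of x] tendsto_const[of "L x"]] by simp
    qed
    \<comment> \<open>The functionals \<open>g n\<close> have norm at most 2, and passing to the
      subsequence only helps because \<open>n \<le> s n\<close>; the total is at most 1/4.\<close>
    have small: "norm (g n) * norm (x (s n) - ?w (s n)) \<le> 1 / 8 * (1 / 2) ^ n" for n
    proof -
      have "norm (g n) * norm (x (s n) - ?w (s n)) \<le> 2 * ((1 / 2) ^ s n / 16)"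
        by (intro mult_mono g_norm x(2)) auto
      also have "\<dots> \<le> 2 * ((1 / 2) ^ n / 16)"
        using power_decreasing[OF seq_suble[OF s(1), of n], of "1 / 2 :: real"] by simp
      finally show ?thesis by simp
    qed
    show ?thesis
      by (rule complemented_subspace_perturbation[OF sys, of "\<lambda>n. x (s n)"])
        (use geometric_small_sum[OF _ small] x(1) M in auto)
  qed
qed

end

text \<open>The canonical embedding into the bidual; it provides the functionals on the dual that
  are biorthogonal to blocks of evaluations.\<close>

lemma evaluation_functional:
  obtains ev :: "'a::real_normed_vector \<Rightarrow> ('a \<Rightarrow>\<^sub>L real) \<Rightarrow>\<^sub>L real"
  where "\<And>x f. ev x f = f x" "\<And>x. norm (ev x) \<le> norm x"
proof -
  have ap: "blinfun_apply (Blinfun (\<lambda>f :: 'a \<Rightarrow>\<^sub>L real. f x)) = (\<lambda>f. f x)" for x :: 'a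
    by (rule bounded_linear_Blinfun_apply[OF blinfun.bounded_linear_left])
  have "norm (Blinfun (\<lambda>f :: 'a \<Rightarrow>\<^sub>L real. f x)) \<le> norm x" for x :: 'a
  proof (rule norm_blinfun_bound)
    show "norm (Blinfun (\<lambda>f :: 'a \<Rightarrow>\<^sub>L real. f x) f) \<le> norm x * norm f" for f
      using norm_blinfun[of f x] by (simp add: ap mult.commute)
  qed simp
  then show ?thesis using that[of "\<lambda>x. Blinfun (\<lambda>f :: 'a \<Rightarrow>\<^sub>L real. f x)"] ap by simp
qed

context JL_model
begin

section \<open>The dual of JL\<close>

text \<open>\<open>l1_part\<close> is the projection of the dual onto the copy of \<open>\<ell>\<^sub>1\<close> spanned by the evaluations; its kernel,
  the annihilator of \<open>c0\<close>, is a Hilbert space with coordinates \<open>f (\<phi> \<gamma>)\<close>.\<close>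

definition l1_part :: "('x \<Rightarrow>\<^sub>L real) \<Rightarrow> ('x \<Rightarrow>\<^sub>L real)" where
  "l1_part f = (\<Sum>k. f (u k) *\<^sub>R \<delta> k)"

lemma summable_abs_u:
  fixes f :: "'x \<Rightarrow>\<^sub>L real"
  shows "summable (\<lambda>k. \<bar>f (u k)\<bar>)"
  by (rule summableI_nonneg_bounded[where x = "norm f"]) (simp_all add: sum_abs_u_le)

lemma suminf_abs_u_le:
  fixes f :: "'x \<Rightarrow>\<^sub>L real"
  shows "(\<Sum>k. \<bar>f (u k)\<bar>) \<le> norm f"
  by (rule suminf_le_const[OF summable_abs_u]) (simp add: sum_abs_u_le)

lemma norm_scaleR_\<delta>_le: "norm (c *\<^sub>R \<delta> k) \<le> \<bar>c\<bar>"
  using mult_left_mono[OF norm_\<delta>_le[of k], of "\<bar>c\<bar>"] by simp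

lemma summable_l1_part:
  fixes f :: "'x \<Rightarrow>\<^sub>L real"
  shows "summable (\<lambda>k. norm (f (u k) *\<^sub>R \<delta> k))"
  by (rule summable_comparison_test[OF _ summable_abs_u[of f]]) (use norm_scaleR_\<delta>_le in auto)

lemma l1_part_sums:
  fixes f :: "'x \<Rightarrow>\<^sub>L real"
  shows "(\<lambda>k. f (u k) *\<^sub>R \<delta> k) sums l1_part f"
  unfolding l1_part_def by (rule summable_sums[OF summable_norm_cancel[OF summable_l1_part]])

text \<open>Consequently \<open>f - l1_part f\<close> vanishes on c0, which splits the dual into an
  l1 part and the annihilator of c0.\<close>

lemma l1_part_u: "l1_part f (u k) = f (u k)"
proof (rule sums_unique2)
  show "(\<lambda>j. (f (u j) *\<^sub>R \<delta> j) (u k)) sums l1_part f (u k)"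
    using bounded_linear.sums[OF blinfun.bounded_linear_left l1_part_sums] .
  have "(\<lambda>j. (f (u j) *\<^sub>R \<delta> j) (u k)) = (\<lambda>j. if j = k then f (u j) else 0)"
    by (auto simp: blinfun.scaleR_left \<delta>_u)
  then show "(\<lambda>j. (f (u j) *\<^sub>R \<delta> j) (u k)) sums f (u k)"
    using sums_single[of k "\<lambda>j. f (u j)"] by simp
qed

lemma norm_l1_part_le: "norm (l1_part f) \<le> norm f"
proof -
  have "norm (l1_part f) \<le> (\<Sum>k. norm (f (u k) *\<^sub>R \<delta> k))"
    unfolding l1_part_def by (rule summable_norm[OF summable_l1_part])
  also have "\<dots> \<le> (\<Sum>k. \<bar>f (u k)\<bar>)"
    by (rule suminf_le[OF norm_scaleR_\<delta>_le summable_l1_part summable_abs_u])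
  finally show ?thesis using suminf_abs_u_le[of f] by simp
qed

lemma linear_l1_part: "linear l1_part"
proof (rule linearI)
  show "l1_part (f + g) = l1_part f + l1_part g" for f g
    using sums_add[OF l1_part_sums[of f] l1_part_sums[of g]] sums_unique2[OF l1_part_sums[of "f + g"]]
    by (simp add: blinfun.add_left scaleR_left_distrib)
  show "l1_part (r *\<^sub>R f) = r *\<^sub>R l1_part f" for r f
    using sums_scaleR_right[OF l1_part_sums[of f], of r] sums_unique2[OF l1_part_sums[of "r *\<^sub>R f"]]
    by (simp add: blinfun.scaleR_left)
qed

lemma l1_part_truncation:
  assumes "0 < \<epsilon>"
  obtains m' where "m < m'" "norm (l1_part f - (\<Sum>k<m'. f (u k) *\<^sub>R \<delta> k)) < \<epsilon>"
proof -
  obtain n0 where n0: "\<And>n. n \<ge> n0 \<Longrightarrow> norm ((\<Sum>k<n. f (u k) *\<^sub>R \<delta> k) - l1_part f) < \<epsilon>"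
    using LIMSEQ_D[OF l1_part_sums[of f, unfolded sums_def] assms] by blast
  show ?thesis
    by (rule that[of "max n0 (Suc m)"]) (use n0 in \<open>auto simp: norm_minus_commute less_max_iff_disj\<close>)
qed

text \<open>Disjoint blocks with entries at most 1 combine to norm at most 1 under any choice of
  signs. Read in the dual, this is the l1 bound on evaluations at such blocks.\<close>

lemma sum_abs_blocks_le:
  fixes f :: "'x \<Rightarrow>\<^sub>L real"
  assumes F: "finite F" and A: "\<And>n. n \<in> F \<Longrightarrow> finite (A n)"
    "\<And>n m. n \<in> F \<Longrightarrow> m \<in> F \<Longrightarrow> n \<noteq> m \<Longrightarrow> A n \<inter> A m = {}"
    and a: "\<And>n k. n \<in> F \<Longrightarrow> k \<in> A n \<Longrightarrow> \<bar>a n k\<bar> \<le> 1"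
  shows "(\<Sum>n\<in>F. \<bar>f (\<Sum>k\<in>A n. a n k *\<^sub>R u k)\<bar>) \<le> norm f"
proof -
  let ?v = "\<lambda>n. \<Sum>k\<in>A n. a n k *\<^sub>R u k"
  let ?x = "\<Sum>n\<in>F. sgn (f (?v n)) *\<^sub>R ?v n"
  have "f ?x = (\<Sum>n\<in>F. \<bar>f (?v n)\<bar>)"
    by (simp add: blinfun.sum_right[of f _ F] blinfun.scaleR_right abs_sgn mult.commute)
  moreover have "norm ?x \<le> 1"
    by (rule norm_blocks_le[OF F A a]) (auto simp: sgn_if)
  moreover have "f ?x \<le> norm f * norm ?x"
    using norm_blinfun[of f ?x] by simp
  ultimately show ?thesis
    using mult_left_mono[of "norm ?x" 1 "norm f"] by simp
qed

text \<open>A functional that vanishes on c0 cannot distinguish \<open>\<phi> \<gamma>\<close> from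
  a cut, so the inequality for disjoint cuts holds for the overlapping \<phi> \<gamma>
  themselves.\<close>

lemma c0_annihilator_sum_le:
  fixes g :: "'x \<Rightarrow>\<^sub>L real"
  assumes g: "\<And>k. g (u k) = 0" and F: "finite F"
  shows "(\<Sum>\<gamma>\<in>F. (g (\<phi> \<gamma>))\<^sup>2) \<le> (norm g)\<^sup>2"
proof -
  obtain m where m: "\<And>\<gamma> \<gamma>' k. \<gamma> \<in> F \<Longrightarrow> \<gamma>' \<in> F \<Longrightarrow> k \<in> N \<gamma> \<Longrightarrow> k \<in> N \<gamma>' \<Longrightarrow> m \<le> k \<Longrightarrow> \<gamma> = \<gamma>'"
    using disjoint_cuts[OF F] by blast
  have "L2_set (\<lambda>\<gamma>. g (cut \<gamma> m)) F \<le> norm g"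
    by (rule functional_cut_l2[OF F]) (rule m)
  then have "L2_set (\<lambda>\<gamma>. g (\<phi> \<gamma>)) F \<le> norm g"
    by (simp add: cut_def blinfun.diff_right blinfun.sum_right g)
  then have "(L2_set (\<lambda>\<gamma>. g (\<phi> \<gamma>)) F)\<^sup>2 \<le> (norm g)\<^sup>2" by (intro power_mono) auto
  then show ?thesis by (simp add: L2_set_def sum_nonneg)
qed

text \<open>On the dense span \<open>g y\<close> is the sum of the products
  \<open>e \<gamma> y * g (\<phi> \<gamma>)\<close>, and Cauchy-Schwarz applies. With the opposite
  inequality above, the annihilator of c0 embeds isometrically into l2 through the values at the
  \<phi> \<gamma>.\<close>

lemma c0_annihilator_norm_le:
  fixes g :: "'x \<Rightarrow>\<^sub>L real"
  assumes g: "\<And>k. g (u k) = 0" and C: "0 \<le> C" "\<And>F. finite F \<Longrightarrow> (\<Sum>\<gamma>\<in>F. (g (\<phi> \<gamma>))\<^sup>2) \<le> C\<^sup>2"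
  shows "norm g \<le> C"
proof (rule norm_blinfun_bound)
  have "closure (span (range u \<union> range \<phi>)) \<subseteq> {x. norm (g x) \<le> C * norm x}"
  proof (rule closure_minimal)
    show "span (range u \<union> range \<phi>) \<subseteq> {x. norm (g x) \<le> C * norm x}"
    proof
      fix y assume "y \<in> span (range u \<union> range \<phi>)"
      then obtain v w where vw: "v \<in> span (range u)" "w \<in> span (range \<phi>)" "y = v + w"
        unfolding span_Un by blast
      obtain A a where A: "finite A" "v = (\<Sum>k\<in>A. a k *\<^sub>R u k)" using span_rangeE[OF vw(1)] .
      obtain F b where F: "finite F" "w = (\<Sum>\<gamma>\<in>F. b \<gamma> *\<^sub>R \<phi> \<gamma>)" using span_rangeE[OF vw(2)] .
      have ey: "e \<gamma> y = (if \<gamma> \<in> F then b \<gamma> else 0)" for \<gamma>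
        using F(1) by (simp add: vw A F(2) blinfun.add_right e_sum_u blinfun.sum_right[of _ _ F]
            blinfun.scaleR_right e_\<phi> if_distrib sum.delta cong: if_cong)
      have "g y = (\<Sum>\<gamma>\<in>F. b \<gamma> * g (\<phi> \<gamma>))"
        by (simp add: vw A F(2) blinfun.add_right blinfun.sum_right blinfun.scaleR_right g)
      also have "\<dots> = (\<Sum>\<gamma>\<in>F. e \<gamma> y * g (\<phi> \<gamma>))"
        by (intro sum.cong) (auto simp: ey)
      finally have "(norm (g y))\<^sup>2 \<le> (\<Sum>\<gamma>\<in>F. (e \<gamma> y)\<^sup>2) * (\<Sum>\<gamma>\<in>F. (g (\<phi> \<gamma>))\<^sup>2)"
        using Cauchy_Schwarz_ineq_sum[of "\<lambda>\<gamma>. e \<gamma> y" "\<lambda>\<gamma>. g (\<phi> \<gamma>)" F] by simp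
      also have "\<dots> \<le> (norm y)\<^sup>2 * C\<^sup>2"
        by (intro mult_mono sum_e_le C(2) F) (auto simp: sum_nonneg)
      finally have "(norm (g y))\<^sup>2 \<le> (C * norm y)\<^sup>2" by (simp add: power_mult_distrib mult.commute)
      then have "norm (g y) \<le> C * norm y"
        by (rule power2_le_imp_le) (simp add: C)
      then show "y \<in> {x. norm (g x) \<le> C * norm x}" by simp
    qed
    show "closed {x. norm (g x) \<le> C * norm x}"
      by (intro closed_Collect_le continuous_intros)
  qed
  then show "norm (g x) \<le> C * norm x" for x using dense by auto
qed (rule C)

text \<open>\<open>R\<close> forgets the l1 part, and by the last inequality \<open>f\<close> is
  close to its l1 part whenever \<open>R f\<close> is small.\<close>

lemma dual_coefficient_operator:
  obtains R :: "('x \<Rightarrow>\<^sub>L real) \<Rightarrow>\<^sub>L 'g l2" where "\<And>f \<gamma>. l2_nth (R f) \<gamma> = (f - l1_part f) (\<phi> \<gamma>)"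
    "\<And>f. norm (R f) \<le> 2 * norm f" "\<And>f. norm (f - l1_part f) \<le> norm (R f)"
proof -
  have van: "(f - l1_part f) (u k) = 0" for f k by (simp add: blinfun.diff_left l1_part_u)
  obtain R :: "('x \<Rightarrow>\<^sub>L real) \<Rightarrow>\<^sub>L 'g l2" where R: "\<And>f \<gamma>. l2_nth (R f) \<gamma> = (f - l1_part f) (\<phi> \<gamma>)"
    "\<And>f. norm (R f) \<le> 2 * norm f"
  proof (rule l2_operator[of "\<lambda>\<gamma> f. (f - l1_part f) (\<phi> \<gamma>)" 2])
    show "linear (\<lambda>f. (f - l1_part f) (\<phi> \<gamma>))" for \<gamma>
      by (rule linearI)
        (simp_all add: blinfun.diff_left blinfun.add_left blinfun.scaleR_left
          linear_add[OF linear_l1_part] linear_scale[OF linear_l1_part] algebra_simps)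
    fix F :: "'g set" and f :: "'x \<Rightarrow>\<^sub>L real" assume "finite F"
    then have "(\<Sum>\<gamma>\<in>F. ((f - l1_part f) (\<phi> \<gamma>))\<^sup>2) \<le> (norm (f - l1_part f))\<^sup>2"
      by (rule c0_annihilator_sum_le[OF van])
    also have "\<dots> \<le> (2 * norm f)\<^sup>2"
      using norm_triangle_ineq4[of f "l1_part f"] norm_l1_part_le[of f] by (intro power_mono) auto
    finally show "(\<Sum>\<gamma>\<in>F. ((f - l1_part f) (\<phi> \<gamma>))\<^sup>2) \<le> (2 * norm f)\<^sup>2" .
  qed (use that in auto)
  have "norm (f - l1_part f) \<le> norm (R f)" for f
    by (rule c0_annihilator_norm_le[OF van norm_ge_zero])
      (use sum_squares_le_norm_l2[of _ "R f"] in \<open>simp add: R(1)\<close>)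
  then show ?thesis by (rule that[OF R])
qed

lemma subprojective_dual:
  fixes M :: "('x \<Rightarrow>\<^sub>L real) set"
  assumes M: "subspace M" "closed M" "infinite_dimensional M"
  shows "\<exists>N' \<subseteq> M. subspace N' \<and> infinite_dimensional N' \<and> complemented N'"
proof -
  obtain R :: "('x \<Rightarrow>\<^sub>L real) \<Rightarrow>\<^sub>L 'g l2" where R: "\<And>f. norm (f - l1_part f) \<le> norm (R f)"
    by (rule dual_coefficient_operator) (rule that)
  define M' where "M' m = {f \<in> M. \<forall>k\<in>{..<m}. f (u k) = 0}" for m :: nat
  have lin: "linear (\<lambda>f :: 'x \<Rightarrow>\<^sub>L real. f (u k))" for k
    by (simp add: blinfun.bounded_linear_left bounded_linear.linear)
  have M'_sub: "subspace (M' m)" for m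
    unfolding M'_def by (intro subspace_inter_kernels M lin)
  show ?thesis
  proof (cases "\<exists>m c. 0 < c \<and> (\<forall>f\<in>M' m. c * norm f \<le> norm (R f))")
    case True
    then obtain m c where c: "0 < c" "\<And>f. f \<in> M' m \<Longrightarrow> c * norm f \<le> norm (R f)" by blast
    have "closed (M' m)"
    proof -
      have "M' m = M \<inter> (\<Inter>k\<in>{..<m}. {f :: 'x \<Rightarrow>\<^sub>L real. f (u k) = 0})" by (auto simp: M'_def)
      moreover have "closed {f :: 'x \<Rightarrow>\<^sub>L real. f (u k) = 0}" for k
        by (intro closed_Collect_eq continuous_intros)
      ultimately show ?thesis using M(2) by (simp add: closed_INT closed_Int)
    qed
    moreover have "infinite_dimensional (M' m)"
      unfolding M'_def by (intro infinite_dimensional_inter_kernels M lin) simp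
    ultimately obtain N' where "N' \<subseteq> M' m" "subspace N'" "infinite_dimensional N'" "complemented N'"
      using complemented_subspace_of_hilbertian[OF M'_sub _ _ c] by blast
    moreover have "M' m \<subseteq> M" by (auto simp: M'_def)
    ultimately show ?thesis by blast
  next
    case False
    let ?Q = "\<lambda>n m (f, a) m'. m < m' \<and> (\<Sum>k\<in>{m..<m'}. \<bar>a k\<bar>) = 1 \<and> f \<in> M \<and>
      norm (f - (\<Sum>k\<in>{m..<m'}. a k *\<^sub>R \<delta> k)) \<le> (1 / 2) ^ n / 16"
    have step: "\<exists>y m'. ?Q n m y m'" for n :: nat and m :: nat
    proof -
      \<comment> \<open>Dropping \<open>f - l1_part f\<close> and truncating the l1 part cost
        \<open>\<epsilon>\<close> each; division by \<open>t\<close>, which is at least 1/2, doubles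
        this to \<open>4 * \<epsilon> = (1 / 2) ^ n / 16\<close>.\<close>
      define \<epsilon> where "\<epsilon> = (1 / 2 :: real) ^ n / 64"
      have eps: "0 < \<epsilon>" "\<epsilon> \<le> 1 / 64" by (simp_all add: \<epsilon>_def power_le_one)
      obtain f0 where f0: "f0 \<in> M' m" "norm (R f0) < \<epsilon> * norm f0"
        using False eps(1) by (auto simp: not_le)
      then have "f0 \<noteq> 0" by auto
      define f where "f = (1 / norm f0) *\<^sub>R f0"
      have f: "f \<in> M' m" "norm f = 1" "norm (R f) < \<epsilon>"
        using f0 \<open>f0 \<noteq> 0\<close> M'_sub[of m]
        by (simp_all add: f_def subspace_scale blinfun.scaleR_right pos_divide_less_eq)
      obtain m' where m': "m < m'" "norm (l1_part f - (\<Sum>k<m'. f (u k) *\<^sub>R \<delta> k)) < \<epsilon>"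
        using l1_part_truncation[OF eps(1)] by blast
      let ?h = "\<Sum>k\<in>{m..<m'}. f (u k) *\<^sub>R \<delta> k"
      have "(\<Sum>k<m'. f (u k) *\<^sub>R \<delta> k) = ?h"
        using f(1) by (intro sum.mono_neutral_right) (auto simp: M'_def)
      then have h: "norm (f - ?h) < 2 * \<epsilon>"
        using norm_triangle_ineq[of "f - l1_part f" "l1_part f - ?h"] m'(2) R[of f] f(3) by simp
      define t where "t = (\<Sum>k\<in>{m..<m'}. \<bar>f (u k)\<bar>)"
      have "norm ?h \<le> t"
        unfolding t_def by (intro sum_norm_le norm_scaleR_\<delta>_le)
      moreover have "1 / 2 \<le> norm ?h"
        using norm_triangle_ineq2[of f "f - ?h"] f(2) h eps(2) by simp
      ultimately have t: "1 / 2 \<le> t" by simp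
      have "?Q n m ((1 / t) *\<^sub>R f, \<lambda>k. f (u k) / t) m'"
      proof (simp only: prod.case, intro conjI)
        show "m < m'" by fact
        have "(\<Sum>k\<in>{m..<m'}. \<bar>f (u k) / t\<bar>) = t / t"
          unfolding t_def sum_divide_distrib using t by (intro sum.cong) (auto simp: t_def)
        then show "(\<Sum>k\<in>{m..<m'}. \<bar>f (u k) / t\<bar>) = 1" using t by simp
        show "(1 / t) *\<^sub>R f \<in> M" using f(1) M(1) by (simp add: M'_def subspace_scale)
        have eq: "(1 / t) *\<^sub>R f - (\<Sum>k\<in>{m..<m'}. (f (u k) / t) *\<^sub>R \<delta> k) = (1 / t) *\<^sub>R (f - ?h)"
          by (simp add: scaleR_right_diff_distrib scaleR_sum_right)
        have "norm ((1 / t) *\<^sub>R f - (\<Sum>k\<in>{m..<m'}. (f (u k) / t) *\<^sub>R \<delta> k)) = norm (f - ?h) / t"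
          unfolding eq norm_scaleR using t by simp
        also have "\<dots> \<le> (2 * \<epsilon>) / (1 / 2)"
          using h t eps by (intro frac_le) auto
        also have "\<dots> = (1 / 2) ^ n / 16" by (simp add: \<epsilon>_def)
        finally show "norm ((1 / t) *\<^sub>R f - (\<Sum>k\<in>{m..<m'}. (f (u k) / t) *\<^sub>R \<delta> k)) \<le> (1 / 2) ^ n / 16" .
      qed
      then show ?thesis
        by (intro exI[of _ "((1 / t) *\<^sub>R f, \<lambda>k. f (u k) / t)"] exI[of _ m'])
    qed
    obtain y m where "m 0 = 0" "\<And>n. ?Q n (m n) (y n) (m (Suc n))"
      by (rule dependent_choice_sequence[where Q = ?Q and ?s0.0 = 0, OF step]) (rule that)
    then obtain f a where m: "\<And>n. m n < m (Suc n)"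
      and a: "\<And>n. (\<Sum>k\<in>{m n..<m (Suc n)}. \<bar>a n k\<bar>) = 1"
      and f: "\<And>n. f n \<in> M" "\<And>n. norm (f n - (\<Sum>k\<in>{m n..<m (Suc n)}. a n k *\<^sub>R \<delta> k)) \<le> (1 / 2) ^ n / 16"
      using that[of "\<lambda>n. snd (y n)" "\<lambda>n. fst (y n)"] by (auto simp: case_prod_unfold)
    have m_mono: "strict_mono m" using m by (simp add: strict_mono_Suc_iff)
    note disj = disjoint_consecutive_intervals[OF m_mono]
    let ?h = "\<lambda>n. \<Sum>k\<in>{m n..<m (Suc n)}. a n k *\<^sub>R \<delta> k"
    \<comment> \<open>Evaluation at the sign vector \<open>?v n\<close> gives the l1 mass of the
      \<open>n\<close>-th block, normalized to 1, and 0 on all other blocks.\<close>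
    let ?v = "\<lambda>n. \<Sum>k\<in>{m n..<m (Suc n)}. sgn (a n k) *\<^sub>R u k"
    obtain ev :: "'x \<Rightarrow> ('x \<Rightarrow>\<^sub>L real) \<Rightarrow>\<^sub>L real" where ev: "\<And>x f. ev x f = f x" "\<And>x. norm (ev x) \<le> norm x"
      by (rule evaluation_functional) (rule that)
    define g where "g n = ev (?v n)" for n
    have g_norm: "norm (g n) \<le> 1" for n
    proof -
      have "norm (?v n) \<le> 1" by (intro norm_sum_u_le) (auto simp: sgn_if)
      then show ?thesis using ev(2)[of "?v n"] by (simp add: g_def)
    qed
    have sys: "projection_system ?h g"
    proof (rule projection_system_l1)
      show "g n (?h i) = (if n = i then 1 else 0)" for n i
      proof -
        have "g n (?h i) = (\<Sum>k\<in>{m i..<m (Suc i)}. a i k * (if k \<in> {m n..<m (Suc n)} then sgn (a n k) else 0))"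
          by (simp add: g_def ev blinfun.sum_left blinfun.scaleR_left \<delta>_sum_u)
        also have "\<dots> = (if n = i then 1 else 0)"
        proof (cases "n = i")
          case True
          then show ?thesis using a[of i] by (simp add: abs_sgn)
        next
          case False
          have "(\<Sum>k\<in>{m i..<m (Suc i)}. a i k * (if k \<in> {m n..<m (Suc n)} then sgn (a n k) else 0)) = 0"
            using disj[OF False] by (intro sum.neutral) auto
          then show ?thesis using False by simp
        qed
        finally show ?thesis .
      qed
      show "norm (?h n) \<le> 1" for n
      proof -
        have "norm (?h n) \<le> (\<Sum>k\<in>{m n..<m (Suc n)}. \<bar>a n k\<bar>)"
          by (intro sum_norm_le norm_scaleR_\<delta>_le)
        then show ?thesis by (simp only: a)
      qed
      show "(\<Sum>n\<in>F. \<bar>g n f\<bar>) \<le> 1 * norm f" if "finite F" for F f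
        unfolding g_def ev mult_1
        by (rule sum_abs_blocks_le[OF that _ disj]) (auto simp: sgn_if)
    qed
    have small: "norm (g n) * norm (f n - ?h n) \<le> 1 / 16 * (1 / 2) ^ n" for n
      using mult_mono[OF g_norm[of n] f(2)[of n]] by simp
    show ?thesis
      by (rule complemented_subspace_perturbation[OF sys, of f])
        (use geometric_small_sum[OF _ small] f(1) M in auto)
  qed
qed

section \<open>JL is superprojective\<close>

text \<open>The two cases correspond to the behaviour of \<open>l1_part\<close> on the annihilator of \<open>M\<close>: functionals with a
  nonvanishing \<open>l1_part\<close> lead to a \<open>c0\<close>-like complement, the others to a Hilbertian one.\<close>

lemma superprojective_JL_c0_case:
  fixes h :: "nat \<Rightarrow> 'x \<Rightarrow>\<^sub>L real"
  assumes M: "\<And>n y. y \<in> M \<Longrightarrow> h n y = 0" and h: "\<And>n. norm (h n) \<le> 2"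
    "\<And>n k. k < n \<Longrightarrow> h n (u k) = 0" "\<And>x. (\<lambda>n. h n x) \<longlonglongrightarrow> 0"
    and c: "0 < c" "\<And>n. c \<le> norm (l1_part (h n))"
  shows "\<exists>N'. M \<subseteq> N' \<and> subspace N' \<and> infinite_codimensional N' \<and> complemented N'"
proof -
  have c2: "c \<le> 2" using c(2)[of 0] norm_l1_part_le[of "h 0"] h(1)[of 0] by simp
  \<comment> \<open>\<open>m \<le> i\<close> makes \<open>h i\<close> vanish on the unit vectors
    below \<open>m\<close>, so its l1 part starts at \<open>m\<close>; \<open>n \<le> i\<close>
    makes the chosen indices tend to infinity, so that pointwise convergence to 0 survives.\<close>
  let ?Q = "\<lambda>n m i m'. m \<le> i \<and> n \<le> i \<and> m < m' \<and>
      norm (l1_part (h i) - (\<Sum>k\<in>{m..<m'}. h i (u k) *\<^sub>R \<delta> k)) \<le> c / 16 * (1 / 2) ^ n"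
  have step: "\<exists>i m'. ?Q n m i m'" for n m :: nat
  proof -
    let ?i = "max m n"
    have "0 < c / 16 * (1 / 2) ^ n" using c(1) by simp
    then obtain m' where m': "m < m'"
      "norm (l1_part (h ?i) - (\<Sum>k<m'. h ?i (u k) *\<^sub>R \<delta> k)) < c / 16 * (1 / 2) ^ n"
      by (rule l1_part_truncation)
    have "(\<Sum>k<m'. h ?i (u k) *\<^sub>R \<delta> k) = (\<Sum>k\<in>{m..<m'}. h ?i (u k) *\<^sub>R \<delta> k)"
      by (intro sum.mono_neutral_right) (auto simp: h(2) less_max_iff_disj)
    then show ?thesis using m' by (intro exI[of _ ?i] exI[of _ m']) simp
  qed
  obtain i m where "m 0 = 0" "\<And>n. ?Q n (m n) (i n) (m (Suc n))"
    by (rule dependent_choice_sequence[where Q = ?Q and ?s0.0 = 0, OF step]) (rule that)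
  then have i: "\<And>n. n \<le> i n" and m: "\<And>n. m n < m (Suc n)"
    and tail: "\<And>n. norm (l1_part (h (i n)) - (\<Sum>k\<in>{m n..<m (Suc n)}. h (i n) (u k) *\<^sub>R \<delta> k)) \<le> c / 16 * (1 / 2) ^ n"
    by auto
  have m_mono: "strict_mono m" using m by (simp add: strict_mono_Suc_iff)
  note disj = disjoint_consecutive_intervals[OF m_mono]
  define H where "H n = h (i n)" for n
  define b where "b n = (\<Sum>k\<in>{m n..<m (Suc n)}. H n (u k) *\<^sub>R \<delta> k)" for n
  define t where "t n = (\<Sum>k\<in>{m n..<m (Suc n)}. \<bar>H n (u k)\<bar>)" for n
  have close: "norm (l1_part (H n) - b n) \<le> c / 16 * (1 / 2) ^ n" for n
    using tail[of n] by (simp add: H_def b_def)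
  have close1: "norm (l1_part (H n) - b n) \<le> c / 16" for n
  proof -
    have "c / 16 * (1 / 2) ^ n \<le> c / 16 * 1"
      using c(1) by (intro mult_left_mono power_le_one) auto
    then show ?thesis using close[of n] by simp
  qed
  have t: "c / 2 \<le> t n" for n
  proof -
    have "norm (b n) \<le> t n"
      unfolding b_def t_def by (intro sum_norm_le norm_scaleR_\<delta>_le)
    moreover have "norm (l1_part (H n)) - norm (l1_part (H n) - b n) \<le> norm (b n)"
      using norm_triangle_ineq2[of "l1_part (H n)" "l1_part (H n) - b n"] by simp
    ultimately show ?thesis using c(2)[of "i n"] close1[of n] c(1) by (simp add: H_def)
  qed
  have t_pos: "0 < t n" for n using t[of n] c(1) by simp
  \<comment> \<open>\<open>g n\<close> is \<open>H n\<close> with its l1 part truncated to the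
    \<open>n\<close>-th block. This makes it exactly biorthogonal to the normalized sign vectors, at
    a cost of at most \<open>c / 16 * (1 / 2) ^ n\<close>.\<close>
  define g where "g n = H n - (l1_part (H n) - b n)" for n
  define x where "x n = (1 / t n) *\<^sub>R (\<Sum>k\<in>{m n..<m (Suc n)}. sgn (H n (u k)) *\<^sub>R u k)" for n
  have gu: "g n (u k) = (if k \<in> {m n..<m (Suc n)} then H n (u k) else 0)" for n k
    by (simp add: g_def b_def blinfun.diff_left l1_part_u blinfun.sum_left blinfun.scaleR_left \<delta>_u
        if_distrib sum.delta cong: if_cong)
  have x_c0: "norm (\<Sum>n\<in>F. a n *\<^sub>R x n) \<le> 2 / c * B"
    if "finite F" "0 \<le> B" "\<And>n. n \<in> F \<Longrightarrow> \<bar>a n\<bar> \<le> B" for F a B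
  proof -
    have "\<bar>a n / t n\<bar> \<le> 2 / c * B" if "n \<in> F" for n
    proof -
      have "\<bar>a n\<bar> / t n \<le> B / (c / 2)"
        using \<open>\<And>n. n \<in> F \<Longrightarrow> \<bar>a n\<bar> \<le> B\<close>[OF that] t[of n] c(1) \<open>0 \<le> B\<close> by (intro frac_le) auto
      then show ?thesis using t_pos[of n] by (simp add: mult.commute)
    qed
    then have "norm (\<Sum>n\<in>F. (a n / t n) *\<^sub>R (\<Sum>k\<in>{m n..<m (Suc n)}. sgn (H n (u k)) *\<^sub>R u k)) \<le> 2 / c * B"
      using that(1,2) c(1) by (intro norm_blocks_le disj) (auto simp: sgn_if)
    then show ?thesis by (simp add: x_def)
  qed
  have sys: "projection_system x g"
  proof (rule projection_system_c0)
    show "g n (x l) = (if n = l then 1 else 0)" for n l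
    proof -
      have eq: "g n (x l) = (1 / t l) * (\<Sum>k\<in>{m l..<m (Suc l)}. sgn (H l (u k)) *
          (if k \<in> {m n..<m (Suc n)} then H n (u k) else 0))"
        by (simp add: x_def blinfun.scaleR_right blinfun.sum_right gu)
      show ?thesis
      proof (cases "n = l")
        case True
        have "(\<Sum>k\<in>{m l..<m (Suc l)}. sgn (H l (u k)) * (if k \<in> {m n..<m (Suc n)} then H n (u k) else 0)) = t l"
          unfolding t_def True by (intro sum.cong) (auto simp: abs_sgn mult.commute)
        then show ?thesis using eq t_pos[of l] True by simp
      next
        case False
        have "(\<Sum>k\<in>{m l..<m (Suc l)}. sgn (H l (u k)) * (if k \<in> {m n..<m (Suc n)} then H n (u k) else 0)) = 0"
          using disj[OF False] by (intro sum.neutral) auto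
        then show ?thesis using eq False by simp
      qed
    qed
    show "norm (g n) \<le> 3" for n
      using norm_triangle_ineq4[of "H n" "l1_part (H n) - b n"] h(1)[of "i n"] close1[of n] c2
      by (simp add: g_def H_def)
    show "(\<lambda>n. g n y) \<longlonglongrightarrow> 0" for y
    proof -
      have "filterlim i at_top sequentially"
        by (rule filterlim_at_top_mono[OF filterlim_ident]) (simp add: i)
      then have 1: "(\<lambda>n. H n y) \<longlonglongrightarrow> 0"
        unfolding H_def by (rule filterlim_compose[OF h(3)])
      have "(\<lambda>n. (l1_part (H n) - b n) y) \<longlonglongrightarrow> 0"
      proof (rule Lim_null_comparison)
        show "\<forall>\<^sub>F n in sequentially. norm ((l1_part (H n) - b n) y) \<le> c / 16 * (1 / 2) ^ n * norm y"
          using norm_blinfun[of "l1_part (H _) - b _" y] mult_right_mono[OF close norm_ge_zero[of y]]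
          by (intro always_eventually allI) (meson order_trans)
        have "(\<lambda>n. (1 / 2 :: real) ^ n) \<longlonglongrightarrow> 0" by (intro LIMSEQ_power_zero) simp
        then show "(\<lambda>n. c / 16 * (1 / 2) ^ n * norm y) \<longlonglongrightarrow> 0"
          by (intro tendsto_mult_left_zero tendsto_mult_right_zero)
      qed
      then show ?thesis
        using tendsto_diff[OF 1] by (fastforce simp: g_def blinfun.diff_left)
    qed
  qed (rule x_c0)
  have small: "norm (H n - g n) * norm (x n) \<le> 1 / 8 * (1 / 2) ^ n" for n
  proof -
    \<comment> \<open>The blocks have l1 mass at least \<open>c / 2\<close>, so \<open>c\<close>
      cancels in the product of the two bounds.\<close>
    have "norm (x n) \<le> 2 / c" using x_c0[of "{n}" 1 "\<lambda>_. 1"] by simp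
    then have "norm (H n - g n) * norm (x n) \<le> (c / 16 * (1 / 2) ^ n) * (2 / c)"
      using close[of n] c(1) by (intro mult_mono) (auto simp: g_def)
    then show ?thesis using c(1) by simp
  qed
  show ?thesis
    by (rule infinite_codimensional_complemented_perturbation[OF sys, of H])
      (use geometric_small_sum[OF _ small] M in \<open>auto simp: H_def\<close>)
qed

text \<open>A unit functional in \<open>G\<close> with small l1 part is nearly a finite combination
  of coefficient functionals \<open>e \<gamma>\<close>. Choosing such functionals over disjoint
  index sets gives an l2-like sequence, and the matching vectors are combinations of cuts, which are
  l2-like as well once each stage cuts high enough to be disjoint from the earlier ones.\<close>

lemma superprojective_JL_hilbertian_case:
  fixes G :: "('x \<Rightarrow>\<^sub>L real) set"
  assumes G: "subspace G" "infinite_dimensional G" and M: "\<And>f y. f \<in> G \<Longrightarrow> y \<in> M \<Longrightarrow> blinfun_apply f y = 0"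
    and small: "\<And>c. 0 < c \<Longrightarrow> \<exists>m. \<forall>f\<in>G. (\<forall>k<m. blinfun_apply f (u k) = 0) \<longrightarrow> norm f = 1 \<longrightarrow> norm (l1_part f) < c"
  shows "\<exists>N'. M \<subseteq> N' \<and> subspace N' \<and> infinite_codimensional N' \<and> complemented N'"
proof -
  obtain R :: "('x \<Rightarrow>\<^sub>L real) \<Rightarrow>\<^sub>L 'g l2" where R: "\<And>f \<gamma>. l2_nth (R f) \<gamma> = (f - l1_part f) (\<phi> \<gamma>)"
    "\<And>f. norm (R f) \<le> 2 * norm f" "\<And>f. norm (f - l1_part f) \<le> norm (R f)"
    by (rule dual_coefficient_operator) (rule that)
  have lin_u: "linear (\<lambda>f :: 'x \<Rightarrow>\<^sub>L real. f (u k))" for k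
    by (simp add: blinfun.bounded_linear_left bounded_linear.linear)
  have lin_R: "linear (\<lambda>f. l2_nth (R f) \<gamma>)" for \<gamma>
    by (rule linearI) (simp_all add: blinfun.add_right blinfun.scaleR_right plus_l2.rep_eq scaleR_l2.rep_eq)
  let ?r = "\<lambda>f \<gamma>. l2_nth (R f) \<gamma>"
  let ?g = "\<lambda>f A. \<Sum>\<gamma>\<in>A. ?r f \<gamma> *\<^sub>R e \<gamma>"
  \<comment> \<open>\<open>F\<close> collects the indices used so far, \<open>A\<close> the fresh
    ones, and beyond height \<open>K\<close> all their supports are disjoint. The bounds 1/16 and 4
    make the later normalization uniform in \<open>n\<close>.\<close>
  let ?Q = "\<lambda>n F (f, A, K) F'. finite A \<and> A \<inter> F = {} \<and> F' = F \<union> A \<and> f \<in> G \<and>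
      norm (f - ?g f A) \<le> (1 / 2) ^ n / 32 \<and> 1 / 16 \<le> (\<Sum>\<gamma>\<in>A. (?r f \<gamma>)\<^sup>2) \<and> (\<Sum>\<gamma>\<in>A. (?r f \<gamma>)\<^sup>2) \<le> 4 \<and>
      (\<forall>\<gamma>\<in>F'. \<forall>\<gamma>'\<in>F'. \<forall>k\<ge>K. k \<in> N \<gamma> \<longrightarrow> k \<in> N \<gamma>' \<longrightarrow> \<gamma> = \<gamma>')"
  have step: "\<exists>y F'. ?Q n F y F' \<and> finite F'" if F: "finite F" for n :: nat and F :: "'g set"
  proof -
    define \<epsilon> where "\<epsilon> = (1 / 2 :: real) ^ n / 64"
    have eps: "0 < \<epsilon>" "\<epsilon> \<le> 1 / 64" by (simp_all add: \<epsilon>_def power_le_one)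
    obtain m where m: "\<And>f. f \<in> G \<Longrightarrow> \<forall>k<m. blinfun_apply f (u k) = 0 \<Longrightarrow> norm f = 1 \<Longrightarrow> norm (l1_part f) < \<epsilon>"
      using small[OF eps(1)] by blast
    define G' where "G' = {f \<in> G. \<forall>k\<in>{..<m}. blinfun_apply f (u k) = 0}"
    have "subspace G'" "infinite_dimensional G'"
      unfolding G'_def by (intro subspace_inter_kernels infinite_dimensional_inter_kernels G lin_u; simp)+
    then obtain f where f: "f \<in> G'" "norm f = 1" "\<And>\<gamma>. \<gamma> \<in> F \<Longrightarrow> ?r f \<gamma> = 0"
      using infinite_dimensional_unit_vector[OF F, of G' "\<lambda>\<gamma> f. l2_nth (R f) \<gamma>"] lin_R by metis
    have fG: "f \<in> G" and l1: "norm (l1_part f) < \<epsilon>"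
      using f(1,2) m by (auto simp: G'_def)
    have "1 - \<epsilon> \<le> norm (f - l1_part f)"
      using norm_triangle_ineq2[of f "l1_part f"] f(2) l1 by simp
    then have Rf: "1 / 2 \<le> norm (R f)" using R(3)[of f] eps(2) by simp
    obtain F1 where F1: "finite F1" "\<And>H. finite H \<Longrightarrow> H \<inter> F1 = {} \<Longrightarrow> (\<Sum>\<gamma>\<in>H. (?r f \<gamma>)\<^sup>2) \<le> \<epsilon>\<^sup>2"
      "(norm (R f))\<^sup>2 - \<epsilon>\<^sup>2 \<le> (\<Sum>\<gamma>\<in>F1. (?r f \<gamma>)\<^sup>2)"
      using norm_l2_tail[of "\<epsilon>\<^sup>2" "R f"] eps(1) by (metis zero_less_power)
    define A where "A = F1 - F"
    have A: "finite A" "A \<inter> F = {}" using F1(1) by (auto simp: A_def)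
    have sum_A: "(\<Sum>\<gamma>\<in>A. (?r f \<gamma>)\<^sup>2) = (\<Sum>\<gamma>\<in>F1. (?r f \<gamma>)\<^sup>2)"
      unfolding A_def using F1(1) f(3) by (intro sum.mono_neutral_left) auto
    \<comment> \<open>\<open>R f\<close> has norm at least 1/2, and the truncation loses at most
      \<open>(1 / 64)\<^sup>2\<close> of its square.\<close>
    have "(1 / 2)\<^sup>2 \<le> (norm (R f))\<^sup>2" using Rf by (intro power_mono) auto
    moreover have "\<epsilon>\<^sup>2 \<le> (1 / 64)\<^sup>2" using eps by (intro power_mono) auto
    ultimately have lower: "1 / 16 \<le> (\<Sum>\<gamma>\<in>A. (?r f \<gamma>)\<^sup>2)"
      using F1(3) unfolding sum_A by (simp add: power2_eq_square)
    have "(norm (R f))\<^sup>2 \<le> 2\<^sup>2" using R(2)[of f] f(2) by (intro power_mono) auto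
    then have upper: "(\<Sum>\<gamma>\<in>A. (?r f \<gamma>)\<^sup>2) \<le> 4"
      using sum_squares_le_norm_l2[OF A(1), of "R f"] by simp
    \<comment> \<open>What remains after the l1 part and the finite part vanishes on c0, so its norm
      is controlled by the discarded coordinates alone; those in \<open>F\<close> are 0 by the
      choice of \<open>f\<close>.\<close>
    let ?d = "f - l1_part f - ?g f A"
    have "norm ?d \<le> \<epsilon>"
    proof (rule c0_annihilator_norm_le)
      show "?d (u k) = 0" for k
        by (simp add: blinfun.diff_left l1_part_u blinfun.sum_left blinfun.scaleR_left e_u)
      show "(\<Sum>\<gamma>\<in>H. (?d (\<phi> \<gamma>))\<^sup>2) \<le> \<epsilon>\<^sup>2" if H: "finite H" for H
      proof -
        have d: "?d (\<phi> \<gamma>) = (if \<gamma> \<in> A then 0 else ?r f \<gamma>)" for \<gamma>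
        proof -
          have "?g f A (\<phi> \<gamma>) = (if \<gamma> \<in> A then ?r f \<gamma> else 0)"
            using A(1) by (simp add: blinfun.sum_left blinfun.scaleR_left e_\<phi> if_distrib sum.delta' cong: if_cong)
          then show ?thesis by (simp add: blinfun.diff_left[of "f - l1_part f"] R(1))
        qed
        have "(\<Sum>\<gamma>\<in>H. (?d (\<phi> \<gamma>))\<^sup>2) = (\<Sum>\<gamma>\<in>H - (A \<union> F). (?r f \<gamma>)\<^sup>2)"
          unfolding d using H f(3) by (intro sum.mono_neutral_cong_right) auto
        also have "\<dots> \<le> \<epsilon>\<^sup>2" by (rule F1(2)) (use H in \<open>auto simp: A_def\<close>)
        finally show ?thesis .
      qed
    qed (use eps in simp)
    then have close: "norm (f - ?g f A) \<le> (1 / 2) ^ n / 32"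
      using norm_triangle_ineq[of "l1_part f" ?d] l1 by (simp add: \<epsilon>_def)
    have "finite (F \<union> A)" using F A by simp
    then obtain K where K: "\<And>\<gamma> \<gamma>' k. \<gamma> \<in> F \<union> A \<Longrightarrow> \<gamma>' \<in> F \<union> A \<Longrightarrow> k \<in> N \<gamma> \<Longrightarrow> k \<in> N \<gamma>' \<Longrightarrow> K \<le> k \<Longrightarrow> \<gamma> = \<gamma>'"
      using disjoint_cuts[of "F \<union> A"] by blast
    have "?Q n F (f, A, K) (F \<union> A)"
    proof (simp only: prod.case, intro conjI ballI allI impI)
      show "\<gamma> = \<gamma>'" if "\<gamma> \<in> F \<union> A" "\<gamma>' \<in> F \<union> A" "K \<le> k" "k \<in> N \<gamma>" "k \<in> N \<gamma>'" for \<gamma> \<gamma>' k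
        using K that by blast
    qed (rule A fG close lower upper refl)+
    then show ?thesis
      using \<open>finite (F \<union> A)\<close> by (intro exI[of _ "(f, A, K)"] exI[of _ "F \<union> A"] conjI)
  qed
  obtain y F where "F 0 = {}" and finF: "\<And>n. finite (F n)" and "\<And>n. ?Q n (F n) (y n) (F (Suc n))"
    by (rule dependent_choice_states[where I = finite and Q = ?Q and ?s0.0 = "{}", OF _ step])
      (auto intro: that)
  then obtain f A K where A: "\<And>n. finite (A n)" "\<And>n. A n \<inter> F n = {}" and FS: "\<And>n. F (Suc n) = F n \<union> A n"
    and f: "\<And>n. f n \<in> G" "\<And>n. norm (f n - ?g (f n) (A n)) \<le> (1 / 2) ^ n / 32"
    and t: "\<And>n. 1 / 16 \<le> (\<Sum>\<gamma>\<in>A n. (?r (f n) \<gamma>)\<^sup>2)" "\<And>n. (\<Sum>\<gamma>\<in>A n. (?r (f n) \<gamma>)\<^sup>2) \<le> 4"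
    and K: "\<And>n \<gamma> \<gamma>' k. \<gamma> \<in> F (Suc n) \<Longrightarrow> \<gamma>' \<in> F (Suc n) \<Longrightarrow> K n \<le> k \<Longrightarrow> k \<in> N \<gamma> \<Longrightarrow> k \<in> N \<gamma>' \<Longrightarrow> \<gamma> = \<gamma>'"
    using that[of "\<lambda>n. fst (snd (y n))" "\<lambda>n. fst (y n)" "\<lambda>n. snd (snd (y n))"]
    by (simp add: case_prod_unfold)
  have A_sub: "A i \<subseteq> F n" if "i < n" for i n
    using that by (induction n) (auto simp: FS less_Suc_eq)
  have A_disj: "A i \<inter> A n = {}" if "i \<noteq> n" for i n
    using that A_sub[of i n] A_sub[of n i] A(2)[of i] A(2)[of n] by (cases i n rule: linorder_cases) auto
  define r where "r n \<gamma> = ?r (f n) \<gamma>" for n \<gamma>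
  define s where "s n = (\<Sum>\<gamma>\<in>A n. (r n \<gamma>)\<^sup>2)" for n
  have s: "1 / 16 \<le> s n" "s n \<le> 4" "0 < s n" for n
    using t(1,2)[of n] by (simp_all add: s_def r_def)
  define g where "g n = (\<Sum>\<gamma>\<in>A n. r n \<gamma> *\<^sub>R e \<gamma>)" for n
  define x where "x n = (1 / s n) *\<^sub>R (\<Sum>\<gamma>\<in>A n. r n \<gamma> *\<^sub>R cut \<gamma> (K n))" for n
  have close: "norm (f n - g n) \<le> (1 / 2) ^ n / 32" for n
    using f(2)[of n] by (simp add: g_def r_def)
  have x_l2: "norm (\<Sum>n\<in>B. a n *\<^sub>R x n) \<le> 4 * L2_set a B" if B: "finite B" for B and a :: "nat \<Rightarrow> real"
  proof -
    \<comment> \<open>\<open>\<nu> \<gamma>\<close> is the block that contains \<gamma>; with it a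
      combination of blocks becomes a single combination of cuts. The factor 4 of the estimate is
      the square root of 16, because \<open>s n\<close> is at least 1/16.\<close>
    define \<nu> where "\<nu> \<gamma> = (THE n. \<gamma> \<in> A n)" for \<gamma>
    have \<nu>: "\<nu> \<gamma> = n" if "\<gamma> \<in> A n" for \<gamma> n
      unfolding \<nu>_def using that A_disj by (intro the_equality) blast+
    define b where "b \<gamma> = a (\<nu> \<gamma>) * r (\<nu> \<gamma>) \<gamma> / s (\<nu> \<gamma>)" for \<gamma>
    have finU: "finite (\<Union>n\<in>B. A n)" using B A(1) by blast
    have UN: "(\<Sum>\<gamma>\<in>(\<Union>n\<in>B. A n). h \<gamma>) = (\<Sum>n\<in>B. \<Sum>\<gamma>\<in>A n. h \<gamma>)" for h :: "'g \<Rightarrow> 'c::comm_monoid_add"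
      using B A(1) A_disj by (intro sum.UNION_disjoint) auto
    have "(\<Sum>n\<in>B. a n *\<^sub>R x n) = (\<Sum>n\<in>B. \<Sum>\<gamma>\<in>A n. b \<gamma> *\<^sub>R cut \<gamma> (K (\<nu> \<gamma>)))"
    proof (rule sum.cong[OF refl])
      fix n assume "n \<in> B"
      have "(\<Sum>\<gamma>\<in>A n. b \<gamma> *\<^sub>R cut \<gamma> (K (\<nu> \<gamma>))) = (\<Sum>\<gamma>\<in>A n. (a n * r n \<gamma> / s n) *\<^sub>R cut \<gamma> (K n))"
        by (intro sum.cong) (auto simp: b_def \<nu>)
      then show "a n *\<^sub>R x n = (\<Sum>\<gamma>\<in>A n. b \<gamma> *\<^sub>R cut \<gamma> (K (\<nu> \<gamma>)))"
        by (simp add: x_def scaleR_sum_right)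
    qed
    also have "norm \<dots> \<le> L2_set b (\<Union>n\<in>B. A n)"
      unfolding UN[symmetric]
    proof (rule norm_sum_cut_le[OF finU])
      fix \<gamma> \<gamma>' k
      assume "\<gamma> \<in> (\<Union>n\<in>B. A n)" "\<gamma>' \<in> (\<Union>n\<in>B. A n)"
        and k: "k \<in> N \<gamma>" "k \<in> N \<gamma>'" "K (\<nu> \<gamma>) \<le> k" "K (\<nu> \<gamma>') \<le> k"
      then obtain i n where i: "\<gamma> \<in> A i" "\<gamma>' \<in> A n" by blast
      have K': "K i \<le> k" "K n \<le> k" using k(3,4) i \<nu> by simp_all
      \<comment> \<open>At the later of the two stages both indices are present, and the height of
        that stage, which is \<open>K i\<close> or \<open>K n\<close>, separates them.\<close>
      let ?l = "max i n"
      have "\<gamma> \<in> F (Suc ?l)" "\<gamma>' \<in> F (Suc ?l)"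
        using i subsetD[OF A_sub[of i "Suc ?l"]] subsetD[OF A_sub[of n "Suc ?l"]]
        by (simp_all add: less_Suc_eq_le)
      then show "\<gamma> = \<gamma>'"
        by (rule K[of _ ?l _ k]) (use k K' in \<open>auto simp: max_def\<close>)
    qed
    also have "\<dots> \<le> 4 * L2_set a B"
    proof -
      have "(\<Sum>\<gamma>\<in>(\<Union>n\<in>B. A n). (b \<gamma>)\<^sup>2) = (\<Sum>n\<in>B. \<Sum>\<gamma>\<in>A n. (b \<gamma>)\<^sup>2)" by (rule UN)
      also have "\<dots> = (\<Sum>n\<in>B. (a n)\<^sup>2 / s n)"
      proof (rule sum.cong[OF refl])
        fix n assume "n \<in> B"
        have "(\<Sum>\<gamma>\<in>A n. (b \<gamma>)\<^sup>2) = (\<Sum>\<gamma>\<in>A n. (a n / s n)\<^sup>2 * (r n \<gamma>)\<^sup>2)"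
          by (intro sum.cong) (auto simp: b_def \<nu> power_mult_distrib power_divide)
        also have "\<dots> = (a n / s n)\<^sup>2 * s n" unfolding s_def sum_distrib_left ..
        also have "\<dots> = (a n)\<^sup>2 / s n" using s(3)[of n] by (simp add: power2_eq_square)
        finally show "(\<Sum>\<gamma>\<in>A n. (b \<gamma>)\<^sup>2) = (a n)\<^sup>2 / s n" .
      qed
      also have "\<dots> \<le> (\<Sum>n\<in>B. (a n)\<^sup>2 / (1 / 16))"
        using s by (intro sum_mono divide_left_mono) auto
      also have "\<dots> = (4 * L2_set a B)\<^sup>2"
        by (simp add: L2_set_def power_mult_distrib sum_nonneg sum_distrib_left mult.commute)
      finally show ?thesis unfolding L2_set_def[of b] by (simp add: real_le_lsqrt sum_nonneg)
    qed
    finally show ?thesis .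
  qed
  have sys: "projection_system x g"
  proof (rule projection_system_l2[where C = 4 and K = 2])
    show "g n (x l) = (if n = l then 1 else 0)" for n l
    proof -
      have e_sum: "e \<gamma> (\<Sum>\<gamma>'\<in>A l. r l \<gamma>' *\<^sub>R cut \<gamma>' (K l)) = (if \<gamma> \<in> A l then r l \<gamma> else 0)" for \<gamma>
        using A(1)[of l] by (simp add: blinfun.sum_right blinfun.scaleR_right e_cut if_distrib sum.delta cong: if_cong)
      have eq: "g n (x l) = (1 / s l) * (\<Sum>\<gamma>\<in>A n. r n \<gamma> * (if \<gamma> \<in> A l then r l \<gamma> else 0))"
        unfolding x_def blinfun.scaleR_right g_def blinfun.sum_left blinfun.scaleR_left e_sum by simp
      show ?thesis
      proof (cases "n = l")
        case True
        have "(\<Sum>\<gamma>\<in>A n. r n \<gamma> * (if \<gamma> \<in> A l then r l \<gamma> else 0)) = s l"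
          unfolding True s_def by (intro sum.cong) (auto simp: power2_eq_square)
        then show ?thesis using eq s(3)[of l] True by simp
      next
        case False
        have "(\<Sum>\<gamma>\<in>A n. r n \<gamma> * (if \<gamma> \<in> A l then r l \<gamma> else 0)) = 0"
          using A_disj[OF False] by (intro sum.neutral) auto
        then show ?thesis using eq False by simp
      qed
    qed
    show "(\<Sum>n\<in>B. (g n y)\<^sup>2) \<le> (2 * norm y)\<^sup>2" if B: "finite B" for B y
    proof -
      have "(g n y)\<^sup>2 \<le> 4 * (\<Sum>\<gamma>\<in>A n. (e \<gamma> y)\<^sup>2)" for n
      proof -
        have "(g n y)\<^sup>2 \<le> s n * (\<Sum>\<gamma>\<in>A n. (e \<gamma> y)\<^sup>2)"
          using Cauchy_Schwarz_ineq_sum[of "r n" "\<lambda>\<gamma>. e \<gamma> y" "A n"]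
          by (simp add: g_def s_def blinfun.sum_left blinfun.scaleR_left)
        also have "\<dots> \<le> 4 * (\<Sum>\<gamma>\<in>A n. (e \<gamma> y)\<^sup>2)"
          using s by (intro mult_right_mono) (auto simp: sum_nonneg)
        finally show ?thesis .
      qed
      then have "(\<Sum>n\<in>B. (g n y)\<^sup>2) \<le> (\<Sum>n\<in>B. 4 * (\<Sum>\<gamma>\<in>A n. (e \<gamma> y)\<^sup>2))" by (rule sum_mono)
      also have "\<dots> = 4 * (\<Sum>\<gamma>\<in>(\<Union>n\<in>B. A n). (e \<gamma> y)\<^sup>2)"
        unfolding sum_distrib_left[symmetric] using B A(1) A_disj by (subst sum.UNION_disjoint) auto
      also have "\<dots> \<le> 4 * (norm y)\<^sup>2"
        using B A(1) by (intro mult_left_mono sum_e_le) auto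
      finally show ?thesis by (simp add: power_mult_distrib)
    qed
  qed (use x_l2 in auto)
  have small: "norm (f n - g n) * norm (x n) \<le> 1 / 8 * (1 / 2) ^ n" for n
  proof -
    have "norm (x n) \<le> 4" using x_l2[of "{n}" "\<lambda>_. 1"] by simp
    then have "norm (f n - g n) * norm (x n) \<le> ((1 / 2) ^ n / 32) * 4"
      using close[of n] by (intro mult_mono) auto
    then show ?thesis by simp
  qed
  show ?thesis
    by (rule infinite_codimensional_complemented_perturbation[OF sys, of f])
      (use geometric_small_sum[OF _ small] M f(1) in auto)
qed

lemma superprojective_JL:
  fixes M :: "'x set"
  assumes M: "subspace M" "closed M" "infinite_codimensional M"
  shows "\<exists>N'. M \<subseteq> N' \<and> subspace N' \<and> infinite_codimensional N' \<and> complemented N'"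
proof -
  let ?G = "annihilator M"
  note G = subspace_annihilator[of M] infinite_dimensional_annihilator[OF M]
  show ?thesis
  proof (cases "\<exists>c>0. \<forall>m. \<exists>f\<in>?G. (\<forall>k<m. blinfun_apply f (u k) = 0) \<and> norm f = 1 \<and> c \<le> norm (l1_part f)")
    case True
    then obtain c and f :: "nat \<Rightarrow> 'x \<Rightarrow>\<^sub>L real" where c: "0 < c" and f: "\<And>m. f m \<in> ?G" "\<And>m k. k < m \<Longrightarrow> f m (u k) = 0"
      "\<And>m. norm (f m) = 1" "\<And>m. c \<le> norm (l1_part (f m))"
      by metis
    have "(\<lambda>n. f n (u k)) \<longlonglongrightarrow> 0" for k
      by (rule tendsto_eventually) (use f(2) in \<open>auto simp: eventually_sequentially intro!: exI[of _ "Suc k"]\<close>)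
    then obtain s L where s: "strict_mono s" "\<And>x. (\<lambda>n. f (s n) x) \<longlonglongrightarrow> blinfun_apply L x"
      "norm L \<le> 1" "\<And>k. L (u k) = 0"
      using weak_star_convergent_subsequence[of f 1] f(3) by (metis order_refl)
    \<comment> \<open>\<open>L\<close> vanishes on \<open>M\<close> as a pointwise limit of
      annihilating functionals, so \<open>h n\<close> still annihilates \<open>M\<close>; it
      vanishes on c0, so the subtraction leaves the l1 parts unchanged.\<close>
    define h where "h n = f (s n) - L" for n
    have L0: "L y = 0" if "y \<in> M" for y
      using LIMSEQ_unique[OF s(2)[of y]] f(1) that by (simp add: annihilator_def)
    show ?thesis
    proof (rule superprojective_JL_c0_case[OF _ _ _ _ c])
      show "h n y = 0" if "y \<in> M" for n y
        using f(1)[of "s n"] L0 that by (simp add: h_def annihilator_def blinfun.diff_left)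
      show "norm (h n) \<le> 2" for n
        using norm_triangle_ineq4[of "f (s n)" L] f(3)[of "s n"] s(3) by (simp add: h_def)
      show "h n (u k) = 0" if "k < n" for n k
        using f(2)[of k "s n"] s(4) seq_suble[OF s(1), of n] that by (simp add: h_def blinfun.diff_left)
      show "(\<lambda>n. h n x) \<longlonglongrightarrow> 0" for x
        using tendsto_diff[OF s(2)[of x] tendsto_const[of "L x"]] by (simp add: h_def blinfun.diff_left)
      have "l1_part L = 0" by (simp add: l1_part_def s(4))
      then show "c \<le> norm (l1_part (h n))" for n
        using f(4)[of "s n"] by (simp add: h_def linear_diff[OF linear_l1_part])
    qed
  next
    case False
    then have "\<exists>m. \<forall>f\<in>?G. (\<forall>k<m. blinfun_apply f (u k) = 0) \<longrightarrow> norm f = 1 \<longrightarrow> norm (l1_part f) < c" if "0 < c" for c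
      using that unfolding not_le[symmetric] by blast
    then show ?thesis
      by (intro superprojective_JL_hilbertian_case[OF G]) (auto simp: annihilator_def)
  qed
qed

end

section \<open>The dual of JL is not superprojective\<close>

lemma apply_bcontfun_discrete:
  fixes f :: "nat \<Rightarrow> real"
  assumes "\<And>n. \<bar>f n\<bar> \<le> C"
  shows "apply_bcontfun (Bcontfun f) = f"
proof (rule Bcontfun_inverse)
  show "f \<in> bcontfun"
    using assms by (intro bcontfun_normI[where b = C]) auto
qed

lemma linf_operator:
  fixes Q :: "nat \<Rightarrow> 'a::real_normed_vector \<Rightarrow> real"
  assumes lin: "\<And>j. linear (Q j)" and le: "\<And>j x. \<bar>Q j x\<bar> \<le> C * norm x"
  obtains q :: "'a \<Rightarrow>\<^sub>L (nat \<Rightarrow>\<^sub>C real)" where "\<And>x j. apply_bcontfun (q x) j = Q j x" "\<And>x. norm (q x) \<le> C * norm x"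
proof -
  have ap: "apply_bcontfun (Bcontfun (\<lambda>j. Q j x)) = (\<lambda>j. Q j x)" for x
    by (rule apply_bcontfun_discrete[OF le])
  have bound: "norm (Bcontfun (\<lambda>j. Q j x)) \<le> C * norm x" for x
    by (rule norm_bound) (simp add: ap le)
  have "bounded_linear (\<lambda>x. Bcontfun (\<lambda>j. Q j x))"
  proof (rule bounded_linear_intro[where K = C])
    show "Bcontfun (\<lambda>j. Q j (x + y)) = Bcontfun (\<lambda>j. Q j x) + Bcontfun (\<lambda>j. Q j y)" for x y
      by (rule bcontfun_eqI, unfold plus_bcontfun.rep_eq ap) (simp add: linear_add[OF lin])
    show "Bcontfun (\<lambda>j. Q j (r *\<^sub>R x)) = r *\<^sub>R Bcontfun (\<lambda>j. Q j x)" for r x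
      by (rule bcontfun_eqI, unfold scaleR_bcontfun.rep_eq ap) (simp add: linear_scale[OF lin])
  qed (use bound in \<open>simp add: mult.commute\<close>)
  then have "blinfun_apply (Blinfun (\<lambda>x. Bcontfun (\<lambda>j. Q j x))) = (\<lambda>x. Bcontfun (\<lambda>j. Q j x))"
    by (rule bounded_linear_Blinfun_apply)
  then show ?thesis using that[of "Blinfun (\<lambda>x. Bcontfun (\<lambda>j. Q j x))"] ap bound by simp
qed

text \<open>The complementary projection vanishes on \<open>N\<close> and fixes an
  infinite-dimensional range; both proofs that a space is not superprojective argue in this
  range.\<close>

lemma infinite_codimensional_complement:
  fixes N :: "'a::banach set"
  assumes "complemented N" "subspace N" "infinite_codimensional N"
  obtains P :: "'a \<Rightarrow>\<^sub>L 'a" where "\<And>x. P (P x) = P x" "\<And>x. x \<in> N \<Longrightarrow> P x = 0"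
    "subspace (range P)" "infinite_dimensional (range P)"
proof -
  obtain P0 :: "'a \<Rightarrow>\<^sub>L 'a" where P0: "\<And>x. P0 (P0 x) = P0 x" "range P0 = N"
    using assms(1) unfolding complemented_def by blast
  define P where "P = id_blinfun - P0"
  have P: "P x = x - P0 x" for x by (simp add: P_def blinfun.diff_left)
  have sub: "subspace (range P)"
    by (simp add: blinfun.bounded_linear_right bounded_linear.linear linear_subspace_image)
  have "infinite_dimensional (range P)"
    unfolding infinite_dimensional_def
  proof
    assume "\<exists>B. finite B \<and> range P \<subseteq> span B"
    then obtain B where B: "finite B" "range P \<subseteq> span B" by blast
    have "x \<in> span (N \<union> B)" for x
    proof -
      have "P0 x \<in> span (N \<union> B)" using P0(2) by (intro span_base) auto
      moreover have "P x \<in> span (N \<union> B)"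
        using B(2) span_mono[of B "N \<union> B"] by blast
      ultimately have "P0 x + P x \<in> span (N \<union> B)" by (rule span_add)
      then show ?thesis by (simp add: P)
    qed
    then have "span (N \<union> B) = UNIV" by auto
    then show False using assms(3) B(1) unfolding infinite_codimensional_def by blast
  qed
  moreover have "P x = 0" if "x \<in> N" for x
    using that P0 by (auto simp: P)
  moreover have "P (P x) = P x" for x by (simp add: P blinfun.diff_right P0(1))
  ultimately show ?thesis using that sub by blast
qed

lemma sum_consecutive_intervals:
  fixes m :: "nat \<Rightarrow> nat" and h :: "nat \<Rightarrow> real"
  assumes "strict_mono m"
  shows "(\<Sum>i<n. \<Sum>k\<in>{m i..<m (Suc i)}. h k) = (\<Sum>k\<in>{m 0..<m n}. h k)"
proof (induction n)
  case (Suc n)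
  have "m 0 \<le> m n" "m n \<le> m (Suc n)" using assms by (simp_all add: strict_mono_less_eq)
  then show ?case using Suc by (simp add: sum.atLeastLessThan_concat)
qed simp

lemma card_intervals_le_1:
  fixes m :: "nat \<Rightarrow> nat"
  assumes "strict_mono m"
  shows "(\<Sum>l<n. if j \<in> {m l..<m (Suc l)} then 1 else 0 :: real) \<le> 1"
proof -
  have "(\<Sum>l<n. if j \<in> {m l..<m (Suc l)} then 1 else 0 :: real) = card {l \<in> {..<n}. j \<in> {m l..<m (Suc l)}}"
    by (simp add: sum.If_cases Int_def)
  moreover have "a = b" if "j \<in> {m a..<m (Suc a)}" "j \<in> {m b..<m (Suc b)}" for a b
    using disjoint_consecutive_intervals[OF assms, of a b] that by auto
  then have "card {l \<in> {..<n}. j \<in> {m l..<m (Suc l)}} \<le> Suc 0"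
    by (subst card_le_Suc0_iff_eq) (simp, blast)
  ultimately show ?thesis by linarith
qed

text \<open>The vectors of \<open>c0\<close> with finitely many entries \<open>1\<close>, \<open>-1\<close> and all others \<open>0\<close>; every element of the
  unit ball of \<open>c0\<close> is at distance at most \<open>1/2\<close> from one of them.\<close>

definition ternary :: "nat \<Rightarrow> nat \<Rightarrow> real" where
  "ternary k j = indicator (set_decode (fst (prod_decode k))) j - indicator (set_decode (snd (prod_decode k))) j"

lemma abs_ternary_le: "\<bar>ternary k j\<bar> \<le> 1"
  by (auto simp: ternary_def indicator_def)

lemma ternary_code:
  assumes "finite A" "finite B"
  shows "ternary (prod_encode (set_encode A, set_encode B)) j = indicator A j - indicator B j"
  using assms by (simp add: ternary_def)

lemma ternary_tendsto_0: "(\<lambda>j. ternary k j) \<longlonglongrightarrow> 0"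
proof -
  let ?S = "set_decode (fst (prod_decode k)) \<union> set_decode (snd (prod_decode k))"
  have "finite ?S" by simp
  then have "\<forall>\<^sub>F j in sequentially. j \<notin> ?S"
    by (simp add: cofinite_eq_sequentially[symmetric] eventually_cofinite)
  then have "\<forall>\<^sub>F j in sequentially. ternary k j = 0"
    by eventually_elim (simp add: ternary_def)
  then show ?thesis by (rule tendsto_eventually)
qed

context JL_model
begin

lemma summable_mult_u:
  fixes f :: "'x \<Rightarrow>\<^sub>L real"
  assumes b: "\<And>k. \<bar>b k\<bar> \<le> C"
  shows "summable (\<lambda>k. b k * f (u k))"
proof (rule summable_comparison_test[OF _ summable_mult[OF summable_abs_u[of f], of C]])
  show "\<exists>N. \<forall>k\<ge>N. norm (b k * f (u k)) \<le> C * \<bar>f (u k)\<bar>"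
    using b by (auto simp: abs_mult intro!: mult_right_mono)
qed

lemma abs_suminf_mult_u_le:
  fixes f :: "'x \<Rightarrow>\<^sub>L real"
  assumes b: "\<And>k. \<bar>b k\<bar> \<le> C"
  shows "\<bar>\<Sum>k. b k * f (u k)\<bar> \<le> C * (\<Sum>k. \<bar>f (u k)\<bar>)"
proof -
  have le: "\<bar>b k * f (u k)\<bar> \<le> C * \<bar>f (u k)\<bar>" for k
    using b[of k] by (simp add: abs_mult mult_right_mono)
  note sm = summable_mult[OF summable_abs_u[of f], of C]
  have sm': "summable (\<lambda>k. \<bar>b k * f (u k)\<bar>)"
    by (rule summable_comparison_test[OF _ sm]) (use le in auto)
  have "\<bar>\<Sum>k. b k * f (u k)\<bar> \<le> (\<Sum>k. \<bar>b k * f (u k)\<bar>)" by (rule summable_rabs[OF sm'])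
  also have "\<dots> \<le> (\<Sum>k. C * \<bar>f (u k)\<bar>)" by (rule suminf_le[OF le sm' sm])
  also have "\<dots> = C * (\<Sum>k. \<bar>f (u k)\<bar>)" by (rule suminf_mult[OF summable_abs_u])
  finally show ?thesis .
qed

lemma linear_suminf_mult_u:
  assumes b: "\<And>k. \<bar>b k\<bar> \<le> C"
  shows "linear (\<lambda>f :: 'x \<Rightarrow>\<^sub>L real. \<Sum>k. b k * f (u k))"
proof (rule linearI)
  show "(\<Sum>k. b k * (f + g) (u k)) = (\<Sum>k. b k * f (u k)) + (\<Sum>k. b k * g (u k))"
    for f g :: "'x \<Rightarrow>\<^sub>L real"
    by (simp add: blinfun.add_left distrib_left suminf_add summable_mult_u[OF b])
  show "(\<Sum>k. b k * (r *\<^sub>R f) (u k)) = r *\<^sub>R (\<Sum>k. b k * f (u k))"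
    for r and f :: "'x \<Rightarrow>\<^sub>L real"
    using suminf_mult[OF summable_mult_u[OF b, where f = f], of r] by (simp add: blinfun.scaleR_left mult.left_commute)
qed

lemma suminf_mult_\<delta>_u: "(\<Sum>k. b k * \<delta> j (u k)) = b j"
proof -
  have "(\<lambda>k. b k * \<delta> j (u k)) = (\<lambda>k. if k = j then b k else 0)" by (auto simp: \<delta>_u)
  then show ?thesis using sums_unique[OF sums_single[of j b]] by simp
qed

text \<open>\<open>q\<close> is the l1 part followed by the quotient map from l1 onto c0 that sends
  the \<open>k\<close>-th unit vector to \<open>ternary k\<close>, and \<open>M\<close> is its
  kernel. A projection \<open>P\<close> that vanishes on \<open>M\<close> satisfies
  \<open>norm (P f) \<le> C * norm (q f)\<close>, so every unit vector in its range has l1 mass at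
  least \<open>1 / C\<close>. A sum of \<open>n\<close> almost disjoint blocks from the range then
  has norm at least \<open>n / (2 * C)\<close>, while its image under \<open>q\<close> has norm at
  most 3.\<close>

lemma not_superprojective_dual: "\<not> superprojective_space TYPE('x \<Rightarrow>\<^sub>L real)"
proof
  assume super: "superprojective_space TYPE('x \<Rightarrow>\<^sub>L real)"
  let ?Q = "\<lambda>j (f :: 'x \<Rightarrow>\<^sub>L real). \<Sum>k. ternary k j * f (u k)"
  have Q_le: "\<bar>?Q j f\<bar> \<le> (\<Sum>k. \<bar>f (u k)\<bar>)" for j f
    using abs_suminf_mult_u_le[of "\<lambda>k. ternary k j" 1 f] abs_ternary_le by simp
  obtain q :: "('x \<Rightarrow>\<^sub>L real) \<Rightarrow>\<^sub>L (nat \<Rightarrow>\<^sub>C real)" where q: "\<And>f j. apply_bcontfun (q f) j = ?Q j f"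
    "\<And>f. norm (q f) \<le> 1 * norm f"
  proof (rule linf_operator[of ?Q 1])
    show "linear (?Q j)" for j by (rule linear_suminf_mult_u) (rule abs_ternary_le)
    show "\<bar>?Q j f\<bar> \<le> 1 * norm f" for j f using Q_le[of j f] suminf_abs_u_le[of f] by simp
  qed (rule that)
  \<comment> \<open>The target type contains all bounded sequences; dominated convergence puts the
    values of \<open>q\<close> into c0, which makes the sets \<open>A\<close> and \<open>B\<close>
    below finite.\<close>
  have q_c0: "(\<lambda>j. apply_bcontfun (q f) j) \<longlonglongrightarrow> 0" for f
  proof -
    have "(\<lambda>j. \<Sum>k. ternary k j * f (u k)) \<longlonglongrightarrow> (\<Sum>k. 0)"
    proof (rule tannerys_theorem[where M = "\<lambda>k. \<bar>f (u k)\<bar>", THEN conjunct2, THEN conjunct2])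
      show "(\<lambda>j. ternary k j * f (u k)) \<longlonglongrightarrow> 0" for k
        by (intro tendsto_mult_left_zero ternary_tendsto_0)
      show "\<forall>\<^sub>F (k, j) in sequentially \<times>\<^sub>F sequentially. norm (ternary k j * f (u k)) \<le> \<bar>f (u k)\<bar>"
        using abs_ternary_le by (intro always_eventually) (auto simp: abs_mult mult_left_le_one_le)
    qed (use summable_abs_u in auto)
    then show ?thesis by (simp add: q)
  qed
  have q_\<delta>: "apply_bcontfun (q (\<delta> k)) j = ternary k j" for k j
    by (simp add: q suminf_mult_\<delta>_u)
  have lift: "\<exists>y. norm y \<le> 2 * 1 * norm (q f) \<and> q y = q f" for f
  proof (rule approximate_preimage[of 1 q f])
    fix f
    show "\<exists>y. norm y \<le> 1 * norm (q f) \<and> norm (q (f - y)) \<le> norm (q f) / 2"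
    proof (cases "q f = 0")
      case True
      then show ?thesis by (intro exI[of _ 0]) (simp add: blinfun.zero_right)
    next
      case False
      define t where "t = norm (q f)"
      have t: "0 < t" using False by (simp add: t_def)
      have le: "\<bar>apply_bcontfun (q f) j\<bar> \<le> t" for j
        using norm_bounded[of "q f" j] by (simp add: t_def)
      have "\<forall>\<^sub>F j in sequentially. \<bar>apply_bcontfun (q f) j\<bar> < t / 2"
        using tendstoD[OF q_c0, of "t / 2" f] t by (simp add: dist_real_def)
      then have fin: "finite {j. t / 2 \<le> \<bar>apply_bcontfun (q f) j\<bar>}"
        by (simp add: cofinite_eq_sequentially[symmetric] eventually_cofinite not_less)
      define A where "A = {j. t / 2 \<le> apply_bcontfun (q f) j}"
      define B where "B = {j. apply_bcontfun (q f) j \<le> - (t / 2)}"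
      have AB: "finite A" "finite B"
        unfolding A_def B_def by (auto intro: finite_subset[OF _ fin])
      define k where "k = prod_encode (set_encode A, set_encode B)"
      \<comment> \<open>Values between \<open>t / 2\<close> and \<open>t\<close> are moved into the
        interval from \<open>- t / 2\<close> to 0, negative ones symmetrically, and the others were
        below \<open>t / 2\<close> in modulus already.\<close>
      have "norm (q (f - t *\<^sub>R \<delta> k)) \<le> t / 2"
      proof (rule norm_bound)
        fix j
        have "apply_bcontfun (q (f - t *\<^sub>R \<delta> k)) j = apply_bcontfun (q f) j - t * (indicator A j - indicator B j)"
          by (simp add: blinfun.diff_right blinfun.scaleR_right minus_bcontfun.rep_eq scaleR_bcontfun.rep_eq
              q_\<delta> k_def ternary_code[OF AB])
        then show "norm (apply_bcontfun (q (f - t *\<^sub>R \<delta> k)) j) \<le> t / 2"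
          using le[of j] t by (auto simp: A_def B_def indicator_def)
      qed
      moreover have "norm (t *\<^sub>R \<delta> k) \<le> 1 * t"
        using t norm_scaleR_\<delta>_le[of t k] by simp
      ultimately show ?thesis unfolding t_def by blast
    qed
  qed blast
  define M where "M = {f. q f = 0}"
  have "subspace M"
    by (auto simp: M_def subspace_def blinfun.zero_right blinfun.add_right blinfun.scaleR_right)
  moreover have "closed M" unfolding M_def by (intro closed_Collect_eq continuous_intros)
  moreover have "infinite_codimensional M"
  proof (rule infinite_codimensional_biorthogonal[where g = "\<lambda>n f. apply_bcontfun (q f) n"
        and x = "\<lambda>m. \<delta> (prod_encode (set_encode {m}, set_encode {}))"])
    show "linear (\<lambda>f. apply_bcontfun (q f) n)" for n
      unfolding q by (rule linear_suminf_mult_u) (rule abs_ternary_le)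
    show "apply_bcontfun (q (\<delta> (prod_encode (set_encode {m}, set_encode {})))) n = (if n = m then 1 else 0)" for n m
      by (simp add: q_\<delta> ternary_code indicator_def del: set_encode_insert set_encode_empty)
  qed (simp add: M_def)
  ultimately obtain N' where N': "M \<subseteq> N'" "subspace N'" "infinite_codimensional N'" "complemented N'"
    using super unfolding superprojective_space_def by blast
  obtain P :: "('x \<Rightarrow>\<^sub>L real) \<Rightarrow>\<^sub>L ('x \<Rightarrow>\<^sub>L real)" where P: "\<And>f. P (P f) = P f" "\<And>f. f \<in> N' \<Longrightarrow> P f = 0"
    "subspace (range P)" "infinite_dimensional (range P)"
    by (rule infinite_codimensional_complement[OF N'(4,2,3)]) (rule that)
  \<comment> \<open>The factor 2 comes from lifting through \<open>q\<close>, and the summand 1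
    keeps \<open>C\<close> safe to divide by.\<close>
  define C where "C = 2 * norm P + 1"
  have C: "1 \<le> C" by (simp add: C_def)
  have P_le: "norm (P f) \<le> C * norm (q f)" for f
  proof -
    obtain y where y: "norm y \<le> 2 * 1 * norm (q f)" "q y = q f" using lift by blast
    then have "f - y \<in> N'" using N'(1) by (auto simp: M_def blinfun.diff_right)
    then have "P f = P y" using P(2)[of "f - y"] by (simp add: blinfun.diff_right)
    then have "norm (P f) \<le> norm P * norm y" using norm_blinfun[of P y] by simp
    also have "\<dots> \<le> norm P * (2 * norm (q f))" using y(1) by (intro mult_left_mono) auto
    also have "\<dots> \<le> C * norm (q f)" by (simp add: C_def algebra_simps)
    finally show ?thesis .
  qed
  \<comment> \<open>Blocks are separated both in the l1 coordinates of \<open>w\<close> and in the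
    c0 coordinates of \<open>q w\<close>. Below \<open>m\<close> both vanish exactly; beyond
    \<open>m'\<close> the l1 mass and the coordinates of \<open>q w\<close> are only small.\<close>
  let ?R = "\<lambda>n m w m'. m < m' \<and> w \<in> range P \<and> norm w = 1 \<and> (\<forall>k<m. w (u k) = 0) \<and>
    (\<forall>j<m. apply_bcontfun (q w) j = 0) \<and> (\<Sum>k. \<bar>w (u k)\<bar>) - (\<Sum>k<m'. \<bar>w (u k)\<bar>) \<le> 1 / (4 * C) \<and>
    (\<forall>j\<ge>m'. \<bar>apply_bcontfun (q w) j\<bar> \<le> (1 / 2) ^ n)"
  have step: "\<exists>w m'. ?R n m w m'" for n m :: nat
  proof -
    let ?h = "\<lambda>(i :: nat \<times> bool) w. if snd i then blinfun_apply w (u (fst i)) else apply_bcontfun (blinfun_apply q w) (fst i)"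
    obtain w :: "'x \<Rightarrow>\<^sub>L real" where w: "w \<in> range P" "norm w = 1"
      "\<And>i. i \<in> {..<m} \<times> {True, False} \<Longrightarrow> ?h i w = 0"
    proof (rule infinite_dimensional_unit_vector[OF _ P(3,4), of "{..<m} \<times> {True, False}" ?h])
      show "linear (?h i)" for i
        unfolding q by (cases "snd i")
          (simp_all add: linear_suminf_mult_u[OF abs_ternary_le] blinfun.bounded_linear_left bounded_linear.linear)
    qed auto
    have w0: "w (u k) = 0" "apply_bcontfun (q w) k = 0" if "k < m" for k
      using w(3)[of "(k, True)"] w(3)[of "(k, False)"] that by simp_all
    have "(\<lambda>m'. \<Sum>k<m'. \<bar>w (u k)\<bar>) \<longlonglongrightarrow> (\<Sum>k. \<bar>w (u k)\<bar>)"
      using summable_LIMSEQ[OF summable_abs_u[of w]] .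
    moreover have "(\<Sum>k. \<bar>w (u k)\<bar>) - 1 / (4 * C) < (\<Sum>k. \<bar>w (u k)\<bar>)" using C by simp
    ultimately have "\<forall>\<^sub>F m' in sequentially. (\<Sum>k. \<bar>w (u k)\<bar>) - 1 / (4 * C) < (\<Sum>k<m'. \<bar>w (u k)\<bar>)"
      by (rule order_tendstoD(1))
    then obtain m1 where m1: "\<And>m'. m' \<ge> m1 \<Longrightarrow> (\<Sum>k. \<bar>w (u k)\<bar>) - 1 / (4 * C) < (\<Sum>k<m'. \<bar>w (u k)\<bar>)"
      unfolding eventually_sequentially by blast
    obtain m2 where m2: "\<And>j. j \<ge> m2 \<Longrightarrow> \<bar>apply_bcontfun (q w) j\<bar> < (1 / 2) ^ n"
      using LIMSEQ_D[OF q_c0, of "(1 / 2) ^ n" w] by auto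
    have "(\<Sum>k. \<bar>w (u k)\<bar>) - 1 / (4 * C) < (\<Sum>k<max (Suc m) (max m1 m2). \<bar>w (u k)\<bar>)"
      by (rule m1) (simp add: le_max_iff_disj)
    then have "?R n m w (max (Suc m) (max m1 m2))"
      using w(1,2) w0 m2 by (auto simp: less_imp_le)
    then show ?thesis by blast
  qed
  obtain w m where "m 0 = 0" "\<And>n. ?R n (m n) (w n) (m (Suc n))"
    by (rule dependent_choice_sequence[where Q = ?R and ?s0.0 = 0, OF step]) (rule that)
  then have m0: "m 0 = 0" and m: "\<And>n. m n < m (Suc n)" and w: "\<And>n. w n \<in> range P" "\<And>n. norm (w n) = 1"
    "\<And>n k. k < m n \<Longrightarrow> w n (u k) = 0" "\<And>n j. j < m n \<Longrightarrow> apply_bcontfun (q (w n)) j = 0"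
    "\<And>n. (\<Sum>k. \<bar>w n (u k)\<bar>) - (\<Sum>k<m (Suc n). \<bar>w n (u k)\<bar>) \<le> 1 / (4 * C)"
    "\<And>n j. m (Suc n) \<le> j \<Longrightarrow> \<bar>apply_bcontfun (q (w n)) j\<bar> \<le> (1 / 2) ^ n"
    by auto
  have m_mono: "strict_mono m" using m by (simp add: strict_mono_Suc_iff)
  note disj = disjoint_consecutive_intervals[OF m_mono]
  let ?I = "\<lambda>l. {m l..<m (Suc l)}"
  define v where "v i = (\<Sum>k\<in>?I i. sgn (w i (u k)) *\<^sub>R u k)" for i
  have bound: "real n / (2 * C) \<le> 3 * C" for n
  proof -
    \<comment> \<open>On its own block \<open>w l\<close> contributes its l1 mass up to
      \<open>1 / (4 * C)\<close>, and the other sign vectors can cancel at most the mass outside,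
      again \<open>1 / (4 * C)\<close>; of the total mass, at least \<open>1 / C\<close>, half
      remains.\<close>
    have lower: "1 / (2 * C) \<le> w l (\<Sum>i<n. v i)" if l: "l < n" for l
    proof -
      let ?S = "\<Sum>k. \<bar>w l (u k)\<bar>" and ?s = "\<Sum>k\<in>?I l. \<bar>w l (u k)\<bar>"
      have "(\<Sum>k<m (Suc l). \<bar>w l (u k)\<bar>) = ?s"
        using w(3) by (intro sum.mono_neutral_right) auto
      then have s: "?S - ?s \<le> 1 / (4 * C)" using w(5)[of l] by simp
      have "1 \<le> C * ?S"
      proof -
        have "norm (w l) = norm (P (w l))" using w(1)[of l] P(1) by auto
        also have "\<dots> \<le> C * norm (q (w l))" by (rule P_le)
        also have "\<dots> \<le> C * ?S"
          using C Q_le[of _ "w l"] by (intro mult_left_mono norm_bound) (auto simp: q)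
        finally show ?thesis using w(2)[of l] by simp
      qed
      then have S: "1 / C \<le> ?S" using C by (simp add: divide_le_eq mult.commute)
      have "(\<Sum>i<n. \<Sum>k\<in>?I i. \<bar>w l (u k)\<bar>) = (\<Sum>k\<in>{m 0..<m n}. \<bar>w l (u k)\<bar>)"
        by (rule sum_consecutive_intervals[OF m_mono])
      also have "\<dots> \<le> ?S" by (intro sum_le_suminf summable_abs_u) auto
      finally have rest: "(\<Sum>i\<in>{..<n} - {l}. \<Sum>k\<in>?I i. \<bar>w l (u k)\<bar>) \<le> ?S - ?s"
        using l by (simp add: sum.remove[of "{..<n}" l])
      have "\<bar>w l (v i)\<bar> \<le> (\<Sum>k\<in>?I i. \<bar>w l (u k)\<bar>)" for i
      proof -
        have "w l (v i) = (\<Sum>k\<in>?I i. sgn (w i (u k)) * w l (u k))"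
          by (simp add: v_def blinfun.sum_right blinfun.scaleR_right)
        also have "\<bar>\<dots>\<bar> \<le> (\<Sum>k\<in>?I i. \<bar>w l (u k)\<bar>)"
          by (rule order_trans[OF sum_abs]) (intro sum_mono, auto simp: abs_mult sgn_if)
        finally show ?thesis .
      qed
      then have "\<bar>\<Sum>i\<in>{..<n} - {l}. w l (v i)\<bar> \<le> (\<Sum>i\<in>{..<n} - {l}. \<Sum>k\<in>?I i. \<bar>w l (u k)\<bar>)"
        by (intro order_trans[OF sum_abs] sum_mono)
      moreover have "w l (v l) = ?s"
        by (simp add: v_def blinfun.sum_right blinfun.scaleR_right abs_sgn mult.commute)
      moreover have "w l (\<Sum>i<n. v i) = w l (v l) + (\<Sum>i\<in>{..<n} - {l}. w l (v i))"
        using l by (simp add: blinfun.sum_right blinfun.add_right sum.remove[of "{..<n}" l])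
      ultimately have "?S - 2 * (1 / (4 * C)) \<le> w l (\<Sum>i<n. v i)"
        using rest s by linarith
      moreover have "1 / C - 2 * (1 / (4 * C)) = 1 / (2 * C)" using C by (simp add: field_simps)
      ultimately show ?thesis using S by linarith
    qed
    define W where "W = (\<Sum>l<n. w l)"
    have "real n / (2 * C) = (\<Sum>l<n. 1 / (2 * C))" by simp
    also have "\<dots> \<le> (\<Sum>l<n. w l (\<Sum>i<n. v i))" using lower by (intro sum_mono) auto
    also have "\<dots> = W (\<Sum>i<n. v i)" by (simp add: W_def blinfun.sum_left)
    also have "\<dots> \<le> norm W * norm (\<Sum>i<n. v i)" using norm_blinfun[of W "\<Sum>i<n. v i"] by simp
    also have "\<dots> \<le> norm W * 1"
    proof (rule mult_left_mono)
      have "norm (\<Sum>i<n. 1 *\<^sub>R v i) \<le> 1"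
        unfolding v_def by (rule norm_blocks_le[OF _ _ disj]) (auto simp: sgn_if)
      then show "norm (\<Sum>i<n. v i) \<le> 1" by simp
    qed simp
    also have "norm W = norm (P W)"
    proof -
      have "P (w l) = w l" for l using w(1)[of l] P(1) by auto
      then show ?thesis by (simp add: W_def blinfun.sum_right)
    qed
    also have "norm (P W) * 1 \<le> C * norm (q W)" using P_le by simp
    also have "\<dots> \<le> C * 3"
    proof (rule mult_left_mono[OF norm_bound])
      fix j
      \<comment> \<open>A coordinate lies in the main interval of at most one block, which
        contributes at most 1; the tails of the others add up to at most 2.\<close>
      have "\<bar>apply_bcontfun (q (w l)) j\<bar> \<le> (if j \<in> ?I l then 1 else 0) + (1 / 2) ^ l" for l
      proof (cases "j \<in> ?I l")
        case True
        have "\<bar>apply_bcontfun (q (w l)) j\<bar> \<le> 1"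
          using norm_bounded[of "q (w l)" j] q(2)[of "w l"] w(2)[of l] by simp
        then show ?thesis using True by (simp add: add_increasing2)
      next
        case False
        then consider "j < m l" | "m (Suc l) \<le> j" by force
        then show ?thesis by cases (use w(4,6) False in auto)
      qed
      then have "\<bar>apply_bcontfun (q W) j\<bar> \<le> (\<Sum>l<n. (if j \<in> ?I l then 1 else 0) + (1 / 2) ^ l)"
        unfolding W_def blinfun.sum_right apply_bcontfun_sum
        by (intro order_trans[OF sum_abs] sum_mono)
      also have "\<dots> = (\<Sum>l<n. if j \<in> ?I l then 1 else 0) + (\<Sum>l<n. (1 / 2) ^ l)"
        by (rule sum.distrib)
      also have "(\<Sum>l<n. if j \<in> ?I l then 1 else 0 :: real) \<le> 1"
        by (rule card_intervals_le_1[OF m_mono])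
      also have "(\<Sum>l<n. (1 / 2 :: real) ^ l) \<le> 2"
        by (simp add: sum_gp_strict)
      finally show "norm (apply_bcontfun (q W) j) \<le> 3" by simp
    qed (use C in simp)
    finally show ?thesis by (simp add: mult.commute)
  qed
  obtain n :: nat where "6 * C * C < n" using reals_Archimedean2 by blast
  then show False using bound[of n] C by (simp add: field_simps)
qed

end

section \<open>Rademacher functions on the natural numbers\<close>

text \<open>The number \<open>k\<close> codes in binary the set of indices that receive the sign -1.
  As \<open>k\<close> runs through \<open>{..<2 ^ n}\<close>, the first \<open>n\<close> values run
  exactly once through all sign patterns, so \<open>avg n\<close> is the expectation over
  \<open>n\<close> independent signs.\<close>

definition rad :: "nat \<Rightarrow> nat \<Rightarrow> real" where
  "rad i k = (if i \<in> set_decode k then -1 else 1)"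

definition avg :: "nat \<Rightarrow> (nat \<Rightarrow> real) \<Rightarrow> real" where
  "avg n F = (\<Sum>k<2 ^ n. F k) / 2 ^ n"

lemma rad_square [simp]: "rad i k * rad i k = 1" and abs_rad [simp]: "\<bar>rad i k\<bar> = 1"
  by (simp_all add: rad_def)

lemma rad_add_power: "i < n \<Longrightarrow> rad i (k + 2 ^ n) = rad i k"
proof -
  assume "i < n"
  then obtain d where d: "n = i + Suc d" using less_iff_Suc_add by auto
  have eq: "k + 2 ^ n = k + (2 * 2 ^ d) * 2 ^ i"
    by (simp add: d power_add mult.commute)
  have "(k + 2 ^ n) div 2 ^ i = 2 * 2 ^ d + k div 2 ^ i"
    unfolding eq by (rule div_mult_self1) simp
  then show ?thesis by (simp add: rad_def set_decode_def)
qed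

lemma rad_top: "k < 2 ^ n \<Longrightarrow> rad n k = 1" "k < 2 ^ n \<Longrightarrow> rad n (k + 2 ^ n) = - 1"
  by (simp_all add: rad_def set_decode_def)

lemma rad_eq_1: "k < 2 ^ n \<Longrightarrow> n \<le> i \<Longrightarrow> rad i k = 1"
  by (rule rad_top) (meson less_le_trans one_le_numeral power_increasing)

lemma avg_mono: "(\<And>k. F k \<le> G k) \<Longrightarrow> avg n F \<le> avg n G"
  by (simp add: avg_def divide_right_mono sum_mono)

lemma avg_add: "avg n (\<lambda>k. F k + G k) = avg n F + avg n G"
  by (simp add: avg_def sum.distrib add_divide_distrib)

lemma avg_diff: "avg n (\<lambda>k. F k - G k) = avg n F - avg n G"
  by (simp add: avg_def sum_subtractf diff_divide_distrib)

lemma avg_mult: "avg n (\<lambda>k. c * F k) = c * avg n F"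
  by (simp add: avg_def sum_distrib_left)

lemma avg_const [simp]: "avg n (\<lambda>k. c) = c"
  by (simp add: avg_def)

lemma avg_sum: "avg n (\<lambda>k. \<Sum>i\<in>I. F i k) = (\<Sum>i\<in>I. avg n (F i))"
  unfolding avg_def sum_divide_distrib[symmetric] by (subst sum.swap) simp

lemma abs_avg_le_avg: "(\<And>k. \<bar>F k\<bar> \<le> G k) \<Longrightarrow> \<bar>avg n F\<bar> \<le> avg n G"
  by (simp add: avg_def abs_divide) (intro divide_right_mono order_trans[OF sum_abs] sum_mono; simp)

lemma abs_avg_le: "(\<And>k. \<bar>F k\<bar> \<le> C) \<Longrightarrow> \<bar>avg n F\<bar> \<le> C"
  using abs_avg_le_avg[of F "\<lambda>_. C" n] by simp

lemma avg_nonneg: "(\<And>k. 0 \<le> F k) \<Longrightarrow> 0 \<le> avg n F"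
  by (simp add: avg_def sum_nonneg)

lemma avg_cong: "(\<And>k. k < 2 ^ n \<Longrightarrow> F k = G k) \<Longrightarrow> avg n F = avg n G"
  by (simp add: avg_def)

text \<open>Conditioning on the last sign: \<open>k\<close> and \<open>k + 2 ^ n\<close> carry the
  same first \<open>n\<close> signs and opposite signs at index \<open>n\<close>.\<close>

lemma avg_Suc: "avg (Suc n) F = avg n (\<lambda>k. (F k + F (k + 2 ^ n)) / 2)"
proof -
  have "(\<Sum>k<2 ^ Suc n. F k) = (\<Sum>k\<in>{0..<2 ^ n}. F k) + (\<Sum>k\<in>{2 ^ n..<2 ^ n + 2 ^ n}. F k)"
    by (simp add: sum.atLeastLessThan_concat lessThan_atLeast0 mult_2)
  also have "(\<Sum>k\<in>{2 ^ n..<2 ^ n + 2 ^ n}. F k) = (\<Sum>k\<in>{0..<2 ^ n}. F (k + 2 ^ n))"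
    using sum.shift_bounds_nat_ivl[of F 0 "2 ^ n" "2 ^ n"] by simp
  finally show ?thesis
    by (simp add: avg_def sum.distrib add_divide_distrib lessThan_atLeast0 sum_divide_distrib[symmetric])
qed

lemma rad_sum_Suc:
  assumes "k < 2 ^ n"
  shows "(\<Sum>i<Suc n. a i * rad i k) = (\<Sum>i<n. a i * rad i k) + a n"
    "(\<Sum>i<Suc n. a i * rad i (k + 2 ^ n)) = (\<Sum>i<n. a i * rad i k) - a n"
  using assms by (simp_all add: rad_top rad_add_power)

lemma rad_second_moment: "avg n (\<lambda>k. (\<Sum>i<n. a i * rad i k)\<^sup>2) = (\<Sum>i<n. (a i)\<^sup>2)"
proof (induction n)
  case (Suc n)
  have "avg (Suc n) (\<lambda>k. (\<Sum>i<Suc n. a i * rad i k)\<^sup>2) = avg n (\<lambda>k. (\<Sum>i<n. a i * rad i k)\<^sup>2 + (a n)\<^sup>2)"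
    unfolding avg_Suc
    by (rule avg_cong) (simp only: rad_sum_Suc, simp add: power2_eq_square field_simps)
  then show ?case by (simp add: avg_add Suc)
qed (simp add: avg_def)

text \<open>Averaging over the last sign kills the odd powers of \<open>a n\<close> and leaves the
  binomial coefficients 1, 6, 1. The constant 3 is what absorbs the middle one, as the mixed term of
  \<open>3 * (x + y)\<^sup>2\<close>.\<close>

lemma rad_fourth_moment: "avg n (\<lambda>k. (\<Sum>i<n. a i * rad i k) ^ 4) \<le> 3 * (\<Sum>i<n. (a i)\<^sup>2)\<^sup>2"
proof (induction n)
  case (Suc n)
  let ?A = "\<Sum>i<n. (a i)\<^sup>2"
  have "avg (Suc n) (\<lambda>k. (\<Sum>i<Suc n. a i * rad i k) ^ 4)
      = avg n (\<lambda>k. (\<Sum>i<n. a i * rad i k) ^ 4 + 6 * (a n)\<^sup>2 * (\<Sum>i<n. a i * rad i k)\<^sup>2 + (a n) ^ 4)"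
    unfolding avg_Suc
    by (rule avg_cong) (simp only: rad_sum_Suc, simp add: power2_eq_square power4_eq_xxxx field_simps)
  also have "\<dots> \<le> 3 * ?A\<^sup>2 + 6 * (a n)\<^sup>2 * ?A + (a n) ^ 4"
    using Suc by (simp add: avg_add avg_mult rad_second_moment)
  also have "\<dots> \<le> 3 * (?A + (a n)\<^sup>2)\<^sup>2"
  proof -
    have "3 * (?A + (a n)\<^sup>2)\<^sup>2 = 3 * ?A\<^sup>2 + 6 * (a n)\<^sup>2 * ?A + 3 * (a n) ^ 4"
      by (simp add: power2_eq_square power4_eq_xxxx algebra_simps)
    moreover have "0 \<le> (a n) ^ 4" by simp
    ultimately show ?thesis by linarith
  qed
  finally show ?case by simp
qed (simp add: avg_def)

text \<open>Polarization: the second moment formula is applied to the coefficient sequence that is 1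
  at \<open>i\<close> and \<open>j\<close>.\<close>

lemma rad_orthonormal:
  assumes "i < n" "j < n"
  shows "avg n (\<lambda>k. rad i k * rad j k) = (if i = j then 1 else 0)"
proof (cases "i = j")
  case False
  define a where "a l = (if l = i then 1 else 0 :: real) + (if l = j then 1 else 0)" for l
  have sum_a: "(\<Sum>l<n. a l * g l) = g i + g j" for g :: "nat \<Rightarrow> real"
    unfolding a_def distrib_right sum.distrib using assms by (simp add: if_distrib[of "\<lambda>x. x * _"] cong: if_cong)
  have "(\<Sum>l<n. (a l)\<^sup>2) = (\<Sum>l<n. a l * a l)" by (simp add: power2_eq_square)
  also have "\<dots> = 2" using False by (subst sum_a) (simp add: a_def)
  finally have "avg n (\<lambda>k. (rad i k + rad j k)\<^sup>2) = 2"
    using rad_second_moment[of n a] by (simp add: sum_a)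
  moreover have "(rad i k + rad j k)\<^sup>2 = 2 + 2 * (rad i k * rad j k)" for k
  proof -
    have "(rad i k + rad j k)\<^sup>2 = rad i k * rad i k + rad j k * rad j k + 2 * (rad i k * rad j k)"
      by (simp add: power2_eq_square algebra_simps del: rad_square)
    then show ?thesis by simp
  qed
  ultimately show ?thesis using False by (simp add: avg_add avg_mult)
qed simp

lemma rad_Bessel: "(\<Sum>i<n. (avg n (\<lambda>k. rad i k * G k))\<^sup>2) \<le> avg n (\<lambda>k. (G k)\<^sup>2)"
proof -
  define c where "c i = avg n (\<lambda>k. rad i k * G k)" for i
  let ?S = "\<lambda>k. \<Sum>i<n. c i * rad i k"
  have "0 \<le> avg n (\<lambda>k. (G k - ?S k)\<^sup>2)" by (rule avg_nonneg) simp
  also have "\<dots> = avg n (\<lambda>k. (G k)\<^sup>2 + (?S k)\<^sup>2 - 2 * (\<Sum>i<n. c i * (rad i k * G k)))"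
    by (rule avg_cong) (simp add: power2_diff sum_distrib_left sum_distrib_right ac_simps)
  also have "\<dots> = avg n (\<lambda>k. (G k)\<^sup>2) + (\<Sum>i<n. (c i)\<^sup>2) - 2 * (\<Sum>i<n. c i * c i)"
    unfolding avg_diff avg_add avg_mult avg_sum rad_second_moment c_def[symmetric] ..
  finally show ?thesis by (simp add: c_def power2_eq_square)
qed

definition clip :: "real \<Rightarrow> real \<Rightarrow> real" where
  "clip t x = max (- t) (min t x)"

lemma abs_clip_le: "0 \<le> t \<Longrightarrow> \<bar>clip t x\<bar> \<le> t"
  by (auto simp: clip_def)

text \<open>The error is 0 up to height \<open>t\<close>; beyond it the error is at most
  \<open>x\<^sup>2\<close>, and there \<open>x\<^sup>2\<close> is at least
  \<open>t\<^sup>2\<close>.\<close>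

lemma clip_error:
  assumes "0 < t"
  shows "(x - clip t x)\<^sup>2 \<le> x ^ 4 / t\<^sup>2"
proof (cases "\<bar>x\<bar> \<le> t")
  case True
  then have "clip t x = x" by (auto simp: clip_def)
  then show ?thesis by simp
next
  case False
  have "(x - clip t x)\<^sup>2 \<le> x\<^sup>2"
    unfolding abs_le_square_iff[symmetric] using False assms by (auto simp: clip_def)
  moreover have "t\<^sup>2 \<le> x\<^sup>2" unfolding abs_le_square_iff[symmetric] using False assms by simp
  then have "x\<^sup>2 * t\<^sup>2 \<le> x\<^sup>2 * x\<^sup>2" by (rule mult_left_mono) simp
  ultimately have "(x - clip t x)\<^sup>2 * t\<^sup>2 \<le> x\<^sup>2 * x\<^sup>2"
    by (meson mult_right_mono order_trans zero_le_power2)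
  then show ?thesis using assms by (simp add: le_divide_eq power4_eq_xxxx power2_eq_square ac_simps)
qed

text \<open>This exchanges a Rademacher sum, whose sup norm is uncontrolled, for a function bounded
  by \<open>t\<close>; the fourth moment makes the loss small in mean square.\<close>

lemma rad_clip_error:
  assumes t: "0 < t" and a: "(\<Sum>i<n. (a i)\<^sup>2) \<le> s\<^sup>2"
  shows "avg n (\<lambda>k. ((\<Sum>i<n. a i * rad i k) - clip t (\<Sum>i<n. a i * rad i k))\<^sup>2) \<le> 3 * s ^ 4 / t\<^sup>2"
proof -
  let ?F = "\<lambda>k. \<Sum>i<n. a i * rad i k"
  have "avg n (\<lambda>k. (?F k - clip t (?F k))\<^sup>2) \<le> avg n (\<lambda>k. (1 / t\<^sup>2) * (?F k) ^ 4)"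
    using clip_error[OF t] by (intro avg_mono) simp
  also have "\<dots> \<le> (1 / t\<^sup>2) * (3 * (\<Sum>i<n. (a i)\<^sup>2)\<^sup>2)"
    unfolding avg_mult by (intro mult_left_mono rad_fourth_moment) simp
  also have "\<dots> \<le> (1 / t\<^sup>2) * (3 * (s\<^sup>2)\<^sup>2)"
    using a by (intro mult_left_mono power_mono) (auto simp: sum_nonneg)
  finally show ?thesis by (simp add: power2_eq_square power4_eq_xxxx mult.assoc)
qed

section \<open>Spaces containing a complemented copy of bounded sequences\<close>

lemma abs_apply_bcontfun_le: "\<bar>apply_bcontfun (b :: nat \<Rightarrow>\<^sub>C real) k\<bar> \<le> norm b"
  using norm_bounded[of b k] by simp

text \<open>A form of the little Grothendieck inequality. If \<open>A\<close> is the best constant, then clipping the random sums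
  \<open>\<Sum>i. \<plusminus> v i\<close> at height \<open>4\<close> gives \<open>A \<le> 4 * C + A / 2\<close>.\<close>

lemma little_Grothendieck:
  fixes \<mu> :: "nat \<Rightarrow> (nat \<Rightarrow>\<^sub>C real) \<Rightarrow> real"
  assumes lin: "\<And>i. linear (\<mu> i)" and C: "\<And>b. (\<Sum>i<n. \<bar>\<mu> i b\<bar>) \<le> C * norm b"
    and v: "\<And>k. (\<Sum>i<n. (apply_bcontfun (v i) k)\<^sup>2) \<le> 1"
  shows "(\<Sum>i<n. \<mu> i (v i)) \<le> 8 * C"
proof -
  \<comment> \<open>The best constant is the supremum of \<open>?m\<close> over \<open>S\<close>. It
    is finite by the crude bound \<open>n * C\<close>, so half of it may be subtracted from both
    sides at the end.\<close>
  define S where "S = {v :: nat \<Rightarrow> nat \<Rightarrow>\<^sub>C real. \<forall>k. (\<Sum>i<n. (apply_bcontfun (v i) k)\<^sup>2) \<le> 1}"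
  let ?m = "\<lambda>v. \<Sum>i<n. \<mu> i (v i)"
  have C0: "0 \<le> C"
  proof -
    let ?b = "const_bcontfun 1 :: nat \<Rightarrow>\<^sub>C real"
    have "1 \<le> norm ?b"
      using norm_bounded[of ?b 0] by (simp add: const_bcontfun.rep_eq)
    moreover have "0 \<le> C * norm ?b"
      using order_trans[OF sum_nonneg C[of ?b]] by simp
    ultimately show ?thesis by (auto simp: zero_le_mult_iff)
  qed
  have "?m v \<le> real n * C" if "v \<in> S" for v
  proof -
    have "\<mu> i (v i) \<le> C" if i: "i < n" for i
    proof -
      have "norm (v i) \<le> 1"
      proof (rule norm_bound)
        fix k
        have "(apply_bcontfun (v i) k)\<^sup>2 \<le> (\<Sum>i<n. (apply_bcontfun (v i) k)\<^sup>2)"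
          using i by (intro member_le_sum) auto
        then have "(apply_bcontfun (v i) k)\<^sup>2 \<le> 1\<^sup>2"
          using \<open>v \<in> S\<close> by (auto simp: S_def intro: order_trans)
        then show "norm (apply_bcontfun (v i) k) \<le> 1" by (simp add: abs_square_le_1)
      qed
      have "\<mu> i (v i) \<le> \<bar>\<mu> i (v i)\<bar>" by simp
      also have "\<dots> \<le> (\<Sum>l<n. \<bar>\<mu> l (v i)\<bar>)"
        using i by (intro member_le_sum) auto
      also have "\<dots> \<le> C * norm (v i)" by (rule C)
      also have "\<dots> \<le> C" using C0 \<open>norm (v i) \<le> 1\<close> by (simp add: mult_left_le)
      finally show ?thesis .
    qed
    then show ?thesis using sum_mono[of "{..<n}" "\<lambda>i. \<mu> i (v i)" "\<lambda>_. C"] by simp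
  qed
  then have bdd: "bdd_above (?m ` S)" by (intro bdd_aboveI2)
  have improve: "?m v \<le> 4 * C + Sup (?m ` S) / 2" if vS: "v \<in> S" for v
  proof -
    \<comment> \<open>\<open>s\<close> codes a choice of signs, \<open>G s\<close> is the clipped
      signed sum, and \<open>v' i\<close> is the \<open>i\<close>-th Rademacher coefficient of
      \<open>G\<close>.\<close>
    define F where "F s = (\<Sum>i<n. rad i s *\<^sub>R v i)" for s
    define G where "G s = Bcontfun (\<lambda>k. clip 4 (apply_bcontfun (F s) k))" for s
    have F: "apply_bcontfun (F s) k = (\<Sum>i<n. apply_bcontfun (v i) k * rad i s)" for s k
      by (simp add: F_def apply_bcontfun_sum scaleR_bcontfun.rep_eq mult.commute)
    have G: "apply_bcontfun (G s) k = clip 4 (apply_bcontfun (F s) k)" for s k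
      unfolding G_def by (subst apply_bcontfun_discrete[of _ 4]) (simp_all add: abs_clip_le)
    have G_norm: "norm (G s) \<le> 4" for s by (rule norm_bound) (simp add: G abs_clip_le)
    define v' where "v' i = (1 / 2 ^ n) *\<^sub>R (\<Sum>s<2 ^ n. rad i s *\<^sub>R G s)" for i
    have v': "apply_bcontfun (v' i) k = avg n (\<lambda>s. rad i s * apply_bcontfun (G s) k)" for i k
      by (simp add: v'_def avg_def apply_bcontfun_sum scaleR_bcontfun.rep_eq)
    \<comment> \<open>By orthonormality \<open>v i - v' i\<close> is a Rademacher coefficient of the
      clipping error, whose mean square is at most 3/16. Doubling multiplies this by 4 and stays
      below 1, so the remainder returns to \<open>S\<close> with a gain of 2.\<close>
    have "(\<lambda>i. 2 *\<^sub>R (v i - v' i)) \<in> S"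
      unfolding S_def mem_Collect_eq
    proof (rule allI)
      fix k
      let ?D = "\<lambda>s. apply_bcontfun (F s) k - apply_bcontfun (G s) k"
      have diff: "apply_bcontfun (v i) k - apply_bcontfun (v' i) k = avg n (\<lambda>s. rad i s * ?D s)" if i: "i < n" for i
      proof -
        have "avg n (\<lambda>s. rad i s * apply_bcontfun (F s) k)
            = avg n (\<lambda>s. \<Sum>l<n. apply_bcontfun (v l) k * (rad i s * rad l s))"
          by (rule avg_cong) (simp add: F sum_distrib_left ac_simps)
        also have "\<dots> = (\<Sum>l<n. apply_bcontfun (v l) k * (if i = l then 1 else 0))"
          unfolding avg_sum avg_mult using rad_orthonormal[OF i] by (intro sum.cong) auto
        also have "\<dots> = apply_bcontfun (v i) k" using i by (simp add: if_distrib cong: if_cong)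
        finally show ?thesis by (simp add: v' right_diff_distrib avg_diff)
      qed
      have "(\<Sum>i<n. (apply_bcontfun (v i) k - apply_bcontfun (v' i) k)\<^sup>2) = (\<Sum>i<n. (avg n (\<lambda>s. rad i s * ?D s))\<^sup>2)"
        by (intro sum.cong) (auto simp: diff)
      also have "\<dots> \<le> avg n (\<lambda>s. (?D s)\<^sup>2)" by (rule rad_Bessel)
      also have "\<dots> \<le> 3 * 1 ^ 4 / 4\<^sup>2"
        unfolding G F using vS by (intro rad_clip_error) (auto simp: S_def)
      finally have "4 * (\<Sum>i<n. (apply_bcontfun (v i) k - apply_bcontfun (v' i) k)\<^sup>2) \<le> 1" by simp
      moreover have "(apply_bcontfun (2 *\<^sub>R (v i - v' i)) k)\<^sup>2
          = 4 * (apply_bcontfun (v i) k - apply_bcontfun (v' i) k)\<^sup>2" for i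
        by (simp add: scaleR_bcontfun.rep_eq minus_bcontfun.rep_eq power2_eq_square algebra_simps)
      ultimately show "(\<Sum>i<n. (apply_bcontfun (2 *\<^sub>R (v i - v' i)) k)\<^sup>2) \<le> 1"
        by (simp only: sum_distrib_left)
    qed
    then have "?m (\<lambda>i. 2 *\<^sub>R (v i - v' i)) \<le> Sup (?m ` S)" by (intro cSup_upper bdd) auto
    moreover have "?m (\<lambda>i. 2 *\<^sub>R (v i - v' i)) = 2 * ?m v - 2 * ?m v'"
      by (simp add: linear_scale[OF lin] linear_diff[OF lin] sum_subtractf sum_distrib_left[symmetric] right_diff_distrib)
    \<comment> \<open>Linearity moves the average outside, and for each sign pattern the sum is at
      most \<open>C\<close> times the norm of \<open>G s\<close>.\<close>
    moreover have "?m v' \<le> 4 * C"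
    proof -
      have "?m v' = avg n (\<lambda>s. \<Sum>i<n. rad i s * \<mu> i (G s))"
        by (simp add: v'_def linear_scale[OF lin] linear_sum[OF lin] avg_sum avg_def)
      also have "\<dots> \<le> avg n (\<lambda>_. 4 * C)"
      proof (rule avg_mono)
        fix s
        have "(\<Sum>i<n. rad i s * \<mu> i (G s)) \<le> (\<Sum>i<n. \<bar>\<mu> i (G s)\<bar>)"
          by (intro sum_mono) (auto simp: rad_def)
        also have "\<dots> \<le> C * norm (G s)" by (rule C)
        also have "\<dots> \<le> C * 4" by (intro mult_left_mono G_norm C0)
        finally show "(\<Sum>i<n. rad i s * \<mu> i (G s)) \<le> 4 * C" by simp
      qed
      finally show ?thesis by simp
    qed
    ultimately show ?thesis by linarith
  qed
  have vS: "v \<in> S" using v by (simp add: S_def)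
  then have "Sup (?m ` S) \<le> 4 * C + Sup (?m ` S) / 2"
    using improve by (intro cSup_least) auto
  moreover have "?m v \<le> Sup (?m ` S)" using vS by (intro cSup_upper bdd) auto
  ultimately show ?thesis by linarith
qed

definition rad_seq :: "nat \<Rightarrow> nat \<Rightarrow>\<^sub>C real" where
  "rad_seq j = Bcontfun (rad j)"

lemma rad_seq: "apply_bcontfun (rad_seq j) = rad j"
  unfolding rad_seq_def by (rule apply_bcontfun_discrete[of _ 1]) simp

lemma norm_rad_seq_le: "norm (rad_seq j) \<le> 1"
  by (rule norm_bound) (simp add: rad_seq)

lemma subspace_closure:
  fixes S :: "'a::real_normed_vector set"
  assumes S: "subspace S"
  shows "subspace (closure S)"
proof (rule subspaceI)
  show "0 \<in> closure S" using subspace_0[OF S] closure_subset by blast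
next
  fix x y assume "x \<in> closure S" "y \<in> closure S"
  then obtain a b where ab: "\<And>n. a n \<in> S" "a \<longlonglongrightarrow> x" "\<And>n. b n \<in> S" "b \<longlonglongrightarrow> y"
    unfolding closure_sequential by blast
  then have "\<And>n. a n + b n \<in> S" "(\<lambda>n. a n + b n) \<longlonglongrightarrow> x + y"
    using S by (simp_all add: subspace_add tendsto_add)
  then show "x + y \<in> closure S"
    unfolding closure_sequential by (intro exI[of _ "\<lambda>n. a n + b n"]) simp
next
  fix c :: real and x assume "x \<in> closure S"
  then obtain a where a: "\<And>n. a n \<in> S" "a \<longlonglongrightarrow> x"
    unfolding closure_sequential by blast
  then have "\<And>n. c *\<^sub>R a n \<in> S" "(\<lambda>n. c *\<^sub>R a n) \<longlonglongrightarrow> c *\<^sub>R x"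
    using S by (simp_all add: subspace_scale tendsto_scaleR)
  then show "c *\<^sub>R x \<in> closure S"
    unfolding closure_sequential by (intro exI[of _ "\<lambda>n. c *\<^sub>R a n"]) simp
qed

text \<open>\<open>L\<close> is isometric, since
  \<open>norm b = norm (T (L b)) \<le> norm (L b)\<close>, and \<open>T\<close> followed by
  \<open>L\<close> is a projection of norm at most 1 onto the copy.\<close>

locale linf_copy =
  fixes L :: "(nat \<Rightarrow>\<^sub>C real) \<Rightarrow>\<^sub>L 'z::banach" and T :: "'z \<Rightarrow>\<^sub>L (nat \<Rightarrow>\<^sub>C real)"
  assumes TL: "T (L b) = b" and norm_L_le: "norm (L b) \<le> norm b" and norm_T_le: "norm (T z) \<le> norm z"
begin

abbreviation coord :: "'z \<Rightarrow> nat \<Rightarrow> real" where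
  "coord z k \<equiv> apply_bcontfun (T z) k"

lemma abs_coord_le: "\<bar>coord z k\<bar> \<le> norm z"
  using abs_apply_bcontfun_le[of "T z" k] norm_T_le[of z] by linarith

lemma coord_linear: "linear (\<lambda>z. coord z k)"
  by (rule linearI) (simp_all add: blinfun.add_right blinfun.scaleR_right plus_bcontfun.rep_eq scaleR_bcontfun.rep_eq)

lemma coord_sum: "coord (\<Sum>i\<in>I. a i *\<^sub>R z i) k = (\<Sum>i\<in>I. a i * coord (z i) k)"
  by (simp add: linear_sum[OF coord_linear] linear_scale[OF coord_linear])

text \<open>The closed span of the Rademacher sequences is isometric to \<open>\<ell>\<^sub>1\<close>, with coordinates \<open>rad_coeff j\<close>.\<close>

definition rad_coeff :: "nat \<Rightarrow> 'z \<Rightarrow> real" where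
  "rad_coeff j z = avg (Suc j) (\<lambda>k. rad j k * coord z k)"

lemma linear_rad_coeff: "linear (rad_coeff j)"
  by (rule linearI)
    (simp_all add: rad_coeff_def linear_add[OF coord_linear] linear_scale[OF coord_linear]
      distrib_left avg_add mult.left_commute[of "rad j _"] avg_mult)

lemma abs_rad_coeff_le: "\<bar>rad_coeff j z\<bar> \<le> norm z"
  unfolding rad_coeff_def by (rule abs_avg_le) (simp add: abs_mult abs_coord_le)

lemma continuous_rad_coeff: "continuous_on UNIV (rad_coeff j)"
  using linear_rad_coeff abs_rad_coeff_le
  by (intro linear_continuous_on bounded_linear_intro[where K = 1])
    (auto simp: linear_add linear_scale)

text \<open>An average over \<open>2 ^ Suc j\<close> points suffices even for \<open>i > j\<close>:
  later Rademacher functions are constantly 1 there, and \<open>rad j\<close> has mean 0.\<close>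

lemma rad_coeff_rad: "rad_coeff j (L (rad_seq i)) = (if i = j then 1 else 0)"
proof (cases "i \<le> j")
  case True
  then show ?thesis
    using rad_orthonormal[of j "Suc j" i] by (auto simp: rad_coeff_def TL rad_seq)
next
  case False
  have "rad_coeff j (L (rad_seq i)) = avg (Suc j) (rad j)"
    unfolding rad_coeff_def TL rad_seq using False rad_eq_1[of _ "Suc j" i] by (intro avg_cong) simp
  also have "\<dots> = avg j (\<lambda>_. 0)"
    unfolding avg_Suc by (rule avg_cong) (simp add: rad_top)
  finally show ?thesis using False by simp
qed

definition l1_copy :: "'z set" where
  "l1_copy = closure (span (range (\<lambda>j. L (rad_seq j))))"

lemma subspace_l1_copy: "subspace l1_copy"
  unfolding l1_copy_def by (intro subspace_closure subspace_span)

lemma closed_l1_copy: "closed l1_copy"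
  by (simp add: l1_copy_def)

lemma L_coord_l1_copy: "z \<in> l1_copy \<Longrightarrow> L (T z) = z"
proof -
  have "l1_copy \<subseteq> {z. L (T z) = z}"
    unfolding l1_copy_def
  proof (rule closure_minimal)
    show "span (range (\<lambda>j. L (rad_seq j))) \<subseteq> {z. L (T z) = z}"
      by (rule span_minimal) (auto simp: TL subspace_def blinfun.zero_right blinfun.add_right blinfun.scaleR_right)
    show "closed {z. L (T z) = z}" by (intro closed_Collect_eq continuous_intros)
  qed
  then show "z \<in> l1_copy \<Longrightarrow> L (T z) = z" by blast
qed

lemma rad_coeff_finite_sum:
  assumes "finite A"
  shows "rad_coeff j (\<Sum>i\<in>A. a i *\<^sub>R L (rad_seq i)) = (if j \<in> A then a j else 0)"
  using assms by (simp add: linear_sum[OF linear_rad_coeff] linear_scale[OF linear_rad_coeff] rad_coeff_rad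
      if_distrib sum.delta cong: if_cong)

lemma sum_abs_rad_coeff_le:
  assumes "z \<in> l1_copy"
  shows "(\<Sum>j<n. \<bar>rad_coeff j z\<bar>) \<le> norm z"
proof -
  have "l1_copy \<subseteq> {z. (\<Sum>j<n. \<bar>rad_coeff j z\<bar>) \<le> norm z}"
    unfolding l1_copy_def
  proof (rule closure_minimal)
    show "span (range (\<lambda>j. L (rad_seq j))) \<subseteq> {z. (\<Sum>j<n. \<bar>rad_coeff j z\<bar>) \<le> norm z}"
    proof
      fix y assume "y \<in> span (range (\<lambda>j. L (rad_seq j)))"
      then obtain A a where A: "finite A" "y = (\<Sum>i\<in>A. a i *\<^sub>R L (rad_seq i))" by (rule span_rangeE)
      \<comment> \<open>This coordinate codes exactly the indices with negative coefficient, so no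
        cancellation occurs and the l1 norm is attained as a coordinate.\<close>
      define k where "k = set_encode {i \<in> A. a i < 0}"
      have "a i * rad i k = \<bar>a i\<bar>" if "i \<in> A" for i
        using that A(1) by (auto simp: rad_def k_def)
      then have "(\<Sum>i\<in>A. \<bar>a i\<bar>) = coord y k"
        unfolding A(2) coord_sum TL rad_seq by (intro sum.cong) auto
      also have "\<dots> \<le> norm y" using abs_coord_le[of y k] by simp
      finally have "(\<Sum>i\<in>A. \<bar>a i\<bar>) \<le> norm y" .
      moreover have "(\<Sum>j<n. \<bar>rad_coeff j y\<bar>) = (\<Sum>j\<in>{..<n} \<inter> A. \<bar>a j\<bar>)"
        unfolding A(2) rad_coeff_finite_sum[OF A(1)] by (intro sum.mono_neutral_cong_right) auto
      moreover have "\<dots> \<le> (\<Sum>j\<in>A. \<bar>a j\<bar>)" using A(1) by (intro sum_mono2) auto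
      ultimately show "y \<in> {z. (\<Sum>j<n. \<bar>rad_coeff j z\<bar>) \<le> norm z}" by simp
    qed
    show "closed {z. (\<Sum>j<n. \<bar>rad_coeff j z\<bar>) \<le> norm z}"
      by (intro closed_Collect_le continuous_intros continuous_rad_coeff)
  qed
  then show ?thesis using assms by blast
qed

text \<open>Approximation within 1/4 by a finite combination changes the norm by at most 1/4 and the
  l1 sum of the coefficients by at most 1/4, which leaves 1/2.\<close>

lemma sum_abs_rad_coeff_lower:
  assumes w: "w \<in> l1_copy" "norm w = 1"
  obtains m' where "m < m'" "1 / 2 \<le> (\<Sum>j<m'. \<bar>rad_coeff j w\<bar>)"
proof -
  obtain y where y: "y \<in> span (range (\<lambda>j. L (rad_seq j)))" "dist y w < 1 / 4"
    using w(1) closure_approachable[of w "span (range (\<lambda>j. L (rad_seq j)))"]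
    unfolding l1_copy_def by (metis zero_less_divide_1_iff zero_less_numeral)
  have "y \<in> l1_copy" using y(1) closure_subset unfolding l1_copy_def by blast
  then have yw: "y - w \<in> l1_copy" using subspace_l1_copy w(1) by (simp add: subspace_diff)
  obtain A a where A: "finite A" "y = (\<Sum>i\<in>A. a i *\<^sub>R L (rad_seq i))" using span_rangeE[OF y(1)] .
  obtain m' where m': "A \<subseteq> {..<m'}" "m < m'"
    using A(1) finite_nat_set_iff_bounded[of "insert m A"] by auto
  have "norm y \<le> (\<Sum>i\<in>A. \<bar>a i\<bar>)"
    unfolding A(2)
  proof (rule sum_norm_le)
    fix i
    have "norm (L (rad_seq i)) \<le> 1" using norm_L_le[of "rad_seq i"] norm_rad_seq_le[of i] by linarith
    then show "norm (a i *\<^sub>R L (rad_seq i)) \<le> \<bar>a i\<bar>" using mult_left_mono[of _ 1 "\<bar>a i\<bar>"] by simp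
  qed
  also have "\<dots> = (\<Sum>j<m'. \<bar>rad_coeff j y\<bar>)"
    unfolding A(2) rad_coeff_finite_sum[OF A(1)] using m' by (intro sum.mono_neutral_cong_left) auto
  also have "\<dots> \<le> (\<Sum>j<m'. \<bar>rad_coeff j w\<bar> + \<bar>rad_coeff j (y - w)\<bar>)"
    by (intro sum_mono) (simp add: linear_diff[OF linear_rad_coeff])
  also have "\<dots> \<le> (\<Sum>j<m'. \<bar>rad_coeff j w\<bar>) + norm (y - w)"
    unfolding sum.distrib using sum_abs_rad_coeff_le[OF yw] by simp
  finally have "norm y \<le> (\<Sum>j<m'. \<bar>rad_coeff j w\<bar>) + norm (y - w)" .
  moreover have "norm w - norm (y - w) \<le> norm y"
    using norm_triangle_ineq2[of w "w - y"] by (simp add: norm_minus_commute)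
  ultimately have "1 / 2 \<le> (\<Sum>j<m'. \<bar>rad_coeff j w\<bar>)"
    using w(2) y(2) by (simp add: dist_norm)
  then show ?thesis using that m'(2) by blast
qed

text \<open>Suppose \<open>P\<close> projects onto \<open>N\<close> inside the l1 copy. Signed sums
  of Rademacher coefficients of \<open>P (L b)\<close> over disjoint intervals are functionals
  \<open>\<mu> i\<close> with absolute values summing to at most \<open>norm P * norm b\<close>, and
  \<open>n\<close> block vectors divided by \<open>sqrt n\<close> have square function at most 1.
  The little Grothendieck inequality bounds the sum of the pairings by \<open>8 * norm P\<close>,
  whereas each pairing is at least \<open>1 / (2 * sqrt n)\<close>.\<close>

lemma not_subprojective_linf_copy: "\<not> subprojective_space TYPE('z)"
proof
  assume sub: "subprojective_space TYPE('z)"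
  have "infinite_dimensional l1_copy"
  proof (rule infinite_dimensional_biorthogonal[where x = "\<lambda>j. L (rad_seq j)" and g = rad_coeff])
    show "L (rad_seq n) \<in> l1_copy" for n
      unfolding l1_copy_def by (rule subsetD[OF closure_subset]) (simp add: span_base)
  qed (auto simp: rad_coeff_rad linear_rad_coeff)
  then obtain N where N: "N \<subseteq> l1_copy" "subspace N" "infinite_dimensional N" "complemented N"
    using sub subspace_l1_copy closed_l1_copy unfolding subprojective_space_def by blast
  obtain P :: "'z \<Rightarrow>\<^sub>L 'z" where P: "\<And>z. P (P z) = P z" "range P = N"
    using N(4) unfolding complemented_def by blast
  let ?R = "\<lambda>n m w m'. m < m' \<and> w \<in> N \<and> norm w = 1 \<and> 1 / 2 \<le> (\<Sum>j\<in>{m..<m'}. \<bar>rad_coeff j w\<bar>)"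
  have step: "\<exists>w m'. ?R n m w m'" for n m :: nat
  proof -
    obtain w where w: "w \<in> N" "norm w = 1" "\<And>j. j \<in> {..<m} \<Longrightarrow> rad_coeff j w = 0"
      using infinite_dimensional_unit_vector[OF _ N(2,3), of "{..<m}" rad_coeff] linear_rad_coeff by blast
    obtain m' where m': "m < m'" "1 / 2 \<le> (\<Sum>j<m'. \<bar>rad_coeff j w\<bar>)"
      using sum_abs_rad_coeff_lower[of w m] w(1,2) N(1) by blast
    have "(\<Sum>j<m'. \<bar>rad_coeff j w\<bar>) = (\<Sum>j\<in>{m..<m'}. \<bar>rad_coeff j w\<bar>)"
      using w(3) by (intro sum.mono_neutral_right) auto
    then show ?thesis using w m' by (intro exI[of _ w] exI[of _ m']) simp
  qed
  obtain w m where "m 0 = 0" "\<And>n. ?R n (m n) (w n) (m (Suc n))"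
    by (rule dependent_choice_sequence[where Q = ?R and ?s0.0 = 0, OF step]) (rule that)
  then have m: "m 0 = 0" "\<And>n. m n < m (Suc n)" and w: "\<And>n. w n \<in> N" "\<And>n. norm (w n) = 1"
    "\<And>n. 1 / 2 \<le> (\<Sum>j\<in>{m n..<m (Suc n)}. \<bar>rad_coeff j (w n)\<bar>)"
    by auto
  have m_mono: "strict_mono m" using m(2) by (simp add: strict_mono_Suc_iff)
  define \<mu> where "\<mu> i b = (\<Sum>j\<in>{m i..<m (Suc i)}. sgn (rad_coeff j (w i)) * rad_coeff j (P (L b)))" for i b
  have bound: "sqrt (real n) \<le> 16 * norm P" for n
  proof (cases "n = 0")
    case False
    define v where "v i = (1 / sqrt (real n)) *\<^sub>R T (w i)" for i
    have "(\<Sum>i<n. \<mu> i (v i)) \<le> 8 * norm P"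
    proof (rule little_Grothendieck)
      show "linear (\<mu> i)" for i
        unfolding \<mu>_def
        by (intro linear_compose_sum ballI linearI)
          (simp_all add: blinfun.add_right blinfun.scaleR_right linear_add[OF linear_rad_coeff]
            linear_scale[OF linear_rad_coeff] distrib_left)
      show "(\<Sum>i<n. \<bar>\<mu> i b\<bar>) \<le> norm P * norm b" for b
      proof -
        have "\<bar>\<mu> i b\<bar> \<le> (\<Sum>j\<in>{m i..<m (Suc i)}. \<bar>rad_coeff j (P (L b))\<bar>)" for i
          unfolding \<mu>_def by (rule order_trans[OF sum_abs]) (intro sum_mono, auto simp: abs_mult sgn_if)
        then have "(\<Sum>i<n. \<bar>\<mu> i b\<bar>) \<le> (\<Sum>i<n. \<Sum>j\<in>{m i..<m (Suc i)}. \<bar>rad_coeff j (P (L b))\<bar>)"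
          by (rule sum_mono)
        also have "\<dots> = (\<Sum>j<m n. \<bar>rad_coeff j (P (L b))\<bar>)"
          unfolding sum_consecutive_intervals[OF m_mono] m(1) by (simp add: lessThan_atLeast0)
        also have "\<dots> \<le> norm (P (L b))"
          using P(2) N(1) by (intro sum_abs_rad_coeff_le) blast
        also have "\<dots> \<le> norm P * norm (L b)" by (rule norm_blinfun)
        also have "\<dots> \<le> norm P * norm b" by (intro mult_left_mono norm_L_le) simp
        finally show ?thesis .
      qed
      show "(\<Sum>i<n. (apply_bcontfun (v i) k)\<^sup>2) \<le> 1" for k
      proof -
        have "(apply_bcontfun (v i) k)\<^sup>2 \<le> 1 / real n" for i
        proof -
          have "\<bar>coord (w i) k\<bar> \<le> 1" using abs_coord_le[of "w i" k] w(2)[of i] by simp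
          then have "(coord (w i) k)\<^sup>2 \<le> 1" by (simp add: abs_square_le_1)
          then show ?thesis
            by (simp add: v_def scaleR_bcontfun.rep_eq power_divide divide_right_mono)
        qed
        then have "(\<Sum>i<n. (apply_bcontfun (v i) k)\<^sup>2) \<le> (\<Sum>i<n. 1 / real n)" by (rule sum_mono)
        then show ?thesis using False by simp
      qed
    qed
    moreover have "\<mu> i (v i) \<ge> (1 / sqrt (real n)) * (1 / 2)" for i
    proof -
      have "P (L (T (w i))) = w i"
        using L_coord_l1_copy[of "w i"] w(1)[of i] N(1) P by fastforce
      then have "\<mu> i (v i) = (1 / sqrt (real n)) * (\<Sum>j\<in>{m i..<m (Suc i)}. \<bar>rad_coeff j (w i)\<bar>)"
        unfolding \<mu>_def v_def blinfun.scaleR_right linear_scale[OF linear_rad_coeff] sum_distrib_left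
        by (intro sum.cong) (auto simp: abs_sgn)
      then show ?thesis using mult_left_mono[OF w(3)[of i], of "1 / sqrt (real n)"] by simp
    qed
    then have "(\<Sum>i<n. (1 / sqrt (real n)) * (1 / 2)) \<le> (\<Sum>i<n. \<mu> i (v i))" by (intro sum_mono)
    moreover have "(\<Sum>i<n. (1 / sqrt (real n)) * (1 / 2)) = sqrt (real n) / 2"
      using False by (simp add: real_div_sqrt field_simps)
    ultimately show ?thesis by linarith
  qed simp
  obtain n :: nat where n: "(16 * norm P)\<^sup>2 < real n" using reals_Archimedean2 by blast
  then have "16 * norm P < sqrt (real n)" by (rule real_less_rsqrt)
  then show False using bound[of n] by simp
qed

end

section \<open>Generalized limits of bounded sequences\<close>

lemma subspace_c0: "subspace c0"
proof (rule subspaceI)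
  show "0 \<in> c0" by (simp add: c0_def zero_bcontfun.rep_eq)
  show "x + y \<in> c0" if "x \<in> c0" "y \<in> c0" for x y
    using that tendsto_add[of "apply_bcontfun x" 0 sequentially "apply_bcontfun y" 0]
    by (simp add: c0_def plus_bcontfun.rep_eq)
  show "c *\<^sub>R x \<in> c0" if "x \<in> c0" for c x
    using that tendsto_mult_right_zero[of "apply_bcontfun x" sequentially c]
    by (simp add: c0_def scaleR_bcontfun.rep_eq)
qed

definition generalized_limit :: "((nat \<Rightarrow>\<^sub>C real) \<Rightarrow>\<^sub>L real) \<Rightarrow> bool" where
  "generalized_limit \<Lambda> \<longleftrightarrow>
     (\<forall>b C n0. 0 \<le> C \<longrightarrow> (\<forall>k\<ge>n0. \<bar>apply_bcontfun b k\<bar> \<le> C) \<longrightarrow> \<bar>\<Lambda> b\<bar> \<le> C) \<and>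
     (\<forall>b c n0. (\<forall>k\<ge>n0. apply_bcontfun b k = c) \<longrightarrow> \<Lambda> b = c)"

text \<open>Hahn-Banach for the distance to c0, attained at the constant sequence 1. This distance
  is at most any bound valid on a tail, because the initial segment belongs to c0.\<close>

lemma ex_generalized_limit: "\<exists>\<Lambda>. generalized_limit \<Lambda>"
proof -
  let ?one = "const_bcontfun 1 :: nat \<Rightarrow>\<^sub>C real"
  obtain \<Lambda> :: "(nat \<Rightarrow>\<^sub>C real) \<Rightarrow>\<^sub>L real" where \<Lambda>: "\<And>b. \<Lambda> b \<le> infdist b c0" "\<Lambda> ?one = infdist ?one c0"
    using Hahn_Banach_infdist[OF subspace_c0] by blast
  have inf_le: "infdist b c0 \<le> C" if "0 \<le> C" "\<And>k. n0 \<le> k \<Longrightarrow> \<bar>apply_bcontfun b k\<bar> \<le> C" for b C n0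
  proof -
    let ?a = "\<lambda>k. if k < n0 then apply_bcontfun b k else 0"
    have a: "apply_bcontfun (Bcontfun ?a) = ?a"
      using abs_apply_bcontfun_le[of b] by (intro apply_bcontfun_discrete[of _ "norm b"]) auto
    have "(\<lambda>k. ?a k) \<longlonglongrightarrow> 0"
      by (rule tendsto_eventually) (auto simp: eventually_sequentially intro!: exI[of _ n0])
    then have "Bcontfun ?a \<in> c0" by (simp add: c0_def a)
    then have "infdist b c0 \<le> norm (b - Bcontfun ?a)"
      using infdist_le[of "Bcontfun ?a" c0 b] by (simp add: dist_norm)
    also have "\<dots> \<le> C"
      by (rule norm_bound) (use that in \<open>auto simp: minus_bcontfun.rep_eq a\<close>)
    finally show ?thesis .
  qed
  have abs_le: "\<bar>\<Lambda> b\<bar> \<le> C" if "0 \<le> C" "\<And>k. n0 \<le> k \<Longrightarrow> \<bar>apply_bcontfun b k\<bar> \<le> C" for b C n0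
    using \<Lambda>(1)[of b] \<Lambda>(1)[of "- b"] inf_le[of C n0 b] inf_le[of C n0 "- b"] that
    by (simp add: blinfun.minus_right uminus_bcontfun.rep_eq)
  have "1 \<le> infdist ?one c0"
    unfolding infdist_notempty[OF subspace_0[OF subspace_c0, THEN ex_in_conv[THEN iffD1, OF exI]]]
  proof (rule cINF_greatest)
    show "c0 \<noteq> {}" using subspace_0[OF subspace_c0] by blast
    fix a assume "a \<in> c0"
    then have "(\<lambda>k. \<bar>1 - apply_bcontfun a k\<bar>) \<longlonglongrightarrow> \<bar>1 - 0\<bar>"
      by (intro tendsto_intros) (simp add: c0_def)
    moreover have "\<bar>1 - apply_bcontfun a k\<bar> \<le> dist ?one a" for k
      using abs_apply_bcontfun_le[of "?one - a" k]
      by (simp add: dist_norm minus_bcontfun.rep_eq const_bcontfun.rep_eq)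
    ultimately have "\<bar>1 - 0\<bar> \<le> dist ?one a" by (intro LIMSEQ_le_const2) auto
    then show "1 \<le> dist ?one a" by simp
  qed
  then have one: "\<Lambda> ?one = 1"
    using abs_le[of 1 0 ?one] \<Lambda>(2) by (simp add: const_bcontfun.rep_eq)
  have eq: "\<Lambda> b = c" if "\<And>k. n0 \<le> k \<Longrightarrow> apply_bcontfun b k = c" for b c n0
  proof -
    have "\<bar>\<Lambda> (b - c *\<^sub>R ?one)\<bar> \<le> 0"
      by (rule abs_le[of 0 n0])
        (use that in \<open>simp_all add: minus_bcontfun.rep_eq scaleR_bcontfun.rep_eq const_bcontfun.rep_eq\<close>)
    then show ?thesis by (simp add: blinfun.diff_right blinfun.scaleR_right one)
  qed
  have "generalized_limit \<Lambda>"
    unfolding generalized_limit_def using abs_le eq by blast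
  then show ?thesis by blast
qed

context linf_copy
begin

text \<open>Averaging against the Rademacher functions over the dyadic blocks \<open>{..<2^n}\<close> and passing to a generalized
  limit in \<open>n\<close> maps the space onto \<open>\<ell>\<^sub>2\<close>.\<close>

definition rademacher_quotient :: "('z \<Rightarrow>\<^sub>L nat l2) \<Rightarrow> bool" where
  "rademacher_quotient \<theta> \<longleftrightarrow>
     (\<forall>i j. l2_nth (\<theta> (L (rad_seq i))) j = (if i = j then 1 else 0)) \<and>
     (\<forall>z D n0. 0 \<le> D \<longrightarrow> (\<forall>n\<ge>n0. avg n (\<lambda>k. (coord z k)\<^sup>2) \<le> D\<^sup>2) \<longrightarrow> norm (\<theta> z) \<le> D) \<and>
     (\<forall>(I :: nat set) J h z C n0. finite I \<longrightarrow> 0 \<le> C \<longrightarrow>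
       (\<forall>n\<ge>n0. \<bar>avg n (\<lambda>k. \<Sum>i\<in>I. (\<Sum>j<J. h i j * rad j k) * coord (z i) k)\<bar> \<le> C) \<longrightarrow>
       \<bar>\<Sum>i\<in>I. \<Sum>j<J. h i j * l2_nth (\<theta> (z i)) j\<bar> \<le> C)"

text \<open>The \<open>j\<close>-th coordinate of the quotient is the generalized limit of
  \<open>avg n\<close> of \<open>rad j\<close> times the coordinates of \<open>z\<close>. A finite
  linear combination of such values is the generalized limit of one sequence of averages, so a bound
  on these averages from some \<open>n0\<close> on passes to the limit; Bessel's inequality is
  obtained in this way.\<close>

lemma ex_rademacher_quotient: "\<exists>\<theta>. rademacher_quotient \<theta>"
proof -
  obtain \<Lambda> where \<Lambda>: "generalized_limit \<Lambda>" using ex_generalized_limit by blast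
  have \<Lambda>_le: "\<bar>\<Lambda> b\<bar> \<le> C" if "0 \<le> C" "\<And>k. n0 \<le> k \<Longrightarrow> \<bar>apply_bcontfun b k\<bar> \<le> C" for b C n0
    using \<Lambda> that unfolding generalized_limit_def by blast
  have \<Lambda>_eq: "\<Lambda> b = c" if "\<And>k. n0 \<le> k \<Longrightarrow> apply_bcontfun b k = c" for b c n0
    using \<Lambda> that unfolding generalized_limit_def by blast
  define B where "B j z = Bcontfun (\<lambda>n. avg n (\<lambda>k. rad j k * coord z k))" for j z
  have B: "apply_bcontfun (B j z) n = avg n (\<lambda>k. rad j k * coord z k)" for j z n
    unfolding B_def
    by (subst apply_bcontfun_discrete[of _ "norm z"])
      (auto intro!: abs_avg_le simp: abs_mult abs_coord_le)
  have B_linear: "linear (B j)" for j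
  proof (rule linearI)
    show "B j (x + y) = B j x + B j y" for x y
      by (rule bcontfun_eqI) (simp add: B plus_bcontfun.rep_eq linear_add[OF coord_linear] distrib_left avg_add)
    show "B j (r *\<^sub>R x) = r *\<^sub>R B j x" for r x
      by (rule bcontfun_eqI)
        (simp add: B scaleR_bcontfun.rep_eq linear_scale[OF coord_linear] mult.left_commute[of "rad j _"] avg_mult)
  qed
  let ?\<theta> = "\<lambda>j z. \<Lambda> (B j z)"
  have \<theta>_lin: "linear (?\<theta> j)" for j
    using linear_compose[OF B_linear[of j] bounded_linear.linear[OF blinfun.bounded_linear_right[of \<Lambda>]]]
    by (simp add: o_def)
  have comb: "\<bar>\<Sum>i\<in>I. \<Sum>j\<in>J. h i j * ?\<theta> j (z i)\<bar> \<le> C"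
    if "finite I" "0 \<le> C"
      "\<And>n. n0 \<le> n \<Longrightarrow> \<bar>avg n (\<lambda>k. \<Sum>i\<in>I. (\<Sum>j\<in>J. h i j * rad j k) * coord (z i) k)\<bar> \<le> C"
    for I :: "nat set" and J h z C n0
  proof -
    let ?b = "\<Sum>i\<in>I. \<Sum>j\<in>J. h i j *\<^sub>R B j (z i)"
    have "apply_bcontfun ?b n = avg n (\<lambda>k. \<Sum>i\<in>I. (\<Sum>j\<in>J. h i j * rad j k) * coord (z i) k)" for n
      by (simp add: apply_bcontfun_sum scaleR_bcontfun.rep_eq B avg_sum sum_distrib_right mult.assoc avg_mult)
    then have "\<bar>\<Lambda> ?b\<bar> \<le> C" by (intro \<Lambda>_le[of C n0]) (use that in auto)
    then show ?thesis by (simp add: blinfun.sum_right blinfun.scaleR_right)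
  qed
  have bessel: "(\<Sum>j\<in>F. (?\<theta> j z)\<^sup>2) \<le> D\<^sup>2"
    if F: "finite F" and D: "\<And>n. n0 \<le> n \<Longrightarrow> avg n (\<lambda>k. (coord z k)\<^sup>2) \<le> D\<^sup>2" for F z D n0
  proof -
    let ?S = "\<Sum>j\<in>F. (?\<theta> j z)\<^sup>2"
    obtain m where m: "F \<subseteq> {..<m}" using F finite_nat_set_iff_bounded by auto
    \<comment> \<open>The values are tested against themselves with a single vector; bounding a
      product by half the sum of the squares leads to \<open>?S \<le> (?S + D\<^sup>2) / 2\<close>,
      which is solved for \<open>?S\<close>.\<close>
    have "\<bar>\<Sum>i\<in>{0::nat}. \<Sum>j\<in>F. ?\<theta> j z * ?\<theta> j z\<bar> \<le> (?S + D\<^sup>2) / 2"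
    proof (rule comb[of _ _ "max n0 m"])
      fix n assume n: "max n0 m \<le> n"
      let ?H = "\<lambda>k. \<Sum>j\<in>F. ?\<theta> j z * rad j k"
      have H: "avg n (\<lambda>k. (?H k)\<^sup>2) = ?S"
      proof -
        have eq: "?H k = (\<Sum>j<n. (if j \<in> F then ?\<theta> j z else 0) * rad j k)" for k
          using m n by (intro sum.mono_neutral_cong_left) auto
        have "(\<Sum>j<n. (if j \<in> F then ?\<theta> j z else 0)\<^sup>2) = ?S"
          using m n by (intro sum.mono_neutral_cong_right) auto
        then show ?thesis unfolding eq rad_second_moment .
      qed
      have "\<bar>?H k * coord z k\<bar> \<le> ((?H k)\<^sup>2 + (coord z k)\<^sup>2) / 2" for k
        using sum_squares_bound[of "\<bar>?H k\<bar>" "\<bar>coord z k\<bar>"] by (simp add: abs_mult)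
      then have "\<bar>avg n (\<lambda>k. ?H k * coord z k)\<bar> \<le> avg n (\<lambda>k. (1 / 2) * ((?H k)\<^sup>2 + (coord z k)\<^sup>2))"
        by (intro abs_avg_le_avg) simp
      also have "\<dots> \<le> (?S + D\<^sup>2) / 2"
        unfolding avg_mult avg_add H using D[of n] n by simp
      finally show "\<bar>avg n (\<lambda>k. \<Sum>i\<in>{0::nat}. ?H k * coord z k)\<bar> \<le> (?S + D\<^sup>2) / 2" by simp
    qed (simp_all add: sum_nonneg add_nonneg_nonneg)
    then have "?S \<le> (?S + D\<^sup>2) / 2" by (simp add: power2_eq_square)
    then show ?thesis by simp
  qed
  obtain \<theta> :: "'z \<Rightarrow>\<^sub>L nat l2" where \<theta>: "\<And>z j. l2_nth (\<theta> z) j = ?\<theta> j z" "\<And>z. norm (\<theta> z) \<le> 1 * norm z"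
  proof (rule l2_operator[of ?\<theta> 1, OF \<theta>_lin])
    show "(\<Sum>j\<in>F. (?\<theta> j z)\<^sup>2) \<le> (1 * norm z)\<^sup>2" if "finite F" for F z
    proof (rule bessel[OF that, of 0])
      fix n
      have "avg n (\<lambda>k. (coord z k)\<^sup>2) \<le> avg n (\<lambda>k. (norm z)\<^sup>2)"
        by (rule avg_mono) (use abs_coord_le[of z] in \<open>simp add: abs_le_square_iff[symmetric]\<close>)
      then show "avg n (\<lambda>k. (coord z k)\<^sup>2) \<le> (1 * norm z)\<^sup>2" by simp
    qed
  qed (auto intro: that)
  have "l2_nth (\<theta> (L (rad_seq i))) j = (if i = j then 1 else 0)" for i j
    unfolding \<theta>(1)
  proof (rule \<Lambda>_eq[of "Suc (max i j)"])
    fix n assume n: "Suc (max i j) \<le> n"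
    then show "apply_bcontfun (B j (L (rad_seq i))) n = (if i = j then 1 else 0)"
      using rad_orthonormal[of j n i] by (auto simp: B TL rad_seq)
  qed
  moreover have "norm (\<theta> z) \<le> D" if "0 \<le> D" "\<forall>n\<ge>n0. avg n (\<lambda>k. (coord z k)\<^sup>2) \<le> D\<^sup>2" for z D n0
    by (rule norm_l2_leI[OF _ that(1)]) (use bessel[of _ n0 z D] that(2) in \<open>simp add: \<theta>(1)\<close>)
  moreover have "\<bar>\<Sum>i\<in>I. \<Sum>j<J. h i j * l2_nth (\<theta> (z i)) j\<bar> \<le> C"
    if "finite I" "0 \<le> C"
      "\<forall>n\<ge>n0. \<bar>avg n (\<lambda>k. \<Sum>i\<in>I. (\<Sum>j<J. h i j * rad j k) * coord (z i) k)\<bar> \<le> C"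
    for I :: "nat set" and J h z C n0
    unfolding \<theta>(1) by (rule comb[OF that(1,2), of n0]) (use that(3) in blast)
  ultimately have "rademacher_quotient \<theta>"
    unfolding rademacher_quotient_def by blast
  then show ?thesis by blast
qed

text \<open>A projection that vanishes on the kernel of the quotient map is controlled by it, so its
  range carries a sequence \<open>w\<close> with orthonormal images. Being Hilbertian,
  \<open>w\<close> has square sums of coordinates bounded at every point, uniformly in the number of
  vectors; averaging against Rademacher sums bounds the sum of the squared norms of the images by
  the same constant, so only boundedly many could be orthonormal.\<close>

lemma not_superprojective_linf_copy: "\<not> superprojective_space TYPE('z)"
proof
  assume super: "superprojective_space TYPE('z)"
  obtain \<theta> where \<theta>: "rademacher_quotient \<theta>" using ex_rademacher_quotient by blast
  have \<theta>_rad: "l2_nth (\<theta> (L (rad_seq i))) j = (if i = j then 1 else 0)" for i j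
    using \<theta> unfolding rademacher_quotient_def by blast
  have \<theta>_le: "norm (\<theta> z) \<le> D" if "0 \<le> D" "\<And>n. n0 \<le> n \<Longrightarrow> avg n (\<lambda>k. (coord z k)\<^sup>2) \<le> D\<^sup>2" for z D n0
    using \<theta> that unfolding rademacher_quotient_def by blast
  have \<theta>_comb: "\<bar>\<Sum>i\<in>I. \<Sum>j<J. h i j * l2_nth (\<theta> (z i)) j\<bar> \<le> C"
    if "finite I" "0 \<le> C"
      "\<And>n. n0 \<le> n \<Longrightarrow> \<bar>avg n (\<lambda>k. \<Sum>i\<in>I. (\<Sum>j<J. h i j * rad j k) * coord (z i) k)\<bar> \<le> C"
    for I :: "nat set" and J h z C n0
    using \<theta> that unfolding rademacher_quotient_def by blast
  have lift: "\<exists>y. norm y \<le> 2 * 8 * norm (\<theta> z) \<and> \<theta> y = \<theta> z" for z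
  proof (rule approximate_preimage[of 8 \<theta> z])
    fix z
    show "\<exists>y. norm y \<le> 8 * norm (\<theta> z) \<and> norm (\<theta> (z - y)) \<le> norm (\<theta> z) / 2"
    proof (cases "\<theta> z = 0")
      case True
      then show ?thesis by (intro exI[of _ 0]) (simp add: blinfun.zero_right)
    next
      case False
      define s where "s = norm (\<theta> z)"
      have s: "0 < s" using False by (simp add: s_def)
      obtain F where F: "finite F" "\<And>H. finite H \<Longrightarrow> H \<inter> F = {} \<Longrightarrow> (\<Sum>j\<in>H. (l2_nth (\<theta> z) j)\<^sup>2) \<le> (s / 4)\<^sup>2"
        using norm_l2_tail[of "(s / 4)\<^sup>2" "\<theta> z"] s by (metis half_gt_zero divide_pos_pos zero_less_numeral zero_less_power)
      obtain m where m: "F \<subseteq> {..<m}" using F(1) finite_nat_set_iff_bounded by auto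
      define a where "a j = (if j < m then l2_nth (\<theta> z) j else 0)" for j
      define x where "x = (\<Sum>j<m. a j *\<^sub>R L (rad_seq j))"
      have x: "coord x k = (\<Sum>j<m. a j * rad j k)" for k
        unfolding x_def coord_sum TL rad_seq ..
      have \<theta>x: "l2_nth (\<theta> x) j = a j" for j
      proof -
        have lin: "linear (\<lambda>y. l2_nth (\<theta> y) j)"
          by (rule linearI) (simp_all add: blinfun.add_right blinfun.scaleR_right plus_l2.rep_eq scaleR_l2.rep_eq)
        have "l2_nth (\<theta> x) j = (\<Sum>i<m. a i * (if i = j then 1 else 0))"
          unfolding x_def by (simp add: linear_sum[OF lin] linear_scale[OF lin] \<theta>_rad)
        then show ?thesis by (simp add: a_def if_distrib cong: if_cong)
      qed
      have near: "norm (\<theta> z - \<theta> x) \<le> s / 4"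
      proof (rule norm_l2_leI)
        fix H :: "nat set" assume H: "finite H"
        have "(\<Sum>j\<in>H. (l2_nth (\<theta> z - \<theta> x) j)\<^sup>2) = (\<Sum>j\<in>H - {..<m}. (l2_nth (\<theta> z) j)\<^sup>2)"
          unfolding l2_nth_minus \<theta>x a_def using H by (intro sum.mono_neutral_cong_right) auto
        also have "\<dots> \<le> (s / 4)\<^sup>2" using H m by (intro F(2)) auto
        finally show "(\<Sum>j\<in>H. (l2_nth (\<theta> z - \<theta> x) j)\<^sup>2) \<le> (s / 4)\<^sup>2" .
      qed (use s in simp)
      \<comment> \<open>The Rademacher sum \<open>x\<close> has no norm bound in terms of
        \<open>s\<close>. Clipping at \<open>8 * s\<close> provides one, with mean square error at
        most \<open>3 / 64 * s\<^sup>2\<close>, which is below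
        \<open>(s / 4)\<^sup>2\<close>.\<close>
      define G where "G = Bcontfun (\<lambda>k. clip (8 * s) (coord x k))"
      have G: "apply_bcontfun G k = clip (8 * s) (coord x k)" for k
        unfolding G_def by (subst apply_bcontfun_discrete[of _ "8 * s"]) (use s in \<open>simp_all add: abs_clip_le\<close>)
      have "norm (L G) \<le> norm G" by (rule norm_L_le)
      also have "\<dots> \<le> 8 * s" by (rule norm_bound) (use s in \<open>simp add: G abs_clip_le\<close>)
      finally have LG: "norm (L G) \<le> 8 * s" .
      have "norm (\<theta> (x - L G)) \<le> s / 4"
      proof (rule \<theta>_le)
        fix n assume n: "m \<le> n"
        have eq: "(\<Sum>j<m. a j * rad j k) = (\<Sum>j<n. a j * rad j k)" for k
          using n by (intro sum.mono_neutral_left) (auto simp: a_def)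
        have "(\<Sum>j<n. (a j)\<^sup>2) = (\<Sum>j<m. (l2_nth (\<theta> z) j)\<^sup>2)"
          using n by (intro sum.mono_neutral_cong_right) (auto simp: a_def)
        also have "\<dots> \<le> s\<^sup>2" unfolding s_def by (rule sum_squares_le_norm_l2) simp
        finally have "avg n (\<lambda>k. ((\<Sum>j<n. a j * rad j k) - clip (8 * s) (\<Sum>j<n. a j * rad j k))\<^sup>2) \<le> 3 * s ^ 4 / (8 * s)\<^sup>2"
          using s by (intro rad_clip_error) auto
        also have "\<dots> = 3 / 64 * s\<^sup>2"
          using s by (simp add: power2_eq_square power4_eq_xxxx)
        also have "\<dots> \<le> (s / 4)\<^sup>2" by (simp add: power_divide)
        finally show "avg n (\<lambda>k. (coord (x - L G) k)\<^sup>2) \<le> (s / 4)\<^sup>2"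
          by (simp only: linear_diff[OF coord_linear] TL G x eq)
      qed (use s in simp)
      then have "norm (\<theta> (z - L G)) \<le> s / 2"
        using norm_triangle_ineq[of "\<theta> z - \<theta> x" "\<theta> (x - L G)"] near by (simp add: blinfun.diff_right)
      then show ?thesis using LG unfolding s_def by blast
    qed
  qed blast
  define M where "M = {z. \<theta> z = 0}"
  have "subspace M"
    by (auto simp: M_def subspace_def blinfun.zero_right blinfun.add_right blinfun.scaleR_right)
  moreover have "closed M" unfolding M_def by (intro closed_Collect_eq continuous_intros)
  moreover have "infinite_codimensional M"
  proof (rule infinite_codimensional_biorthogonal[where g = "\<lambda>n z. l2_nth (\<theta> z) n" and x = "\<lambda>m. L (rad_seq m)"])
    show "linear (\<lambda>z. l2_nth (\<theta> z) n)" for n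
      by (rule linearI) (simp_all add: blinfun.add_right blinfun.scaleR_right plus_l2.rep_eq scaleR_l2.rep_eq)
  qed (auto simp: M_def zero_l2.rep_eq \<theta>_rad)
  ultimately obtain N where N: "M \<subseteq> N" "subspace N" "infinite_codimensional N" "complemented N"
    using super unfolding superprojective_space_def by blast
  obtain P :: "'z \<Rightarrow>\<^sub>L 'z" where P: "\<And>z. P (P z) = P z" "\<And>z. z \<in> N \<Longrightarrow> P z = 0"
    "subspace (range P)" "infinite_dimensional (range P)"
    by (rule infinite_codimensional_complement[OF N(4,2,3)]) (rule that)
  define C where "C = 16 * norm P + 1"
  have C: "1 \<le> C" by (simp add: C_def)
  have P_le: "norm (P z) \<le> C * norm (\<theta> z)" for z
  proof -
    obtain y where y: "norm y \<le> 2 * 8 * norm (\<theta> z)" "\<theta> y = \<theta> z" using lift by blast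
    then have "z - y \<in> N" using N(1) by (auto simp: M_def blinfun.diff_right)
    then have "P z = P y" using P(2)[of "z - y"] by (simp add: blinfun.diff_right)
    then have "norm (P z) \<le> norm P * norm y" using norm_blinfun[of P y] by simp
    also have "\<dots> \<le> norm P * (16 * norm (\<theta> z))" using y(1) by (intro mult_left_mono) auto
    also have "\<dots> \<le> C * norm (\<theta> z)" by (simp add: C_def algebra_simps)
    finally show ?thesis .
  qed
  have fixed: "P z = z" if "z \<in> range P" for z using that P(1) by auto
  obtain w where w: "\<And>n::nat. w n \<in> range P" "\<And>n m. inner (\<theta> (w n)) (\<theta> (w m)) = (if n = m then 1 else 0)"
  proof (rule orthonormal_sequence[OF P(3,4), of "1 / C" \<theta>])
    show "1 / C * norm z \<le> norm (\<theta> z)" if "z \<in> range P" for z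
      using P_le[of z] C fixed[OF that] by (simp add: divide_le_eq mult.commute)
  qed (use C in \<open>auto intro: that\<close>)
  have w_le: "norm (\<Sum>i<n. b i *\<^sub>R w i) \<le> C * L2_set b {..<n}" for b n
  proof -
    have z: "(\<Sum>i<n. b i *\<^sub>R w i) \<in> range P"
      using P(3) w(1) by (intro subspace_sum subspace_scale)
    have "norm (\<Sum>i<n. b i *\<^sub>R w i) \<le> C * norm (\<theta> (\<Sum>i<n. b i *\<^sub>R w i))"
      using P_le[of "\<Sum>i<n. b i *\<^sub>R w i"] unfolding fixed[OF z] .
    also have "norm (\<theta> (\<Sum>i<n. b i *\<^sub>R w i)) = L2_set b {..<n}"
      using norm_orthonormal_sum[of "\<lambda>n. \<theta> (w n)" "{..<n}" b, OF w(2)]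
      by (simp add: blinfun.sum_right blinfun.scaleR_right)
    finally show ?thesis .
  qed
  \<comment> \<open>The upper l2 estimate for \<open>w\<close> is tested with the coordinates at
    \<open>k\<close> themselves as coefficients.\<close>
  have coord_le: "(\<Sum>i<n. (coord (w i) k)\<^sup>2) \<le> C\<^sup>2" for n k
  proof -
    let ?b = "\<lambda>i. coord (w i) k"
    have "(L2_set ?b {..<n})\<^sup>2 = coord (\<Sum>i<n. ?b i *\<^sub>R w i) k"
      unfolding coord_sum by (simp add: L2_set_def sum_nonneg power2_eq_square)
    also have "\<dots> \<le> C * L2_set ?b {..<n}"
      using abs_coord_le[of "\<Sum>i<n. ?b i *\<^sub>R w i" k] w_le[of ?b n] by linarith
    finally have "L2_set ?b {..<n} \<le> C"
      using C by (cases "L2_set ?b {..<n} = 0") (auto simp: power2_eq_square less_le)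
    then have "(L2_set ?b {..<n})\<^sup>2 \<le> C\<^sup>2" by (intro power_mono) auto
    then show ?thesis by (simp add: L2_set_def sum_nonneg)
  qed
  have bound: "real n / 2 \<le> C\<^sup>2" for n
  proof -
    have "\<exists>F. finite F \<and> 1 / 2 \<le> (\<Sum>j\<in>F. (l2_nth (\<theta> (w i)) j)\<^sup>2)" for i
    proof -
      have pos: "0 < (1 / 2 :: real)" by simp
      obtain F where F: "finite F" "(norm (\<theta> (w i)))\<^sup>2 - 1 / 2 \<le> (\<Sum>j\<in>F. (l2_nth (\<theta> (w i)) j)\<^sup>2)"
        by (rule norm_l2_tail[OF pos, of "\<theta> (w i)"]) (rule that)
      have "(norm (\<theta> (w i)))\<^sup>2 = 1" using w(2)[of i i] by (simp add: power2_norm_eq_inner)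
      then show ?thesis using F by (intro exI[of _ F]) simp
    qed
    then obtain F where F: "\<And>i. finite (F i)" "\<And>i. 1 / 2 \<le> (\<Sum>j\<in>F i. (l2_nth (\<theta> (w i)) j)\<^sup>2)"
      by metis
    obtain J where J: "(\<Union>i<n. F i) \<subseteq> {..<J}"
      using F(1) finite_nat_set_iff_bounded[of "\<Union>i<n. F i"] by auto
    let ?h = "\<lambda>i j. l2_nth (\<theta> (w i)) j"
    let ?s = "\<Sum>i<n. \<Sum>j<J. (?h i j)\<^sup>2"
    have lower: "real n / 2 \<le> ?s"
    proof -
      have "1 / 2 \<le> (\<Sum>j<J. (?h i j)\<^sup>2)" if "i < n" for i
      proof -
        have "(\<Sum>j\<in>F i. (?h i j)\<^sup>2) \<le> (\<Sum>j<J. (?h i j)\<^sup>2)"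
          using J that by (intro sum_mono2) auto
        then show ?thesis using F(2)[of i] by linarith
      qed
      then have "(\<Sum>i<n. 1 / 2) \<le> ?s" by (intro sum_mono) auto
      then show ?thesis by simp
    qed
    \<comment> \<open>One factor is written as a Rademacher sum and the other is the coordinate
      function of \<open>w i\<close>; half the sum of squares bounds the product, and the second
      squares contribute at most \<open>C\<^sup>2\<close> pointwise.\<close>
    have "\<bar>\<Sum>i<n. \<Sum>j<J. ?h i j * ?h i j\<bar> \<le> (?s + C\<^sup>2) / 2"
    proof (rule \<theta>_comb[of _ _ J])
      fix l assume l: "J \<le> l"
      let ?H = "\<lambda>i k. \<Sum>j<J. ?h i j * rad j k"
      have H: "avg l (\<lambda>k. (?H i k)\<^sup>2) = (\<Sum>j<J. (?h i j)\<^sup>2)" for i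
      proof -
        have eq: "?H i k = (\<Sum>j<l. (if j < J then ?h i j else 0) * rad j k)" for k
          using l by (intro sum.mono_neutral_cong_left) auto
        have "(\<Sum>j<l. (if j < J then ?h i j else 0)\<^sup>2) = (\<Sum>j<J. (?h i j)\<^sup>2)"
          using l by (intro sum.mono_neutral_cong_right) auto
        then show ?thesis unfolding eq rad_second_moment .
      qed
      have "\<bar>\<Sum>i<n. ?H i k * coord (w i) k\<bar> \<le> (1 / 2) * ((\<Sum>i<n. (?H i k)\<^sup>2) + C\<^sup>2)" for k
      proof -
        have "\<bar>?H i k * coord (w i) k\<bar> \<le> ((?H i k)\<^sup>2 + (coord (w i) k)\<^sup>2) / 2" for i
          using sum_squares_bound[of "\<bar>?H i k\<bar>" "\<bar>coord (w i) k\<bar>"] by (simp add: abs_mult)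
        then have "\<bar>\<Sum>i<n. ?H i k * coord (w i) k\<bar> \<le> (\<Sum>i<n. ((?H i k)\<^sup>2 + (coord (w i) k)\<^sup>2) / 2)"
          by (intro order_trans[OF sum_abs] sum_mono)
        also have "\<dots> = (1 / 2) * ((\<Sum>i<n. (?H i k)\<^sup>2) + (\<Sum>i<n. (coord (w i) k)\<^sup>2))"
          by (simp add: sum.distrib sum_divide_distrib[symmetric])
        also have "\<dots> \<le> (1 / 2) * ((\<Sum>i<n. (?H i k)\<^sup>2) + C\<^sup>2)"
          using coord_le[of k n] by simp
        finally show ?thesis .
      qed
      then have "\<bar>avg l (\<lambda>k. \<Sum>i<n. ?H i k * coord (w i) k)\<bar> \<le> avg l (\<lambda>k. (1 / 2) * ((\<Sum>i<n. (?H i k)\<^sup>2) + C\<^sup>2))"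
        by (intro abs_avg_le_avg) simp
      also have "\<dots> = (?s + C\<^sup>2) / 2"
        unfolding avg_mult avg_add avg_sum H by simp
      finally show "\<bar>avg l (\<lambda>k. \<Sum>i<n. ?H i k * coord (w i) k)\<bar> \<le> (?s + C\<^sup>2) / 2" .
    qed (auto simp: sum_nonneg intro!: add_nonneg_nonneg)
    then have "?s \<le> (?s + C\<^sup>2) / 2" by (simp add: power2_eq_square)
    then show ?thesis using lower by simp
  qed
  obtain n :: nat where "2 * C\<^sup>2 < n" using reals_Archimedean2 by blast
  then show False using bound[of n] by simp
qed

end

section \<open>A complemented copy of the bounded sequences in the bidual\<close>

context JL_model
begin

text \<open>Adjoint to the splitting of the dual: a bounded sequence acts on \<open>f\<close>
  through the l1 sequence of the \<open>f (u k)\<close>, and an element of the bidual is read off on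
  the evaluations \<open>\<delta> k\<close>.\<close>

lemma linf_copy_bidual:
  obtains L :: "(nat \<Rightarrow>\<^sub>C real) \<Rightarrow>\<^sub>L (('x \<Rightarrow>\<^sub>L real) \<Rightarrow>\<^sub>L real)" and T where "linf_copy L T"
proof -
  have lin: "linear (\<lambda>f :: 'x \<Rightarrow>\<^sub>L real. \<Sum>k. apply_bcontfun b k * f (u k))" for b
    by (rule linear_suminf_mult_u) (rule abs_apply_bcontfun_le)
  have le: "norm (\<Sum>k. apply_bcontfun b k * f (u k)) \<le> norm b * norm f" for b and f :: "'x \<Rightarrow>\<^sub>L real"
    using abs_suminf_mult_u_le[of "apply_bcontfun b" "norm b" f, OF abs_apply_bcontfun_le]
      mult_left_mono[OF suminf_abs_u_le[of f], of "norm b"] by simp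
  define l where "l b = Blinfun (\<lambda>f :: 'x \<Rightarrow>\<^sub>L real. \<Sum>k. apply_bcontfun b k * f (u k))" for b
  have l: "l b f = (\<Sum>k. apply_bcontfun b k * f (u k))" for b f
  proof -
    have "bounded_linear (\<lambda>f :: 'x \<Rightarrow>\<^sub>L real. \<Sum>k. apply_bcontfun b k * f (u k))"
      using le[of b] linear_add[OF lin] linear_scale[OF lin]
      by (intro bounded_linear_intro[where K = "norm b"]) (auto simp: mult.commute)
    then show ?thesis by (simp add: l_def bounded_linear_Blinfun_apply)
  qed
  have l_norm: "norm (l b) \<le> norm b" for b
    by (rule norm_blinfun_bound) (use le[of b] in \<open>simp_all add: l\<close>)
  have sm: "summable (\<lambda>k. apply_bcontfun b k * f (u k))" for b and f :: "'x \<Rightarrow>\<^sub>L real"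
    by (rule summable_mult_u) (rule abs_apply_bcontfun_le)
  have "bounded_linear l"
  proof (rule bounded_linear_intro[where K = 1])
    show "l (b + c) = l b + l c" for b c
      by (rule blinfun_eqI) (simp add: l blinfun.add_left plus_bcontfun.rep_eq distrib_right suminf_add sm)
    show "l (r *\<^sub>R b) = r *\<^sub>R l b" for r b
      by (rule blinfun_eqI) (simp add: l blinfun.scaleR_left scaleR_bcontfun.rep_eq mult.assoc suminf_mult sm)
  qed (use l_norm in simp)
  then have L: "blinfun_apply (Blinfun l) = l" by (rule bounded_linear_Blinfun_apply)
  obtain T :: "(('x \<Rightarrow>\<^sub>L real) \<Rightarrow>\<^sub>L real) \<Rightarrow>\<^sub>L (nat \<Rightarrow>\<^sub>C real)"
    where T: "\<And>z k. apply_bcontfun (T z) k = z (\<delta> k)" "\<And>z. norm (T z) \<le> 1 * norm z"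
  proof (rule linf_operator[of "\<lambda>k z. blinfun_apply z (\<delta> k)" 1])
    show "linear (\<lambda>z :: ('x \<Rightarrow>\<^sub>L real) \<Rightarrow>\<^sub>L real. z (\<delta> k))" for k
      by (simp add: blinfun.bounded_linear_left bounded_linear.linear)
    show "\<bar>z (\<delta> k)\<bar> \<le> 1 * norm z" for k and z :: "('x \<Rightarrow>\<^sub>L real) \<Rightarrow>\<^sub>L real"
      using norm_blinfun[of z "\<delta> k"] mult_left_mono[OF norm_\<delta>_le[of k], of "norm z"] by simp
  qed (rule that)
  have "linf_copy (Blinfun l) T"
  proof
    show "T (Blinfun l b) = b" for b
      by (rule bcontfun_eqI) (simp add: T(1) L l suminf_mult_\<delta>_u)
  qed (use l_norm T(2) in \<open>simp_all add: L\<close>)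
  then show ?thesis by (rule that)
qed

lemma not_projective_bidual:
  "\<not> subprojective_space TYPE(('x \<Rightarrow>\<^sub>L real) \<Rightarrow>\<^sub>L real)"
  "\<not> superprojective_space TYPE(('x \<Rightarrow>\<^sub>L real) \<Rightarrow>\<^sub>L real)"
proof -
  obtain L :: "(nat \<Rightarrow>\<^sub>C real) \<Rightarrow>\<^sub>L (('x \<Rightarrow>\<^sub>L real) \<Rightarrow>\<^sub>L real)" and T where LT: "linf_copy L T"
    by (rule linf_copy_bidual) (rule that)
  show "\<not> subprojective_space TYPE(('x \<Rightarrow>\<^sub>L real) \<Rightarrow>\<^sub>L real)"
    by (rule linf_copy.not_subprojective_linf_copy[OF LT])
  show "\<not> superprojective_space TYPE(('x \<Rightarrow>\<^sub>L real) \<Rightarrow>\<^sub>L real)"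
    by (rule linf_copy.not_superprojective_linf_copy[OF LT])
qed

end

section \<open>The completion\<close>

lemma linear_on_subspace_sum:
  fixes \<iota> :: "'a::real_vector \<Rightarrow> 'b::real_vector"
  assumes S: "subspace S"
    and \<iota>: "\<And>x y. x \<in> S \<Longrightarrow> y \<in> S \<Longrightarrow> \<iota> (x + y) = \<iota> x + \<iota> y" "\<And>c x. x \<in> S \<Longrightarrow> \<iota> (c *\<^sub>R x) = c *\<^sub>R \<iota> x"
    and s: "\<And>i. s i \<in> S"
  shows "\<iota> (\<Sum>i\<in>A. a i *\<^sub>R s i) = (\<Sum>i\<in>A. a i *\<^sub>R \<iota> (s i))"
proof (induction A rule: infinite_finite_induct)
  case (insert i A)
  then show ?case using s S by (simp add: \<iota> subspace_scale subspace_sum)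
qed (use \<iota>(2)[of 0 0] subspace_0[OF S] in auto)

text \<open>\<open>\<iota>\<close> is linear only on \<open>S\<close>, so the functional is
  prescribed on \<open>S\<close> and extended along sequences: it contracts distances of images,
  hence \<open>T (s n)\<close> is Cauchy whenever \<open>\<iota> (s n)\<close> converges.\<close>

lemma extend_functional:
  fixes \<iota> :: "'a::real_vector \<Rightarrow> 'b::banach" and T :: "'a \<Rightarrow> real"
  assumes S: "subspace S"
    and \<iota>: "\<And>x y. x \<in> S \<Longrightarrow> y \<in> S \<Longrightarrow> \<iota> (x + y) = \<iota> x + \<iota> y" "\<And>c x. x \<in> S \<Longrightarrow> \<iota> (c *\<^sub>R x) = c *\<^sub>R \<iota> x"
    and dense: "closure (\<iota> ` S) = UNIV"
    and T: "\<And>x y. x \<in> S \<Longrightarrow> y \<in> S \<Longrightarrow> T (x + y) = T x + T y" "\<And>c x. x \<in> S \<Longrightarrow> T (c *\<^sub>R x) = c * T x"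
    and le: "\<And>x. x \<in> S \<Longrightarrow> \<bar>T x\<bar> \<le> norm (\<iota> x)"
  obtains f :: "'b \<Rightarrow>\<^sub>L real" where "\<And>x. x \<in> S \<Longrightarrow> f (\<iota> x) = T x" "\<And>y. \<bar>f y\<bar> \<le> norm y"
proof -
  have diff: "\<bar>T x - T y\<bar> \<le> norm (\<iota> x - \<iota> y)" if "x \<in> S" "y \<in> S" for x y
  proof -
    have y: "(- 1) *\<^sub>R y \<in> S" using S that(2) by (rule subspace_scale)
    have "x + (- 1) *\<^sub>R y \<in> S" by (rule subspace_add[OF S that(1) y])
    from le[OF this] show ?thesis
      unfolding T(1)[OF that(1) y] T(2)[OF that(2)] \<iota>(1)[OF that(1) y] \<iota>(2)[OF that(2)] by simp
  qed
  have "\<exists>s. (\<forall>n. s n \<in> S) \<and> (\<lambda>n. \<iota> (s n)) \<longlonglongrightarrow> y" for y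
  proof -
    have "y \<in> closure (\<iota> ` S)" using dense by simp
    then obtain z where z: "\<And>n. z n \<in> \<iota> ` S" "z \<longlonglongrightarrow> y" unfolding closure_sequential by blast
    have "\<forall>n. \<exists>x. x \<in> S \<and> z n = \<iota> x" using z(1) by blast
    from choice[OF this] obtain s where "\<forall>n. s n \<in> S \<and> z n = \<iota> (s n)" ..
    then show ?thesis using z(2) by (intro exI[of _ s]) (simp add: LIMSEQ_def)
  qed
  then obtain s where s: "\<And>y n. s y n \<in> S" "\<And>y. (\<lambda>n. \<iota> (s y n)) \<longlonglongrightarrow> y" by metis
  define f where "f y = lim (\<lambda>n. T (s y n))" for y
  \<comment> \<open>The limit is the same along every sequence in \<open>S\<close> whose image
    converges to \<open>y\<close>, and this yields additivity and homogeneity.\<close>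
  have f: "(\<lambda>n. T (r n)) \<longlonglongrightarrow> f y" if r: "\<And>n. r n \<in> S" "(\<lambda>n. \<iota> (r n)) \<longlonglongrightarrow> y" for r y
  proof -
    have "Cauchy (\<lambda>n. T (s y n))"
    proof (rule metric_CauchyI)
      fix e :: real assume "0 < e"
      then obtain M where "\<forall>m\<ge>M. \<forall>n\<ge>M. dist (\<iota> (s y m)) (\<iota> (s y n)) < e"
        using LIMSEQ_imp_Cauchy[OF s(2)[of y]] unfolding Cauchy_def by blast
      then show "\<exists>M. \<forall>m\<ge>M. \<forall>n\<ge>M. dist (T (s y m)) (T (s y n)) < e"
        using diff[OF s(1) s(1)] unfolding dist_norm real_norm_def by (meson order_le_less_trans)
    qed
    then have 1: "(\<lambda>n. T (s y n)) \<longlonglongrightarrow> f y"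
      unfolding f_def by (simp add: Cauchy_convergent_iff convergent_LIMSEQ_iff)
    have "(\<lambda>n. norm (\<iota> (r n) - \<iota> (s y n))) \<longlonglongrightarrow> norm (y - y)"
      by (intro tendsto_intros r s(2))
    then have 2: "(\<lambda>n. norm (\<iota> (r n) - \<iota> (s y n))) \<longlonglongrightarrow> 0" by simp
    have "(\<lambda>n. T (r n) - T (s y n)) \<longlonglongrightarrow> 0"
      by (rule Lim_null_comparison[OF _ 2]) (simp add: diff r(1) s(1))
    from tendsto_add[OF this 1] show ?thesis by simp
  qed
  have "bounded_linear f"
  proof (rule bounded_linear_intro[where K = 1])
    show "f (x + y) = f x + f y" for x y
    proof (rule LIMSEQ_unique)
      show "(\<lambda>n. T (s x n + s y n)) \<longlonglongrightarrow> f (x + y)"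
        using tendsto_add[OF s(2)[of x] s(2)[of y]]
        by (intro f) (simp_all add: \<iota> s(1) subspace_add[OF S])
      show "(\<lambda>n. T (s x n + s y n)) \<longlonglongrightarrow> f x + f y"
        using tendsto_add[OF f[OF s(1) s(2)[of x]] f[OF s(1) s(2)[of y]]] by (simp add: T s(1))
    qed
    show "f (r *\<^sub>R x) = r *\<^sub>R f x" for r x
    proof (rule LIMSEQ_unique)
      show "(\<lambda>n. T (r *\<^sub>R s x n)) \<longlonglongrightarrow> f (r *\<^sub>R x)"
        using tendsto_scaleR[OF tendsto_const s(2)[of x], of r]
        by (intro f) (simp_all add: \<iota> s(1) subspace_scale[OF S])
      show "(\<lambda>n. T (r *\<^sub>R s x n)) \<longlonglongrightarrow> r *\<^sub>R f x"
        using tendsto_mult_left[OF f[OF s(1) s(2)[of x]], of r] by (simp add: T s(1))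
    qed
    show "norm (f x) \<le> norm x * 1" for x
    proof -
      have "norm (f x) \<le> norm x"
        by (rule LIMSEQ_le[OF tendsto_norm[OF f[OF s(1) s(2)]] tendsto_norm[OF s(2)]]) (use le[OF s(1)] in auto)
      then show ?thesis by simp
    qed
  qed
  then have ap: "blinfun_apply (Blinfun f) = f" and bound: "\<And>y. \<bar>f y\<bar> \<le> norm y"
    using bounded_linear_Blinfun_apply LIMSEQ_le[OF tendsto_norm[OF f[OF s(1) s(2)]] tendsto_norm[OF s(2)]] le[OF s(1)]
    by auto
  have "f (\<iota> x) = T x" if "x \<in> S" for x
    using LIMSEQ_unique[OF f[of "\<lambda>_. x" "\<iota> x"] tendsto_const[of "T x"]] that by simp
  then show ?thesis using that[of "Blinfun f"] ap bound by simp
qed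

section \<open>The space c0 inside the bounded sequences\<close>

definition unit_seq :: "nat \<Rightarrow> nat \<Rightarrow>\<^sub>C real" where
  "unit_seq k = Bcontfun (\<lambda>n. if n = k then 1 else 0)"

lemma unit_seq: "apply_bcontfun (unit_seq k) n = (if n = k then 1 else 0)"
  unfolding unit_seq_def by (subst apply_bcontfun_discrete[of _ 1]) auto

lemma unit_seq_c0: "unit_seq k \<in> c0"
proof -
  have "\<forall>\<^sub>F n in sequentially. apply_bcontfun (unit_seq k) n = 0"
    unfolding eventually_sequentially by (intro exI[of _ "Suc k"]) (auto simp: unit_seq)
  then show ?thesis unfolding c0_def by (auto intro: tendsto_eventually)
qed

lemma c0_approximation:
  assumes "y \<in> c0" "0 < \<epsilon>"
  obtains n where "norm (y - (\<Sum>k<n. apply_bcontfun y k *\<^sub>R unit_seq k)) \<le> \<epsilon>"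
proof -
  obtain n where n: "\<And>k. k \<ge> n \<Longrightarrow> \<bar>apply_bcontfun y k\<bar> < \<epsilon>"
    using assms LIMSEQ_D[of "apply_bcontfun y" 0 \<epsilon>] by (auto simp: c0_def)
  have "norm (y - (\<Sum>k<n. apply_bcontfun y k *\<^sub>R unit_seq k)) \<le> \<epsilon>"
  proof (rule norm_bound)
    fix j
    have "apply_bcontfun (\<Sum>k<n. apply_bcontfun y k *\<^sub>R unit_seq k) j = (if j < n then apply_bcontfun y j else 0)"
      by (simp add: apply_bcontfun_sum scaleR_bcontfun.rep_eq unit_seq if_distrib sum.delta' cong: if_cong)
    then show "norm (apply_bcontfun (y - (\<Sum>k<n. apply_bcontfun y k *\<^sub>R unit_seq k)) j) \<le> \<epsilon>"
      using n[of j] assms(2) by (simp add: minus_bcontfun.rep_eq less_imp_le)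
  qed
  then show ?thesis by (rule that)
qed

lemma closed_c0: "closed c0"
  unfolding closed_sequential_limits
proof (intro allI impI, elim conjE)
  fix y l assume y: "\<forall>n. y n \<in> c0" "y \<longlonglongrightarrow> l"
  have "apply_bcontfun l \<longlonglongrightarrow> 0"
  proof (rule LIMSEQ_I)
    fix \<epsilon> :: real assume \<epsilon>: "0 < \<epsilon>"
    then obtain n where n: "norm (y n - l) < \<epsilon> / 2"
      using LIMSEQ_D[OF y(2), of "\<epsilon> / 2"] by auto
    obtain m where m: "\<And>k. k \<ge> m \<Longrightarrow> \<bar>apply_bcontfun (y n) k\<bar> < \<epsilon> / 2"
      using LIMSEQ_D[of "apply_bcontfun (y n)" 0 "\<epsilon> / 2"] y(1) \<epsilon> by (auto simp: c0_def)
    have "norm (apply_bcontfun l k - 0) < \<epsilon>" if "k \<ge> m" for k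
      using m[OF that] n abs_apply_bcontfun_le[of "y n - l" k]
      by (simp add: minus_bcontfun.rep_eq)
    then show "\<exists>m. \<forall>k\<ge>m. norm (apply_bcontfun l k - 0) < \<epsilon>" by blast
  qed
  then show "l \<in> c0" by (simp add: c0_def)
qed

text \<open>The library proves completeness of bounded continuous functions on metric spaces only, and \<open>nat\<close> is
  not an instance of that class.\<close>

lemma complete_c0: "complete c0"
  unfolding complete_def
proof (intro allI impI, elim conjE)
  fix f :: "nat \<Rightarrow> nat \<Rightarrow>\<^sub>C real" assume f: "\<forall>n. f n \<in> c0" and "Cauchy f"
  have "\<forall>\<epsilon>>0. \<exists>M. \<forall>m n k. M \<le> m \<and> M \<le> n \<and> True \<longrightarrow> dist (apply_bcontfun (f m) k) (apply_bcontfun (f n) k) < \<epsilon>"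
    using \<open>Cauchy f\<close> unfolding Cauchy_def by (meson dist_fun_lt_imp_dist_val_lt)
  then obtain g where "\<forall>\<epsilon>>0. \<exists>M. \<forall>n k. M \<le> n \<and> True \<longrightarrow> dist (apply_bcontfun (f n) k) (g k) < \<epsilon>"
    using uniformly_convergent_eq_cauchy[of "\<lambda>_. True" "\<lambda>n. apply_bcontfun (f n)"] by blast
  then have "uniform_limit UNIV (\<lambda>n. apply_bcontfun (f n)) g sequentially"
    unfolding uniform_limit_sequentially_iff by auto
  then obtain l where "f \<longlonglongrightarrow> l"
    using uniform_limit_bcontfunE sequentially_bot by metis
  moreover from this have "l \<in> c0" using closed_c0 f closed_sequentially by blast
  ultimately show "\<exists>l\<in>c0. f \<longlonglongrightarrow> l" by blast
qed

text \<open>The functionals \<open>\<delta>\<close> and \<open>e\<close> are extended by continuity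
  from the dense image of \<open>JL0\<close>, and the inequalities between them and the norm are
  verified there first. The bijection \<open>h\<close> turns the index set into a type. The isometry
  on c0 is recorded separately because it makes the image of c0 closed.\<close>

lemma JL_model_completion:
  fixes \<Gamma> :: "'g set" and N :: "'g \<Rightarrow> nat set" and \<iota> :: "(nat \<Rightarrow>\<^sub>C real) \<Rightarrow> 'x::banach" and h :: "'i \<Rightarrow> 'g"
  assumes h: "bij_betw h UNIV \<Gamma>"
    and inf: "\<And>\<gamma>. \<gamma> \<in> \<Gamma> \<Longrightarrow> infinite (N \<gamma>)"
    and ad: "\<And>\<gamma> \<gamma>'. \<gamma> \<in> \<Gamma> \<Longrightarrow> \<gamma>' \<in> \<Gamma> \<Longrightarrow> \<gamma> \<noteq> \<gamma>' \<Longrightarrow> finite (N \<gamma> \<inter> N \<gamma>')"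
    and compl: "is_completion (JL0 \<Gamma> N) (JL_norm \<Gamma> N) \<iota>"
  shows "\<exists>\<delta> e. JL_model (\<lambda>i. N (h i)) (\<lambda>k. \<iota> (unit_seq k)) (\<lambda>i. \<iota> (phi N (h i))) \<delta> e"
    and "\<And>y. y \<in> c0 \<Longrightarrow> norm (\<iota> y) = norm y"
proof -
  let ?S = "JL0 \<Gamma> N" and ?\<nu> = "JL_norm \<Gamma> N" and ?N = "\<lambda>i. N (h i)"
  have h_in: "h i \<in> \<Gamma>" for i using h by (auto simp: bij_betw_def)
  have h_inj: "inj h" and h_range: "h ` UNIV = \<Gamma>" using h by (auto simp: bij_betw_def)
  have S: "subspace ?S" by (simp add: JL0_def subspace_span)
  have \<iota>: "\<And>x y. x \<in> ?S \<Longrightarrow> y \<in> ?S \<Longrightarrow> \<iota> (x + y) = \<iota> x + \<iota> y" "\<And>c x. x \<in> ?S \<Longrightarrow> \<iota> (c *\<^sub>R x) = c *\<^sub>R \<iota> x"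
    "\<And>x. x \<in> ?S \<Longrightarrow> norm (\<iota> x) = ?\<nu> x" "closure (\<iota> ` ?S) = UNIV"
    using compl by (auto simp: is_completion_def)
  have c0_S: "y \<in> ?S" if "y \<in> c0" for y using that by (auto simp: JL0_def intro: span_base)
  have phi_S: "phi N (h i) \<in> ?S" for i using h_in by (auto simp: JL0_def intro: span_base)
  have phi_h: "phi ?N i = phi N (h i)" for i by (simp add: phi_def)
  have infN: "infinite (?N i)" for i by (rule inf[OF h_in])
  have adN: "finite (?N i \<inter> ?N j)" if "i \<noteq> j" for i j
    using that h_inj by (intro ad h_in) (simp add: inj_eq)
  let ?sum = "\<lambda>a A. \<Sum>i\<in>A. a i *\<^sub>R phi N (h i)"
  have sum_S: "?sum a A \<in> ?S" for a A by (intro subspace_sum subspace_scale S phi_S)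
  have \<nu>: "?\<nu> (y + ?sum a A) = max (norm (y + ?sum a A)) (L2_set a A)" if "y \<in> c0" "finite A" for y a A
  proof -
    have sum: "(\<Sum>\<gamma>\<in>h ` A. a (inv h \<gamma>) *\<^sub>R phi N \<gamma>) = ?sum a A"
      by (subst sum.reindex[OF inj_on_subset[OF h_inj subset_UNIV]]) (simp add: inv_f_f[OF h_inj])
    have "L2_set (\<lambda>\<gamma>. a (inv h \<gamma>)) (h ` A) = L2_set a A"
      unfolding L2_set_def
      by (subst sum.reindex[OF inj_on_subset[OF h_inj subset_UNIV]]) (simp add: inv_f_f[OF h_inj])
    then show ?thesis
      using JL_norm_eq[of \<Gamma> N y "h ` A" "\<lambda>\<gamma>. a (inv h \<gamma>)", OF inf ad that(1)] that(2) h_in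
      unfolding sum by auto
  qed
  have rep: "\<exists>y a A. y \<in> c0 \<and> finite A \<and> s = y + ?sum a A" if "s \<in> ?S" for s
  proof -
    have "phi N ` \<Gamma> = range (\<lambda>i. phi N (h i))" by (auto simp: h_range[symmetric])
    then have "s \<in> span (c0 \<union> range (\<lambda>i. phi N (h i)))" using that by (simp add: JL0_def)
    then obtain y w where yw: "y \<in> span c0" "w \<in> span (range (\<lambda>i. phi N (h i)))" "s = y + w"
      unfolding span_Un by blast
    obtain A a where "finite A" "w = ?sum a A" using span_rangeE[OF yw(2)] .
    moreover have "y \<in> c0" using yw(1) span_minimal[OF order_refl subspace_c0] by blast
    ultimately show ?thesis using yw(3) by blast
  qed
  have norm_c0: "norm (\<iota> y) = norm y" if "y \<in> c0" for y
    using \<nu>[OF that, of "{}" "\<lambda>_. 0"] \<iota>(3)[OF c0_S[OF that]] by simp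
  show "norm (\<iota> y) = norm y" if "y \<in> c0" for y by (rule norm_c0[OF that])
  \<comment> \<open>The coefficient of \<open>phi N (h i)\<close> is recovered as the limit along
    \<open>N (h i)\<close>, so it depends on the sequence alone and not on a representation.\<close>
  define c :: "'i \<Rightarrow> (nat \<Rightarrow>\<^sub>C real) \<Rightarrow> real" where "c i s = lim (\<lambda>k. apply_bcontfun s (enumerate (?N i) k))" for i s
  have c: "c i (y + ?sum a A) = (if i \<in> A then a i else 0)" if "y \<in> c0" "finite A" for i y a A
    unfolding c_def
    using limI[OF JL_coeff_limit[of ?N i A y a, OF infN _ that(2,1)]] adN unfolding phi_h by simp
  have c_add: "c i (s + s') = c i s + c i s'" and c_scale: "c i (r *\<^sub>R s) = r * c i s"
    if "s \<in> ?S" "s' \<in> ?S" for i s s' r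
  proof -
    have conv: "convergent (\<lambda>k. apply_bcontfun s (enumerate (?N i) k))" if "s \<in> ?S" for s
    proof -
      obtain y a A where s: "y \<in> c0" "finite A" "s = y + ?sum a A" using rep[OF \<open>s \<in> ?S\<close>] by blast
      show ?thesis
        unfolding convergent_def s(3)
        using JL_coeff_limit[of ?N i A y a, OF infN _ s(2,1)] adN unfolding phi_h by blast
    qed
    note lims = conv[OF that(1), unfolded convergent_LIMSEQ_iff] conv[OF that(2), unfolded convergent_LIMSEQ_iff]
    show "c i (s + s') = c i s + c i s'"
      unfolding c_def by (rule limI) (use tendsto_add[OF lims] in \<open>simp add: plus_bcontfun.rep_eq\<close>)
    show "c i (r *\<^sub>R s) = r * c i s"
      unfolding c_def by (rule limI) (use tendsto_mult_left[OF lims(1), of r] in \<open>simp add: scaleR_bcontfun.rep_eq\<close>)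
  qed
  have norm_le_\<nu>: "norm s \<le> ?\<nu> s" if "s \<in> ?S" for s
    using rep[OF that] \<nu> by auto
  have sum_c: "(\<Sum>i\<in>F. (c i s)\<^sup>2) \<le> (?\<nu> s)\<^sup>2" if s: "s \<in> ?S" and F: "finite F" for s F
  proof -
    obtain y a A where yaA: "y \<in> c0" "finite A" "s = y + ?sum a A" using rep[OF s] by blast
    have "(\<Sum>i\<in>F. (c i s)\<^sup>2) = (\<Sum>i\<in>F \<inter> A. (a i)\<^sup>2)"
      unfolding yaA(3) c[OF yaA(1,2)] using F by (intro sum.mono_neutral_cong_right) auto
    also have "\<dots> \<le> (\<Sum>i\<in>A. (a i)\<^sup>2)" using yaA(2) by (intro sum_mono2) auto
    also have "\<dots> = (L2_set a A)\<^sup>2" by (simp add: L2_set_def sum_nonneg)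
    also have "\<dots> \<le> (?\<nu> s)\<^sup>2" unfolding yaA(3) \<nu>[OF yaA(1,2)] by (intro power_mono) auto
    finally show ?thesis .
  qed
  have "\<exists>f :: 'x \<Rightarrow>\<^sub>L real. (\<forall>s\<in>?S. f (\<iota> s) = apply_bcontfun s k) \<and> (\<forall>x. \<bar>f x\<bar> \<le> norm x)" for k
  proof (rule extend_functional[OF S \<iota>(1,2,4), of "\<lambda>s. apply_bcontfun s k"])
    show "\<bar>apply_bcontfun s k\<bar> \<le> norm (\<iota> s)" if "s \<in> ?S" for s
      using abs_apply_bcontfun_le[of s k] norm_le_\<nu>[OF that] \<iota>(3)[OF that] by simp
  qed (auto simp: plus_bcontfun.rep_eq scaleR_bcontfun.rep_eq)
  then obtain \<delta> :: "nat \<Rightarrow> 'x \<Rightarrow>\<^sub>L real" where \<delta>: "\<And>k s. s \<in> ?S \<Longrightarrow> \<delta> k (\<iota> s) = apply_bcontfun s k"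
    "\<And>k x. \<bar>\<delta> k x\<bar> \<le> norm x"
    by metis
  have "\<exists>f :: 'x \<Rightarrow>\<^sub>L real. (\<forall>s\<in>?S. f (\<iota> s) = c i s)" for i
  proof (rule extend_functional[OF S \<iota>(1,2,4), of "c i"])
    show "\<bar>c i s\<bar> \<le> norm (\<iota> s)" if "s \<in> ?S" for s
    proof -
      have "(c i s)\<^sup>2 \<le> (norm (\<iota> s))\<^sup>2" using sum_c[OF that, of "{i}"] \<iota>(3)[OF that] by simp
      then show ?thesis by (simp add: abs_le_square_iff[symmetric])
    qed
  qed (use c_add c_scale in auto)
  then obtain e :: "'i \<Rightarrow> 'x \<Rightarrow>\<^sub>L real" where e: "\<And>i s. s \<in> ?S \<Longrightarrow> e i (\<iota> s) = c i s" by metis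
  have sum_e: "(\<Sum>i\<in>F. (e i x)\<^sup>2) \<le> (norm x)\<^sup>2" if F: "finite F" for F x
  proof -
    have "closure (\<iota> ` ?S) \<subseteq> {x. (\<Sum>i\<in>F. (e i x)\<^sup>2) \<le> (norm x)\<^sup>2}"
    proof (rule closure_minimal)
      show "\<iota> ` ?S \<subseteq> {x. (\<Sum>i\<in>F. (e i x)\<^sup>2) \<le> (norm x)\<^sup>2}"
        using sum_c[OF _ F] by (auto simp: e \<iota>(3))
      show "closed {x. (\<Sum>i\<in>F. (e i x)\<^sup>2) \<le> (norm x)\<^sup>2}"
        by (intro closed_Collect_le continuous_intros)
    qed
    then show ?thesis using \<iota>(4) by auto
  qed
  have unit_S: "unit_seq k \<in> ?S" for k by (rule c0_S[OF unit_seq_c0])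
  have c_c0: "c i y = 0" if "y \<in> c0" for i y using c[OF that, of "{}" i "\<lambda>_. 0"] by simp
  have c_phi: "c i (phi N (h j)) = (if i = j then 1 else 0)" for i j
    using c[of 0 "{j}" i "\<lambda>_. 1"] subspace_0[OF subspace_c0] by simp
  let ?U = "range (\<lambda>k. \<iota> (unit_seq k)) \<union> range (\<lambda>i. \<iota> (phi N (h i)))"
  have "JL_model ?N (\<lambda>k. \<iota> (unit_seq k)) (\<lambda>i. \<iota> (phi N (h i))) \<delta> e"
  proof
    show "finite (?N i \<inter> ?N j)" if "i \<noteq> j" for i j by (rule adN[OF that])
    show "\<delta> j (\<iota> (unit_seq k)) = (if j = k then 1 else 0)" for j k
      by (simp add: \<delta>(1)[OF unit_S] unit_seq)
    show "e i (\<iota> (unit_seq k)) = 0" for i k by (simp add: e[OF unit_S] c_c0 unit_seq_c0)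
    show "\<delta> k (\<iota> (phi N (h i))) = (if k \<in> ?N i then 1 else 0)" for k i
      by (simp add: \<delta>(1)[OF phi_S] phi_apply indicator_def)
    show "e i (\<iota> (phi N (h j))) = (if i = j then 1 else 0)" for i j by (simp add: e[OF phi_S] c_phi)
    show "\<bar>\<delta> k x\<bar> \<le> norm x" for k x by (rule \<delta>(2))
    show "(\<Sum>i\<in>F. (e i x)\<^sup>2) \<le> (norm x)\<^sup>2" if "finite F" for F x by (rule sum_e[OF that])
    show "closure (span ?U) = UNIV"
    proof -
      have "\<iota> s \<in> closure (span ?U)" if "s \<in> ?S" for s
      proof -
        obtain y a A where yaA: "y \<in> c0" "finite A" "s = y + ?sum a A" using rep[OF \<open>s \<in> ?S\<close>] by blast
        have "\<iota> y \<in> closure (span ?U)"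
          unfolding closure_approachable
        proof (intro allI impI)
          fix \<epsilon> :: real assume \<epsilon>: "0 < \<epsilon>"
          then have \<epsilon>2: "0 < \<epsilon> / 2" by simp
          obtain n where n: "norm (y - (\<Sum>k<n. apply_bcontfun y k *\<^sub>R unit_seq k)) \<le> \<epsilon> / 2"
            using c0_approximation[OF yaA(1) \<epsilon>2] by blast
          let ?y = "\<Sum>k<n. apply_bcontfun y k *\<^sub>R unit_seq k"
          have y_c0: "?y \<in> c0" by (intro subspace_sum subspace_scale subspace_c0 unit_seq_c0)
          have d_c0: "y - ?y \<in> c0" using subspace_c0 yaA(1) y_c0 by (simp add: subspace_diff)
          have "\<iota> y = \<iota> ((y - ?y) + ?y)" by simp
          also have "\<dots> = \<iota> (y - ?y) + \<iota> ?y" using c0_S[OF d_c0] c0_S[OF y_c0] by (rule \<iota>(1))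
          finally have "dist (\<iota> ?y) (\<iota> y) = norm (y - ?y)"
            using norm_c0[OF d_c0] by (simp add: dist_norm)
          also have "\<dots> < \<epsilon>" using n \<epsilon> by simp
          finally have "dist (\<iota> ?y) (\<iota> y) < \<epsilon>" .
          moreover have "\<iota> ?y = (\<Sum>k<n. apply_bcontfun y k *\<^sub>R \<iota> (unit_seq k))"
            by (rule linear_on_subspace_sum[OF S \<iota>(1,2) unit_S])
          then have "\<iota> ?y \<in> span ?U"
            by (simp only:) (intro span_sum span_scale span_base, auto)
          ultimately show "\<exists>z\<in>span ?U. dist z (\<iota> y) < \<epsilon>" by blast
        qed
        moreover have "\<iota> (?sum a A) \<in> closure (span ?U)"
        proof -
          have "\<iota> (?sum a A) = (\<Sum>i\<in>A. a i *\<^sub>R \<iota> (phi N (h i)))"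
            by (rule linear_on_subspace_sum[OF S \<iota>(1,2) phi_S])
          then have "\<iota> (?sum a A) \<in> span ?U"
            by (simp only:) (intro span_sum span_scale span_base, auto)
          then show ?thesis using closure_subset by blast
        qed
        moreover have "\<iota> s = \<iota> y + \<iota> (?sum a A)"
          unfolding yaA(3) using c0_S[OF yaA(1)] sum_S by (rule \<iota>(1))
        ultimately show ?thesis
          using subspace_closure[OF subspace_span[of ?U]] by (simp add: subspace_add)
      qed
      then have "closure (\<iota> ` ?S) \<subseteq> closure (span ?U)"
        by (intro closure_minimal) auto
      then show ?thesis using \<iota>(4) by auto
    qed
    \<comment> \<open>An approximation \<open>\<iota> s\<close> within \<open>\<epsilon> / 2\<close>
      inherits both bounds up to \<open>\<epsilon> / 2\<close>, and on \<open>JL0\<close> the norm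
      is the maximum of the two bounded quantities.\<close>
    show "norm x \<le> C"
      if C: "0 \<le> C" "\<And>k. \<bar>\<delta> k x\<bar> \<le> C" "\<And>F. finite F \<Longrightarrow> (\<Sum>i\<in>F. (e i x)\<^sup>2) \<le> C\<^sup>2" for C x
    proof (rule field_le_epsilon)
      fix \<epsilon> :: real assume \<epsilon>: "0 < \<epsilon>"
      then have "0 < \<epsilon> / 2" by simp
      moreover have "x \<in> closure (\<iota> ` ?S)" using \<iota>(4) by simp
      ultimately obtain s where s: "s \<in> ?S" "dist (\<iota> s) x < \<epsilon> / 2"
        unfolding closure_approachable by blast
      obtain y a A where yaA: "y \<in> c0" "finite A" "s = y + ?sum a A" using rep[OF s(1)] by blast
      have "norm s \<le> C + \<epsilon> / 2"
      proof (rule norm_bound)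
        fix k
        have "\<bar>\<delta> k (\<iota> s - x)\<bar> \<le> norm (\<iota> s - x)" by (rule \<delta>(2))
        then have "\<bar>\<delta> k (\<iota> s)\<bar> \<le> C + \<epsilon> / 2"
          using C(2)[of k] s(2) by (simp add: blinfun.diff_right dist_norm)
        then show "norm (apply_bcontfun s k) \<le> C + \<epsilon> / 2" by (simp add: \<delta>(1)[OF s(1)])
      qed
      moreover have "L2_set a A \<le> C + \<epsilon> / 2"
      proof -
        have "e i (\<iota> s) = a i" if "i \<in> A" for i
          unfolding e[OF s(1)] unfolding yaA(3) c[OF yaA(1,2)] using that by simp
        then have "L2_set a A = L2_set (\<lambda>i. e i x + e i (\<iota> s - x)) A"
          by (intro L2_set_cong) (simp_all add: blinfun.diff_right)
        also have "\<dots> \<le> L2_set (\<lambda>i. e i x) A + L2_set (\<lambda>i. e i (\<iota> s - x)) A"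
          by (rule L2_set_triangle_ineq)
        also have "L2_set (\<lambda>i. e i x) A \<le> C"
          unfolding L2_set_def using C(1,3) yaA(2) by (intro real_le_lsqrt) (auto simp: sum_nonneg)
        also have "L2_set (\<lambda>i. e i (\<iota> s - x)) A \<le> norm (\<iota> s - x)"
          unfolding L2_set_def using sum_e yaA(2) by (intro real_le_lsqrt) (auto simp: sum_nonneg)
        finally show ?thesis using s(2) by (simp add: dist_norm)
      qed
      ultimately have "norm (\<iota> s) \<le> C + \<epsilon> / 2"
        unfolding \<iota>(3)[OF s(1)] unfolding yaA(3) \<nu>[OF yaA(1,2)] by simp
      then show "norm x \<le> C + \<epsilon>"
        using norm_triangle_ineq2[of x "\<iota> s"] s(2) by (simp add: dist_norm norm_minus_commute)
    qed
  qed
  then show "\<exists>\<delta> e. JL_model ?N (\<lambda>k. \<iota> (unit_seq k)) (\<lambda>i. \<iota> (phi N (h i))) \<delta> e" by blast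
qed

text \<open>A convergent sequence of images comes from a Cauchy sequence in \<open>V\<close>, whose
  limit in the complete \<open>V\<close> is mapped to the limit of the images.\<close>

lemma subspace_closed_isometric_image:
  fixes \<iota> :: "'a::real_normed_vector \<Rightarrow> 'b::real_normed_vector"
  assumes V: "subspace V" "complete V"
    and \<iota>: "\<And>x y. x \<in> V \<Longrightarrow> y \<in> V \<Longrightarrow> \<iota> (x + y) = \<iota> x + \<iota> y" "\<And>c x. x \<in> V \<Longrightarrow> \<iota> (c *\<^sub>R x) = c *\<^sub>R \<iota> x"
      "\<And>x. x \<in> V \<Longrightarrow> norm (\<iota> x) = norm x"
  shows "subspace (\<iota> ` V)" "closed (\<iota> ` V)"
proof -
  show sub: "subspace (\<iota> ` V)"
  proof (rule subspaceI)
    show "0 \<in> \<iota> ` V" using \<iota>(2)[OF subspace_0[OF V(1)], of 0] subspace_0[OF V(1)] by force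
    show "a + b \<in> \<iota> ` V" if "a \<in> \<iota> ` V" "b \<in> \<iota> ` V" for a b
      using that \<iota>(1) subspace_add[OF V(1)] by (auto simp flip: \<iota>(1))
    show "c *\<^sub>R a \<in> \<iota> ` V" if "a \<in> \<iota> ` V" for c a
      using that subspace_scale[OF V(1)] by (auto simp flip: \<iota>(2))
  qed
  have diff: "norm (\<iota> x - \<iota> y) = norm (x - y)" if "x \<in> V" "y \<in> V" for x y
  proof -
    have y: "(- 1) *\<^sub>R y \<in> V" using V(1) that(2) by (rule subspace_scale)
    have "x + (- 1) *\<^sub>R y \<in> V" by (rule subspace_add[OF V(1) that(1) y])
    from \<iota>(3)[OF this] show ?thesis
      unfolding \<iota>(1)[OF that(1) y] \<iota>(2)[OF that(2)] by simp
  qed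
  show "closed (\<iota> ` V)"
    unfolding closed_sequential_limits
  proof (intro allI impI, elim conjE)
    fix z l assume z: "\<forall>n. z n \<in> \<iota> ` V" "z \<longlonglongrightarrow> l"
    have "\<forall>n. \<exists>x. x \<in> V \<and> z n = \<iota> x" using z(1) by blast
    from choice[OF this] obtain y where "\<forall>n. y n \<in> V \<and> z n = \<iota> (y n)" ..
    then have y: "y n \<in> V" "z n = \<iota> (y n)" for n by simp_all
    have "Cauchy z" using z(2) by (rule LIMSEQ_imp_Cauchy)
    then have "Cauchy y" unfolding Cauchy_def dist_norm y(2) diff[OF y(1) y(1)] .
    then obtain a where aV: "a \<in> V" and a: "y \<longlonglongrightarrow> a"
      using V(2) y(1) unfolding complete_def by blast
    have "(\<lambda>n. norm (\<iota> (y n) - \<iota> a)) \<longlonglongrightarrow> 0"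
      unfolding diff[OF y(1) aV] using a by (simp add: LIM_zero tendsto_norm_zero)
    then have "z \<longlonglongrightarrow> \<iota> a" unfolding y(2) by (rule LIM_zero_cancel[OF tendsto_norm_zero_cancel])
    then show "l \<in> \<iota> ` V" using LIMSEQ_unique[OF z(2)] aV by blast
  qed
qed

lemma closed_complemented:
  fixes N :: "'a::banach set"
  assumes "complemented N"
  shows "closed N"
proof -
  obtain P :: "'a \<Rightarrow>\<^sub>L 'a" where P: "\<And>x. P (P x) = P x" "range P = N"
    using assms unfolding complemented_def by blast
  have "N = {x. P x = x}" using P by (auto, metis rangeI)
  moreover have "closed {x. P x = x}" by (intro closed_Collect_eq continuous_intros)
  ultimately show ?thesis by simp
qed

text \<open>A complemented subspace containing \<open>Q -` M\<close> contains the kernel of \<open>Q\<close>, hence is the preimage of its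
  image.\<close>

lemma superprojective_quotient_map:
  fixes Q :: "'a::banach \<Rightarrow>\<^sub>L 'b::banach"
  assumes super: "superprojective_space TYPE('a)" and Q: "is_quotient_by V Q"
  shows "superprojective_operator Q"
  unfolding superprojective_operator_def
proof (intro allI impI, elim conjE)
  fix M :: "'b set" assume M: "subspace M" "closed M" "infinite_codimensional M"
  have V: "subspace V" and surj: "surj Q" and norm_Q: "\<And>x. norm (Q x) = infdist x V"
    using Q by (simp_all add: is_quotient_by_def)
  have closedV: "closed V" using Q by (simp add: is_quotient_by_def)
  have V_ne: "V \<noteq> {}" using subspace_0[OF V] by blast
  have linQ: "linear Q" by (simp add: blinfun.bounded_linear_right bounded_linear.linear)
  have Q0: "Q x = 0 \<longleftrightarrow> x \<in> V" for x
    using norm_Q[of x] in_closed_iff_infdist_zero[OF closedV V_ne, of x] by (metis norm_eq_zero)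
  let ?K = "Q -` M"
  have "subspace ?K" using M(1) linQ by (intro linear_subspace_vimage)
  moreover have "closed ?K"
    by (rule closed_vimage[OF M(2)]) (intro continuous_intros)
  moreover have "infinite_codimensional ?K"
    unfolding infinite_codimensional_def
  proof
    assume "\<exists>B. finite B \<and> span (?K \<union> B) = UNIV"
    then obtain B where B: "finite B" "span (?K \<union> B) = UNIV" by blast
    have "UNIV = Q ` span (?K \<union> B)" using B(2) surj by simp
    also have "\<dots> = span (Q ` (?K \<union> B))" by (rule linear_span_image[OF linQ, symmetric])
    also have "\<dots> \<subseteq> span (M \<union> Q ` B)" by (intro span_mono) auto
    finally show False using M(3) B(1) unfolding infinite_codimensional_def by auto
  qed
  ultimately obtain N where N: "?K \<subseteq> N" "subspace N" "infinite_codimensional N" "complemented N"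
    using super unfolding superprojective_space_def by blast
  have closedN: "closed N" by (rule closed_complemented[OF N(4)])
  have VN: "V \<subseteq> N" using N(1) subspace_0[OF M(1)] Q0 by (auto simp flip: Q0)
  have pre: "Q -` (Q ` N) = N"
  proof
    show "Q -` (Q ` N) \<subseteq> N"
    proof
      fix x assume "x \<in> Q -` (Q ` N)"
      then obtain n where n: "n \<in> N" "Q x = Q n" by auto
      then have "x - n \<in> V" by (simp add: blinfun.diff_right flip: Q0)
      then have "(x - n) + n \<in> N" using VN n(1) N(2) by (blast intro: subspace_add)
      then show "x \<in> N" by simp
    qed
  qed auto
  show "\<exists>N. M \<subseteq> N \<and> subspace N \<and> closed N \<and> infinite_codimensional N \<and> complemented (Q -` N)"
  proof (intro exI[of _ "Q ` N"] conjI)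
    show "M \<subseteq> Q ` N"
    proof
      fix y assume "y \<in> M"
      moreover obtain x where "y = Q x" using surj by blast
      ultimately show "y \<in> Q ` N" using N(1) by auto
    qed
    show "subspace (Q ` N)" using linQ N(2) by (rule linear_subspace_image)
    show "complemented (Q -` (Q ` N))" unfolding pre by (rule N(4))
    show "closed (Q ` N)"
      unfolding closed_sequential_limits
    proof (intro allI impI, elim conjE)
      fix z l assume z: "\<forall>n. z n \<in> Q ` N" "z \<longlonglongrightarrow> l"
      obtain x where x: "l = Q x" using surj by blast
      \<comment> \<open>The quotient norm is the distance to \<open>V\<close>, so a point of
        \<open>Q\<close> near \<open>l\<close> has a lift in \<open>N\<close> that comes near
        \<open>x\<close> after correction by an element of \<open>V\<close>, which lies in
        \<open>N\<close> as well.\<close>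
      have "x \<in> closure N"
        unfolding closure_approachable
      proof (intro allI impI)
        fix \<epsilon> :: real assume "0 < \<epsilon>"
        then obtain n where n: "norm (z n - l) < \<epsilon>" using LIMSEQ_D[OF z(2)] by blast
        obtain y where y: "y \<in> N" "z n = Q y" using z(1) by blast
        have "infdist (y - x) V < \<epsilon>"
          using n unfolding norm_Q[symmetric] by (simp add: x y blinfun.diff_right)
        then obtain v where v: "v \<in> V" "dist (y - x) v < \<epsilon>"
          using infdist_less_witness[OF V_ne] by blast
        have "y - v \<in> N" using N(2) y(1) v(1) VN by (blast intro: subspace_diff)
        moreover have "dist (y - v) x < \<epsilon>" using v(2) by (simp add: dist_norm algebra_simps)
        ultimately show "\<exists>y\<in>N. dist y x < \<epsilon>" by blast
      qed
      then show "l \<in> Q ` N" using closedN x by simp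
    qed
    show "infinite_codimensional (Q ` N)"
      unfolding infinite_codimensional_def
    proof
      assume "\<exists>B. finite B \<and> span (Q ` N \<union> B) = UNIV"
      then obtain B where B: "finite B" "span (Q ` N \<union> B) = UNIV" by blast
      obtain B' where B': "finite B'" "Q ` B' = B"
        using finite_subset_image[OF B(1), of Q UNIV] surj by auto
      have "x \<in> span (N \<union> B')" for x
      proof -
        have "Q x \<in> span (Q ` (N \<union> B'))" using B(2) B'(2) by (simp add: image_Un)
        then obtain z where z: "z \<in> span (N \<union> B')" "Q x = Q z"
          unfolding linear_span_image[OF linQ] by blast
        then have "x - z \<in> N" using VN by (auto simp: blinfun.diff_right simp flip: Q0)
        then have "x - z \<in> span (N \<union> B')" by (simp add: span_base)
        from span_add[OF this z(1)] show ?thesis by simp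
      qed
      then have "span (N \<union> B') = UNIV" by auto
      then show False using N(3) B'(1) unfolding infinite_codimensional_def by blast
    qed
  qed
qed

theorem proposition3p5:
  fixes \<Gamma> :: "'g set" and N :: "'g \<Rightarrow> nat set"
    and \<iota> :: "(nat \<Rightarrow>\<^sub>C real) \<Rightarrow> 'x::banach"
  assumes "\<Gamma> \<approx> (UNIV :: real set)"
    and "\<And>\<gamma>. \<gamma> \<in> \<Gamma> \<Longrightarrow> infinite (N \<gamma>)"
    and "\<And>\<gamma> \<gamma>'. \<gamma> \<in> \<Gamma> \<Longrightarrow> \<gamma>' \<in> \<Gamma> \<Longrightarrow> \<gamma> \<noteq> \<gamma>' \<Longrightarrow> finite (N \<gamma> \<inter> N \<gamma>')"
    and "is_completion (JL0 \<Gamma> N) (JL_norm \<Gamma> N) \<iota>"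
  shows "subprojective_operator (\<iota> ` c0) (\<lambda>x. x) \<and>
    (\<forall>Q :: 'x \<Rightarrow>\<^sub>L 'q::banach. is_quotient_by (\<iota> ` c0) Q \<longrightarrow> superprojective_operator Q) \<and>
    (subprojective_space TYPE('x) \<and> superprojective_space TYPE('x)) \<and>
    (subprojective_space TYPE('x \<Rightarrow>\<^sub>L real) \<and> \<not> superprojective_space TYPE('x \<Rightarrow>\<^sub>L real)) \<and>
    (\<not> subprojective_space TYPE(('x \<Rightarrow>\<^sub>L real) \<Rightarrow>\<^sub>L real) \<and>
     \<not> superprojective_space TYPE(('x \<Rightarrow>\<^sub>L real) \<Rightarrow>\<^sub>L real))"
proof -
  \<comment> \<open>The type \<open>real\<close> replaces \<Gamma> as index set, because the
    coordinate description quantifies over a whole index type.\<close>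
  obtain h :: "real \<Rightarrow> 'g" where h: "bij_betw h UNIV \<Gamma>"
    using eqpoll_sym[OF assms(1)] unfolding eqpoll_def by blast
  note model = JL_model_completion[OF h assms(2-4)]
  obtain \<delta> e where JL: "JL_model (\<lambda>i. N (h i)) (\<lambda>k. \<iota> (unit_seq k)) (\<lambda>i. \<iota> (phi N (h i))) \<delta> e"
    using model(1) by blast
  have sub: "subprojective_space TYPE('x)"
    unfolding subprojective_space_def using JL_model.subprojective_JL[OF JL] by blast
  have super: "superprojective_space TYPE('x)"
    unfolding superprojective_space_def using JL_model.superprojective_JL[OF JL] by blast
  have sub_dual: "subprojective_space TYPE('x \<Rightarrow>\<^sub>L real)"
    unfolding subprojective_space_def using JL_model.subprojective_dual[OF JL] by blast
  have c0_S: "y \<in> JL0 \<Gamma> N" if "y \<in> c0" for y using that by (auto simp: JL0_def intro: span_base)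
  have V: "subspace (\<iota> ` c0)" "closed (\<iota> ` c0)"
    using assms(4) c0_S
    by (auto intro!: subspace_closed_isometric_image[OF subspace_c0 complete_c0] model(2) simp: is_completion_def)
  have "subprojective_operator (\<iota> ` c0) (\<lambda>x. x)"
    unfolding subprojective_operator_def
  proof (intro conjI allI impI)
    show "operator_on (\<iota> ` c0) (\<lambda>x. x)"
      unfolding operator_on_def using V by (auto intro: exI[of _ 1])
    \<comment> \<open>The inclusion maps every subspace to itself, so it suffices to find a subspace
      of \<open>M\<close> that is complemented in the whole space.\<close>
    fix M assume "M \<subseteq> \<iota> ` c0"
      "subspace M \<and> closed M \<and> infinite_dimensional M \<and> bounded_below_on M (\<lambda>x. x)"
    then obtain N' where N': "N' \<subseteq> M" "subspace N'" "infinite_dimensional N'" "complemented N'"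
      using sub unfolding subprojective_space_def by blast
    then show "\<exists>N'\<subseteq>M. subspace N' \<and> closed N' \<and> infinite_dimensional N' \<and> complemented ((\<lambda>x. x) ` N')"
      using closed_complemented by (intro exI[of _ N']) simp
  qed
  then show ?thesis
    using sub super sub_dual superprojective_quotient_map[OF super]
      JL_model.not_superprojective_dual[OF JL] JL_model.not_projective_bidual[OF JL] by blast
qed

end
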